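(* Let $\psi\in C([-1,1])$ be even, and let $\mu$ be a finite signed Borel measure on $\mathbb S^{d-1}$ with $\mu(\mathbb S^{d-1})=1$. The following are equivalent. (i) For every $K\in\mathcal K^d_\circ$, $\int\mathcal B_\psi K\,d\mu=\int\mathcal B_\psi K\,d\sigma$. (ii) $T_\psi\mu(v)=\lambda_0(\psi)$ for all $v\in\mathbb S^{d-1}$. (iii) For every $\ell\ge1$ and every $Y\in\mathcal H_\ell$, $\lambda_\ell(\psi)\int Y\,d\mu=0$. (iv) $\int Y\,d\mu=0$ for all $Y\in\mathcal H_\ell$ and all $\ell\in\Lambda_\psi$.
   Context: Fix an integer $d\ge 2$. $\sigma$ is the normalized rotation-invariant Borel probability measure on the unit sphere $\mathbb S^{d-1}\subset\mathbb R^d$. $\mathcal K^d_\circ$ is the set of convex bodies (compact convex sets) in $\mathbb R^d$ with nonempty interior. For $K\in\mathcal K^d_\circ$, the surface area measure $S_K$ on $\mathbb S^{d-1}$ is the pushforward of $(d-1)$-dimensional Hausdorff measure on $\partial K$ under the ($\mathcal H^{d-1}$-a.e. defined) outer Gauss map. For even $\psi\in C([-1,1])$ (real-valued), define $$\mathcal B_\psi K(u):=\frac12\int_{\mathbb S^{d-1}}\psi(\langle u,v\rangle)\,dS_K(v),\qquad u\in\mathbb S^{d-1}.$$ For a finite signed Borel measure $\nu$ on $\mathbb S^{d-1}$, $(T_\psi\nu)(v):=\int_{\mathbb S^{d-1}}\psi(\langle u,v\rangle)\,d\nu(u)$. $\mathcal H_\ell$ denotes the space of restrictions to $\mathbb S^{d-1}$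 of real homogeneous harmonic polynomials of degree $\ell$ on $\mathbb R^d$. The Funk--Hecke multiplier $\lambda_\ell(\psi)$ is the scalar such that $\int_{\mathbb S^{d-1}}\psi(\langle u,v\rangle)Y(v)\,d\sigma(v)=\lambda_\ell(\psi)Y(u)$ for all $Y\in\mathcal H_\ell$, $u\in\mathbb S^{d-1}$ (it exists by the Funk--Hecke theorem); in particular $\lambda_0(\psi)=\int\psi(\langle u,e\rangle)\,d\sigma(u)$ for any $e\in\mathbb S^{d-1}$. The active spectrum is $\Lambda_\psi:=\{\ell\ge1:\lambda_\ell(\psi)\ne0\}$. *)

theory Defs
  imports "HOL-Analysis.Analysis" "HOL-Probability.Probability"
begin

section \<open>The sphere and its rotation-invariant probability measure\<close>

abbreviation unit_sphere :: "'a::real_normed_vector set" where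
  "unit_sphere \<equiv> sphere 0 1"

definition borel_sphere :: "'a::real_normed_vector measure" where
  "borel_sphere = restrict_space borel unit_sphere"

text \<open>
  The measure on the sphere is described by its defining property rather than constructed;
  lemma \<open>spherical_prob_exists\<close> below shows that the property is satisfiable, and
  in dimension at least two it determines the measure.
\<close>

definition is_spherical_prob :: "(real^'n) measure \<Rightarrow> bool" where
  "is_spherical_prob \<sigma> \<longleftrightarrow>
     sets \<sigma> = sets borel_sphere \<and> prob_space \<sigma> \<and>
     (\<forall>Q. rotation_matrix Q \<longrightarrow> distr \<sigma> \<sigma> (\<lambda>x. Q *v x) = \<sigma>)"

section \<open>Hausdorff measure\<close>

text \<open>
  The measure is normalised so that it agrees with Lebesgue measure on \<open>k\<close>-dimensional
  subspaces. It is meant for \<open>k \<ge> 1\<close>: then empty and one-point sets of a cover contribute 0.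
  The requirement \<open>bounded (C i)\<close> is needed because \<^const>\<open>diameter\<close> is unspecified
  on unbounded sets.
\<close>

definition hausdorff_content :: "nat \<Rightarrow> real \<Rightarrow> 'a::metric_space set \<Rightarrow> ennreal" where
  "hausdorff_content k \<delta> A =
     (INF C \<in> {C :: nat \<Rightarrow> 'a set. A \<subseteq> (\<Union>i. C i) \<and> (\<forall>i. bounded (C i) \<and> diameter (C i) \<le> \<delta>)}.
        \<Sum>i. ennreal (unit_ball_vol (real k) * (diameter (C i) / 2) ^ k))"

definition hausdorff_outer :: "nat \<Rightarrow> 'a::metric_space set \<Rightarrow> ennreal" where
  "hausdorff_outer k A = (SUP \<delta> \<in> {0<..}. hausdorff_content k \<delta> A)"

definition hausdorff_measure :: "nat \<Rightarrow> 'a::metric_space measure" where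
  "hausdorff_measure k = measure_of UNIV (sets borel) (hausdorff_outer k)"

section \<open>Convex bodies and the surface area measure\<close>

definition convex_body :: "'a::euclidean_space set \<Rightarrow> bool" where
  "convex_body K \<longleftrightarrow> compact K \<and> convex K \<and> interior K \<noteq> {}"

definition outer_unit_normal :: "'a::euclidean_space set \<Rightarrow> 'a \<Rightarrow> 'a \<Rightarrow> bool" where
  "outer_unit_normal K x u \<longleftrightarrow> u \<in> unit_sphere \<and> (\<forall>y\<in>K. u \<bullet> y \<le> u \<bullet> x)"

definition regular_points :: "'a::euclidean_space set \<Rightarrow> 'a set" where
  "regular_points K = {x \<in> frontier K. \<exists>!u. outer_unit_normal K x u}"

definition gauss_map :: "'a::euclidean_space set \<Rightarrow> 'a \<Rightarrow> 'a" where
  "gauss_map K x = (THE u. outer_unit_normal K x u)"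

text \<open>
  The Gauss map is defined precisely on the regular boundary points, which are
  almost all boundary points with respect to the \<open>(d-1)\<close>-dimensional Hausdorff measure.
\<close>

definition surface_area_measure :: "'a::euclidean_space set \<Rightarrow> 'a measure" where
  "surface_area_measure K =
     distr (restrict_space (hausdorff_measure (DIM('a) - 1)) (regular_points K))
       borel_sphere (gauss_map K)"

definition B_op :: "(real \<Rightarrow> real) \<Rightarrow> 'a::euclidean_space set \<Rightarrow> 'a \<Rightarrow> real" where
  "B_op \<psi> K u = 1/2 * (\<integral>v. \<psi> (u \<bullet> v) \<partial>surface_area_measure K)"

section \<open>Finite signed measures\<close>

text \<open>
  A finite signed measure on the measurable space \<open>M\<close> (whose own measure is irrelevant) is a
  countably additive real-valued set function on \<open>sets M\<close>. Integrals are taken against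
  its Jordan decomposition; in \<open>positive_variation\<close>, \<^const>\<open>ennreal\<close> sends
  negative values to 0.
\<close>

definition finite_signed_measure :: "'a measure \<Rightarrow> ('a set \<Rightarrow> real) \<Rightarrow> bool" where
  "finite_signed_measure M \<mu> \<longleftrightarrow>
     \<mu> {} = 0 \<and>
     (\<forall>A :: nat \<Rightarrow> 'a set. range A \<subseteq> sets M \<longrightarrow> disjoint_family A \<longrightarrow>
        (\<lambda>i. \<mu> (A i)) sums \<mu> (\<Union>i. A i))"

definition positive_variation :: "'a measure \<Rightarrow> ('a set \<Rightarrow> real) \<Rightarrow> 'a measure" where
  "positive_variation M \<mu> =
     measure_of (space M) (sets M) (\<lambda>A. SUP B \<in> {B \<in> sets M. B \<subseteq> A}. ennreal (\<mu> B))"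

definition negative_variation :: "'a measure \<Rightarrow> ('a set \<Rightarrow> real) \<Rightarrow> 'a measure" where
  "negative_variation M \<mu> = positive_variation M (\<lambda>A. - \<mu> A)"

definition signed_integral :: "'a measure \<Rightarrow> ('a set \<Rightarrow> real) \<Rightarrow> ('a \<Rightarrow> real) \<Rightarrow> real" where
  "signed_integral M \<mu> f =
     (\<integral>x. f x \<partial>positive_variation M \<mu>) - (\<integral>x. f x \<partial>negative_variation M \<mu>)"

definition T_op :: "(real \<Rightarrow> real) \<Rightarrow> ('a::euclidean_space set \<Rightarrow> real) \<Rightarrow> 'a \<Rightarrow> real" where
  "T_op \<psi> \<nu> v = signed_integral borel_sphere \<nu> (\<lambda>u. \<psi> (u \<bullet> v))"

section \<open>Spherical harmonics and multipliers\<close>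

definition homogeneous_polynomial :: "nat \<Rightarrow> (real^'n \<Rightarrow> real) \<Rightarrow> bool" where
  "homogeneous_polynomial l p \<longleftrightarrow>
     (\<exists>c :: ('n \<Rightarrow> nat) \<Rightarrow> real.
        \<forall>x. p x = (\<Sum>\<alpha> | (\<Sum>i\<in>UNIV. \<alpha> i) = l. c \<alpha> * (\<Prod>i\<in>UNIV. (x $ i) ^ \<alpha> i)))"

definition laplacian :: "(real^'n \<Rightarrow> real) \<Rightarrow> real^'n \<Rightarrow> real" where
  "laplacian p x = (\<Sum>i\<in>UNIV. (deriv ^^ 2) (\<lambda>t. p (x + t *\<^sub>R axis i 1)) 0)"

definition spherical_harmonics :: "nat \<Rightarrow> (real^'n \<Rightarrow> real) set" where
  "spherical_harmonics l =
     {restrict p unit_sphere | p. homogeneous_polynomial l p \<and> (\<forall>x. laplacian p x = 0)}"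

definition multiplier :: "(real^'n) measure \<Rightarrow> (real \<Rightarrow> real) \<Rightarrow> nat \<Rightarrow> real" where
  "multiplier \<sigma> \<psi> l =
     (THE c. \<forall>Y\<in>spherical_harmonics l. \<forall>u\<in>unit_sphere.
        (\<integral>v. \<psi> (u \<bullet> v) * Y v \<partial>\<sigma>) = c * Y u)"

definition active_spectrum :: "(real^'n) measure \<Rightarrow> (real \<Rightarrow> real) \<Rightarrow> nat set" where
  "active_spectrum \<sigma> \<psi> = {l. l \<ge> 1 \<and> multiplier \<sigma> \<psi> l \<noteq> 0}"

section \<open>Existence of the spherical measure\<close>

lemma lborel_distr_orthogonal:
  fixes f :: "'a::euclidean_space \<Rightarrow> 'a"
  assumes f: "orthogonal_transformation f"
  shows "distr lborel borel f = lborel"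
proof (rule measure_eqI)
  fix A assume "A \<in> sets (distr lborel borel f)"
  then have A[measurable]: "A \<in> sets borel" by simp
  define b where "b = ball (0::'a) 1"
  have b[measurable]: "b \<in> sets borel" by (simp add: b_def)
  have lin: "linear f" using f by (rule orthogonal_transformation_linear)
  have fm[measurable]: "f \<in> borel_measurable borel"
    using lin by (intro borel_measurable_continuous_onI linear_continuous_on linear_conv_bounded_linear[THEN iffD1])
  have surj: "\<exists>w. x = f w" for x using orthogonal_transformation_surj[OF f] by (auto simp: surj_def)
  have nf: "norm (f x) = norm x" for x using f by (simp add: orthogonal_transformation)
  have aff: "(\<integral>\<^sup>+x. g (t + c *\<^sub>R x) \<partial>lborel) = (\<integral>\<^sup>+x. g x \<partial>lborel)"
    if [measurable]: "g \<in> borel_measurable borel" and c: "\<bar>c\<bar> = 1" for g and t :: 'a and c :: real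
  proof -
    have "(\<integral>\<^sup>+x. g x \<partial>lborel) = (\<integral>\<^sup>+x. g x \<partial>density (distr lborel borel (\<lambda>x. t + c *\<^sub>R x)) (\<lambda>_. 1))"
      using lborel_affine[of c t] c by (auto simp: ennreal_1[symmetric] simp del: ennreal_1)
    then show ?thesis by (simp add: density_1 nn_integral_distr)
  qed
  have sh: "(\<integral>\<^sup>+y. g (y - w) \<partial>lborel) = (\<integral>\<^sup>+x. g x \<partial>lborel)"
    if "g \<in> borel_measurable borel" for g :: "'a \<Rightarrow> ennreal" and w
    using aff[OF that, of 1 "-w"] by simp
  have ball_int: "(\<integral>\<^sup>+y. indicator b (f y - x) \<partial>lborel) = emeasure lborel b" for x
  proof -
    obtain w where w: "x = f w" using surj by blast
    have "(\<integral>\<^sup>+y. indicator b (f y - x) \<partial>lborel) = (\<integral>\<^sup>+y. indicator b (y - w) \<partial>lborel)"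
      by (rule nn_integral_cong) (auto simp: w b_def indicator_def nf linear_diff[OF lin, symmetric])
    also have "\<dots> = (\<integral>\<^sup>+y. indicator b y \<partial>lborel)" by (rule sh) simp
    finally show ?thesis by simp
  qed
  have A_int: "(\<integral>\<^sup>+y. indicator A (f y - x) \<partial>lborel) = emeasure (distr lborel borel f) A" for x
  proof -
    obtain w where w: "x = f w" using surj by blast
    have "(\<integral>\<^sup>+y. indicator A (f y - x) \<partial>lborel) = (\<integral>\<^sup>+y. indicator A (f (y - w)) \<partial>lborel)"
      by (simp add: w linear_diff[OF lin])
    also have "\<dots> = (\<integral>\<^sup>+y. indicator A (f y) \<partial>lborel)" by (rule sh) measurable
    also have "\<dots> = (\<integral>\<^sup>+y. indicator A y \<partial>distr lborel borel f)" by (subst nn_integral_distr) simp_all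
    also have "\<dots> = emeasure (distr lborel borel f) A" by (rule nn_integral_indicator) simp
    finally show ?thesis .
  qed
  have "emeasure lborel A * emeasure lborel b =
      (\<integral>\<^sup>+x. indicator A x * (\<integral>\<^sup>+y. indicator b (f y - x) \<partial>lborel) \<partial>lborel)"
    by (simp add: ball_int nn_integral_multc)
  also have "\<dots> = (\<integral>\<^sup>+x. \<integral>\<^sup>+y. indicator A x * indicator b (f y - x) \<partial>lborel \<partial>lborel)"
    by (simp add: nn_integral_cmult)
  also have "\<dots> = (\<integral>\<^sup>+y. \<integral>\<^sup>+x. indicator A x * indicator b (f y - x) \<partial>lborel \<partial>lborel)"
    by (rule lborel_pair.Fubini'[symmetric]) measurable
  also have "\<dots> = (\<integral>\<^sup>+y. \<integral>\<^sup>+z. indicator A (f y - z) * indicator b z \<partial>lborel \<partial>lborel)"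
  proof (rule nn_integral_cong)
    fix y
    show "(\<integral>\<^sup>+x. indicator A x * indicator b (f y - x) \<partial>lborel) =
        (\<integral>\<^sup>+z. indicator A (f y - z) * indicator b z \<partial>lborel)"
      using aff[of "\<lambda>x. indicator A x * indicator b (f y - x)" "-1" "f y", symmetric] by simp
  qed
  also have "\<dots> = (\<integral>\<^sup>+z. \<integral>\<^sup>+y. indicator A (f y - z) * indicator b z \<partial>lborel \<partial>lborel)"
    by (rule lborel_pair.Fubini') measurable
  also have "\<dots> = emeasure (distr lborel borel f) A * emeasure lborel b"
    by (simp add: nn_integral_multc A_int nn_integral_cmult)
  finally have "emeasure (distr lborel borel f) A * emeasure lborel b = emeasure lborel A * emeasure lborel b" ..
  moreover have "emeasure lborel b = ennreal (unit_ball_vol (real DIM('a)))"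
    by (simp add: b_def emeasure_ball)
  moreover have "unit_ball_vol (real DIM('a)) > 0" by simp
  ultimately show "emeasure (distr lborel borel f) A = emeasure lborel A"
    by (simp add: mult_right_ennreal_cancel not_le[symmetric])
qed simp
lemma spherical_prob_exists: "\<exists>\<sigma> :: (real^'n) measure. is_spherical_prob \<sigma>"
proof -
  define B where "B = ball (0::real^'n) 1 - {0}"
  define R where "R = restrict_space lborel B"
  define U where "U = uniform_measure R B"
  define \<sigma> where "\<sigma> = distr U borel_sphere sgn"
  have Bs: "B \<in> sets borel" by (simp add: B_def)
  have "emeasure lborel B = emeasure lborel (ball (0::real^'n) 1)"
    unfolding B_def by (subst emeasure_Diff_null_set) (auto simp: null_sets_def)
  also have "\<dots> = ennreal (unit_ball_vol (real CARD('n)))"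
    by (simp add: emeasure_ball)
  finally have eB: "emeasure R B = ennreal (unit_ball_vol (real CARD('n)))"
    using Bs by (simp add: R_def emeasure_restrict_space)
  have vol: "unit_ball_vol (real CARD('n)) > 0" by simp
  have pU: "prob_space U"
    unfolding U_def by (rule prob_space_uniform_measure)
      (use vol in \<open>simp_all only: eB ennreal_neq_top infinity_ennreal_def ennreal_eq_0_iff not_le
        not_False_eq_True\<close>)
  have setsR: "sets R = sets (restrict_space borel B)"
    unfolding R_def by (rule sets_restrict_space_cong) simp
  have setsU: "sets U = sets (restrict_space borel B)"
    by (simp add: U_def setsR)
  have spU: "space U = B" by (simp add: U_def R_def space_restrict_space)
  have sgn_meas: "sgn \<in> measurable U (borel_sphere :: (real^'n) measure)"
    unfolding borel_sphere_def
  proof (rule measurable_restrict_space2)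
    show "sgn \<in> space U \<rightarrow> (unit_sphere :: (real^'n) set)"
      by (auto simp: spU B_def norm_sgn)
    have "(\<lambda>x::real^'n. x /\<^sub>R norm x) \<in> borel_measurable borel" by measurable
    then have "(sgn :: real^'n \<Rightarrow> _) \<in> borel_measurable borel"
      by (simp add: sgn_div_norm[abs_def])
    then show "(sgn :: real^'n \<Rightarrow> _) \<in> borel_measurable U"
      using measurable_cong_sets[OF setsU refl] measurable_restrict_space1 by blast
  qed
  have invU: "distr U U (\<lambda>x. Q *v x) = U" and meas_QU: "(\<lambda>x. Q *v x) \<in> measurable U U"
    if Q: "rotation_matrix Q" for Q :: "real^'n^'n"
  proof -
    have ot: "orthogonal_transformation (\<lambda>x. Q *v x)"
      using Q by (simp add: rotation_matrix_def orthogonal_transformation_matrix)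
    have norm_Q: "norm (Q *v x) = norm x" for x
      using ot by (simp add: orthogonal_transformation)
    have QB: "Q *v x \<in> B \<longleftrightarrow> x \<in> B" for x
      using norm_Q[of x] by (auto simp: B_def)
    have Qb: "(\<lambda>x. Q *v x) \<in> borel_measurable borel"
      by (intro borel_measurable_continuous_onI linear_continuous_on
          matrix_vector_mul_bounded_linear)
    then have "(\<lambda>x. Q *v x) \<in> measurable (restrict_space borel B) (restrict_space borel B)"
      by (intro measurable_restrict_space3) (auto simp: QB)
    then show m: "(\<lambda>x. Q *v x) \<in> measurable U U"
      using measurable_cong_sets[OF setsU setsU] by blast
    show "distr U U (\<lambda>x. Q *v x) = U"
    proof (rule measure_eqI)
      fix A assume "A \<in> sets (distr U U (\<lambda>x. Q *v x))"
      then have AU: "A \<in> sets U" by simp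
      then have AB: "A \<subseteq> B" and Ab: "A \<in> sets borel"
        using Bs by (auto simp: setsU sets_restrict_space)
      define P where "P = (\<lambda>x. Q *v x) -` A"
      have PB: "P \<subseteq> B" using AB QB by (auto simp: P_def)
      have Pb: "P \<in> sets borel" using measurable_sets[OF Qb Ab] by (simp add: P_def)
      have "emeasure lborel P = emeasure (distr lborel borel (\<lambda>x. Q *v x)) A"
        using Ab Qb by (simp add: P_def emeasure_distr)
      then have "emeasure lborel P = emeasure lborel A"
        by (simp add: lborel_distr_orthogonal[OF ot])
      then have "emeasure U P = emeasure U A"
        using PB AB Pb Ab Bs
        by (simp add: U_def emeasure_uniform_measure setsR sets_restrict_space_iff Int_absorb1
            R_def emeasure_restrict_space)
      then show "emeasure (distr U U (\<lambda>x. Q *v x)) A = emeasure U A"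
        using PB by (simp add: emeasure_distr[OF m AU] spU P_def[symmetric] Int_absorb2)
    qed simp
  qed
  have "distr \<sigma> \<sigma> (\<lambda>x. Q *v x) = \<sigma>" if Q: "rotation_matrix Q" for Q :: "real^'n^'n"
  proof -
    have ot: "orthogonal_transformation (\<lambda>x. Q *v x)"
      using Q by (simp add: rotation_matrix_def orthogonal_transformation_matrix)
    have norm_Q: "norm (Q *v x) = norm x" for x
      using ot by (simp add: orthogonal_transformation)
    have Qb: "(\<lambda>x. Q *v x) \<in> borel_measurable borel"
      by (intro borel_measurable_continuous_onI linear_continuous_on
          matrix_vector_mul_bounded_linear)
    have QS: "(\<lambda>x. Q *v x) \<in> measurable borel_sphere borel_sphere"
      unfolding borel_sphere_def
      using Qb by (intro measurable_restrict_space3) (auto simp: norm_Q)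
    have "distr \<sigma> \<sigma> (\<lambda>x. Q *v x) = distr \<sigma> borel_sphere (\<lambda>x. Q *v x)"
      by (rule distr_cong) (simp_all add: \<sigma>_def)
    also have "\<dots> = distr U borel_sphere ((\<lambda>x. Q *v x) \<circ> sgn)"
      unfolding \<sigma>_def by (rule distr_distr[OF QS sgn_meas])
    also have "(\<lambda>x. Q *v x) \<circ> sgn = sgn \<circ> (\<lambda>x. Q *v x)"
      by (auto simp: fun_eq_iff sgn_div_norm norm_Q matrix_vector_mult_scaleR)
    also have "distr U borel_sphere (sgn \<circ> (\<lambda>x. Q *v x)) =
        distr (distr U U (\<lambda>x. Q *v x)) borel_sphere sgn"
      by (rule distr_distr[OF sgn_meas meas_QU[OF Q], symmetric])
    also have "\<dots> = \<sigma>" by (simp add: invU[OF Q] \<sigma>_def)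
    finally show ?thesis .
  qed
  moreover have "prob_space \<sigma>"
    unfolding \<sigma>_def by (rule prob_space.prob_space_distr[OF pU sgn_meas])
  ultimately show ?thesis
    unfolding is_spherical_prob_def by (intro exI[of _ \<sigma>]) (simp add: \<sigma>_def)
qed

end

theory Submission
  imports Defs
begin

text \<open>
  By Fubini's theorem both sides of (i) are integrals against the surface area measure of K, and
  (i) says that the even continuous function \<open>g = T \<mu> - \<lambda>\<^sub>0\<close> has integral 0 against
  every surface area measure. For a cylinder of height \<open>2 h\<close> over a unit disc orthogonal to v,
  this measure has atoms at \<open>\<plusminus>v\<close> whose mass does not depend on h, and the remaining mass
  tends to 0 as h tends to 0, so \<open>g(v) = 0\<close>; no existence theorem for convex bodies with
  prescribed surface area measure is needed.

  For (ii) and (iii), the multiplier of \<open>t\<^sup>k\<close> on harmonics of degree l is computed recursively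
  from the identity \<open>\<integral> \<Delta>f d\<sigma> = m (m + d - 2) \<integral> f d\<sigma>\<close> for homogeneous f of degree m, which expresses
  infinitesimal rotation invariance. Since polynomials on the sphere are sums of harmonics, a
  continuous function orthogonal to all harmonics vanishes.
\<close>


section \<open>Finite signed measures\<close>

text \<open>The variations and the Hausdorff measure are given through \<open>measure_of\<close>,
  which has the intended values only once the set function is known to be countably additive;
  Bochner integrals and \<open>THE\<close> fall back to default values outside their intended
  domain. Much of the work therefore shows that the objects in the statement mean what they should:
  variations and Hausdorff measure are measures, surface area is finite, the Gauss map is
  measurable, multipliers exist. Two facts about Hausdorff measure carry the cylinder argument: an
  open unit disc in a hyperplane has positive measure, and the boundary of a convex body has finite
  measure. Both come from comparing covers or packings by small sets with volumes of tubes, so that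
  only Lebesgue measure of the full space is ever computed. A cylinder that is symmetric about the
  hyperplane charges v and -v together; evenness turns this combined information into the single
  value g(v). Multipliers of a continuous \<psi> are reached from those of powers by uniform
  approximation, with constants that depend neither on the harmonic nor on the point.\<close>

lemma finite_signed_measure_uminus:
  "finite_signed_measure M \<mu> \<Longrightarrow> finite_signed_measure M (\<lambda>A. - \<mu> A)"
  by (simp add: finite_signed_measure_def sums_minus)

lemma finite_signed_measure_sums:
  assumes "finite_signed_measure M \<mu>" "range A \<subseteq> sets M" "disjoint_family A"
  shows "(\<lambda>i. \<mu> (A i)) sums \<mu> (\<Union>i. A i)"
  using assms by (simp add: finite_signed_measure_def)

lemma finite_signed_measure_Un:
  assumes \<mu>: "finite_signed_measure M \<mu>" and A: "A \<in> sets M" "B \<in> sets M" "A \<inter> B = {}"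
  shows "\<mu> (A \<union> B) = \<mu> A + \<mu> B"
proof -
  have "(\<lambda>i. \<mu> (binaryset A B i)) sums \<mu> (\<Union>i. binaryset A B i)"
    using A by (intro finite_signed_measure_sums[OF \<mu>])
      (auto simp: disjoint_family_on_def binaryset_def split: if_splits)
  moreover have "(\<lambda>i. \<mu> (binaryset A B i)) sums (\<mu> A + \<mu> B)"
    using \<mu> by (intro binaryset_sums) (simp add: finite_signed_measure_def)
  ultimately show ?thesis
    by (simp add: UN_binaryset_eq sums_unique2)
qed

lemma finite_signed_measure_Diff:
  assumes \<mu>: "finite_signed_measure M \<mu>" and A: "A \<in> sets M" "B \<in> sets M" "B \<subseteq> A"
  shows "\<mu> (A - B) = \<mu> A - \<mu> B"
  using finite_signed_measure_Un[OF \<mu>, of B "A - B"] A by (simp add: Un_absorb1 Int_Diff)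

text \<open>The set function inside \<open>positive_variation\<close>, named because its additivity
  must be settled before \<open>emeasure\<close> of that measure can be evaluated.\<close>

definition upper_variation :: "'a measure \<Rightarrow> ('a set \<Rightarrow> real) \<Rightarrow> 'a set \<Rightarrow> ennreal" where
  "upper_variation M \<mu> A = (SUP B \<in> {B \<in> sets M. B \<subseteq> A}. ennreal (\<mu> B))"

lemma upper_variation_upper: "B \<in> sets M \<Longrightarrow> B \<subseteq> A \<Longrightarrow> ennreal (\<mu> B) \<le> upper_variation M \<mu> A"
  unfolding upper_variation_def by (rule SUP_upper) auto

text \<open>For one inequality, competitors in disjoint pieces are united into a competitor for the
  union; for the other, a competitor in the union is cut along the pieces.\<close>

lemma upper_variation_countably_additive:
  assumes \<mu>: "finite_signed_measure M \<mu>"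
  shows "countably_additive (sets M) (upper_variation M \<mu>)"
proof (rule countably_additiveI)
  fix A :: "nat \<Rightarrow> 'a set"
  assume A: "range A \<subseteq> sets M" and disj: "disjoint_family A"
  let ?P = "upper_variation M \<mu>"
  have empty: "\<mu> {} = 0" using \<mu> by (simp add: finite_signed_measure_def)
  have As: "A i \<in> sets M" for i using A by auto
  show "(\<Sum>i. ?P (A i)) = ?P (\<Union>i. A i)"
  proof (rule antisym)
    have add: "?P X + ?P Y \<le> ?P (X \<union> Y)" if "X \<inter> Y = {}" for X Y
    proof -
      have 1: "ennreal (\<mu> B) + ennreal (\<mu> C) \<le> ?P (X \<union> Y)"
        if B: "B \<in> sets M" "B \<subseteq> X" "C \<in> sets M" "C \<subseteq> Y" for B C
      proof -
        have eq: "\<mu> (B \<union> C) = \<mu> B + \<mu> C"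
          using B \<open>X \<inter> Y = {}\<close> by (intro finite_signed_measure_Un[OF \<mu>]) auto
        \<comment> \<open>\<open>ennreal\<close> is additive only on nonnegative reals. If one of
          the two values is negative it is truncated to 0, and the other set alone is a
          competitor.\<close>
        consider "\<mu> B \<ge> 0" "\<mu> C \<ge> 0" | "\<mu> B \<le> 0" | "\<mu> C \<le> 0" by linarith
        then show ?thesis
        proof cases
          case 1
          then have "ennreal (\<mu> B) + ennreal (\<mu> C) = ennreal (\<mu> (B \<union> C))" by (simp add: eq)
          also have "\<dots> \<le> ?P (X \<union> Y)" using B by (intro upper_variation_upper) auto
          finally show ?thesis .
        next
          case 2
          then show ?thesis using B upper_variation_upper[of C M "X \<union> Y" \<mu>] by (auto simp: ennreal_neg)
        next
          case 3
          then show ?thesis using B upper_variation_upper[of B M "X \<union> Y" \<mu>] by (auto simp: ennreal_neg)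
        qed
      qed
      have "ennreal (\<mu> B) + ?P Y \<le> ?P (X \<union> Y)" if "B \<in> sets M" "B \<subseteq> X" for B
        unfolding upper_variation_def[of M \<mu> Y]
        using 1 that by (subst ennreal_SUP_add_right) (auto intro!: SUP_least)
      then show ?thesis
        unfolding upper_variation_def[of M \<mu> X]
        by (subst ennreal_SUP_add_left[symmetric]) (auto intro!: SUP_least)
    qed
    have fin: "(\<Sum>i<n. ?P (A i)) \<le> ?P (\<Union>i<n. A i)" for n
    proof (induction n)
      case (Suc n)
      have "A i \<inter> A n = {}" if "i < n" for i
        using disjoint_family_onD[OF disj, of i n] that by simp
      then have "(\<Union>i<n. A i) \<inter> A n = {}" by auto
      then have "?P (\<Union>i<n. A i) + ?P (A n) \<le> ?P ((\<Union>i<n. A i) \<union> A n)" by (rule add)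
      moreover have "(\<Sum>i<Suc n. ?P (A i)) \<le> ?P (\<Union>i<n. A i) + ?P (A n)"
        using add_right_mono[OF Suc, of "?P (A n)"] by (simp only: sum.lessThan_Suc)
      ultimately have "(\<Sum>i<Suc n. ?P (A i)) \<le> ?P ((\<Union>i<n. A i) \<union> A n)"
        by (rule order_trans[rotated])
      then show ?case by (simp only: lessThan_Suc UN_insert Un_commute)
    qed simp
    show "(\<Sum>i. ?P (A i)) \<le> ?P (\<Union>i. A i)"
    proof (rule suminf_le_const[OF summableI])
      fix n
      have "?P (\<Union>i<n. A i) \<le> ?P (\<Union>i. A i)"
        unfolding upper_variation_def by (rule SUP_subset_mono) auto
      with fin[of n] show "(\<Sum>i<n. ?P (A i)) \<le> ?P (\<Union>i. A i)" by (rule order_trans)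
    qed
    show "?P (\<Union>i. A i) \<le> (\<Sum>i. ?P (A i))"
      unfolding upper_variation_def[of M \<mu> "\<Union>i. A i"]
    proof (rule SUP_least, clarify)
      fix B assume B: "B \<in> sets M" "B \<subseteq> (\<Union>i. A i)"
      define C where "C i = B \<inter> A i" for i
      have C: "range C \<subseteq> sets M" "disjoint_family C" "(\<Union>i. C i) = B"
        using B As disjoint_family_on_bisimulation[OF disj, of C] by (auto simp: C_def)
      have sums: "(\<lambda>i. \<mu> (C i)) sums \<mu> B"
        using finite_signed_measure_sums[OF \<mu> C(1,2)] C(3) by simp
      have "ennreal (\<Sum>i<n. \<mu> (C i)) \<le> (\<Sum>i. ?P (A i))" for n
      proof -
        \<comment> \<open>The terms may be negative, so they are replaced by their positive parts
          before \<open>ennreal\<close> is moved inside the sum.\<close>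
        have "ennreal (\<Sum>i<n. \<mu> (C i)) \<le> ennreal (\<Sum>i<n. max 0 (\<mu> (C i)))"
          by (intro ennreal_leI sum_mono) auto
        also have "\<dots> = (\<Sum>i<n. ennreal (max 0 (\<mu> (C i))))" by (rule sum_ennreal[symmetric]) simp
        also have "\<dots> \<le> (\<Sum>i<n. ?P (A i))"
        proof (rule sum_mono)
          fix i
          have "ennreal (\<mu> (C i)) \<le> ?P (A i)"
            using C by (intro upper_variation_upper) (auto simp: C_def)
          then show "ennreal (max 0 (\<mu> (C i))) \<le> ?P (A i)"
            by (auto simp: max_def ennreal_neg)
        qed
        also have "\<dots> \<le> (\<Sum>i. ?P (A i))" by (intro sum_le_suminf summableI) auto
        finally show ?thesis .
      qed
      moreover have "(\<lambda>n. ennreal (\<Sum>i<n. \<mu> (C i))) \<longlonglongrightarrow> ennreal (\<mu> B)"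
        using sums unfolding sums_def by (intro tendsto_ennrealI)
      ultimately show "ennreal (\<mu> B) \<le> (\<Sum>i. ?P (A i))"
        by (intro LIMSEQ_le_const2) auto
    qed
  qed
qed

lemma sets_positive_variation [simp, measurable_cong]: "sets (positive_variation M \<mu>) = sets M"
  unfolding positive_variation_def by (simp add: sets.space_closed)

lemma space_positive_variation [simp]: "space (positive_variation M \<mu>) = space M"
  unfolding positive_variation_def by (simp add: space_measure_of_conv)

lemma emeasure_positive_variation:
  assumes \<mu>: "finite_signed_measure M \<mu>" and A: "A \<in> sets M"
  shows "emeasure (positive_variation M \<mu>) A = upper_variation M \<mu> A"
proof (rule emeasure_measure_of[OF positive_variation_def[unfolded upper_variation_def[symmetric]]])
  have "upper_variation M \<mu> {} = 0"
    using \<mu> by (auto simp: upper_variation_def finite_signed_measure_def image_constant_conv)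
  then show "positive (sets (positive_variation M \<mu>)) (upper_variation M \<mu>)"
    by (simp add: positive_def)
  show "countably_additive (sets (positive_variation M \<mu>)) (upper_variation M \<mu>)"
    using upper_variation_countably_additive[OF \<mu>] by simp
qed (use A sets.space_closed in auto)

text \<open>If the variation of E is infinite, E splits into two pieces on both of which
  \<open>\<bar>\<mu>\<bar> > 1\<close> and one of which has infinite variation again. Iterating yields disjoint sets
  with \<open>\<bar>\<mu>\<bar> > 1\<close>, contradicting convergence.\<close>

lemma upper_variation_finite:
  assumes \<mu>: "finite_signed_measure M \<mu>"
  shows "upper_variation M \<mu> (space M) < top"
proof (rule ccontr)
  let ?P = "upper_variation M \<mu>"
  let ?Q = "\<lambda>E. E \<in> sets M \<and> ?P E = top"
  assume "\<not> ?P (space M) < top"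
  then have start: "?Q (space M)" by (simp add: less_top[symmetric])
  have emeas: "emeasure (positive_variation M \<mu>) A = ?P A" if "A \<in> sets M" for A
    using emeasure_positive_variation[OF \<mu> that] .
  have step: "\<exists>E'. ?Q E' \<and> E' \<subseteq> E \<and> \<bar>\<mu> (E - E')\<bar> > 1" if E: "?Q E" for E
  proof -
    \<comment> \<open>The margin \<open>1 + \<bar>\<mu> E\<bar>\<close> also forces
      \<open>\<mu> E - \<mu> B < - 1\<close>, so whichever piece is kept, the discarded one has
      absolute value above 1.\<close>
    have "ennreal (1 + \<bar>\<mu> E\<bar>) < ?P E" using E by simp
    then obtain B where B: "B \<in> sets M" "B \<subseteq> E" "ennreal (1 + \<bar>\<mu> E\<bar>) < ennreal (\<mu> B)"
      unfolding upper_variation_def by (auto simp: less_SUP_iff)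
    then have gt: "1 + \<bar>\<mu> E\<bar> < \<mu> B" by (simp add: ennreal_less_iff del: ennreal_plus)
    have diff: "\<mu> (E - B) = \<mu> E - \<mu> B" using finite_signed_measure_Diff[OF \<mu>] E B by auto
    have "?P B + ?P (E - B) = top"
      using plus_emeasure[of B "positive_variation M \<mu>" "E - B"] E B
      by (simp add: emeas sets.Diff Un_absorb1)
    then have "?P B = top \<or> ?P (E - B) = top" by (simp only: ennreal_add_eq_top)
    then show ?thesis
    proof
      assume "?P B = top"
      then show ?thesis using B gt diff by (intro exI[of _ B]) auto
    next
      assume "?P (E - B) = top"
      moreover have "E - (E - B) = B" using B by auto
      ultimately show ?thesis using B E gt by (intro exI[of _ "E - B"]) auto
    qed
  qed
  obtain E where E: "\<And>n. ?Q (E n)" "\<And>n. E (Suc n) \<subseteq> E n \<and> \<bar>\<mu> (E n - E (Suc n))\<bar> > 1"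
    using dependent_nat_choice[of "\<lambda>_. ?Q" "\<lambda>_ E E'. E' \<subseteq> E \<and> \<bar>\<mu> (E - E')\<bar> > 1"] start step by blast
  have anti: "E n \<subseteq> E m" if "m \<le> n" for m n
    using that E(2) by (induction rule: dec_induct) blast+
  define D where "D n = E n - E (Suc n)" for n
  have "disjoint_family D"
    unfolding disjoint_family_on_def
  proof (intro ballI impI)
    fix m n :: nat assume "m \<noteq> n"
    then consider "Suc m \<le> n" | "Suc n \<le> m" by linarith
    then show "D m \<inter> D n = {}" using anti unfolding D_def by cases blast+
  qed
  moreover have "range D \<subseteq> sets M" using E(1) by (auto simp: D_def)
  ultimately have "(\<lambda>i. \<mu> (D i)) sums \<mu> (\<Union>i. D i)"
    by (intro finite_signed_measure_sums[OF \<mu>])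
  then have "(\<lambda>i. \<mu> (D i)) \<longlonglongrightarrow> 0" by (intro summable_LIMSEQ_zero) (auto simp: sums_iff)
  then have "eventually (\<lambda>i. \<bar>\<mu> (D i)\<bar> < 1) sequentially"
    by (auto dest: tendsto_rabs_zero intro: order_tendstoD)
  then obtain i where "\<bar>\<mu> (D i)\<bar> < 1" by (auto dest: eventually_happens)
  with E(2)[of i] show False by (simp add: D_def)
qed

lemma finite_measure_positive_variation:
  assumes "finite_signed_measure M \<mu>"
  shows "finite_measure (positive_variation M \<mu>)"
  using upper_variation_finite[OF assms] emeasure_positive_variation[OF assms sets.top]
  by (intro finite_measureI) auto

text \<open>Complements turn upper bounds into lower ones:
  \<open>\<nu> B = \<nu> S - \<nu> (S - B)\<close> bounds the positive variation by
  \<open>\<nu> S\<close> plus the negative variation. The same bound for \<open>- \<nu>\<close> is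
  the reverse inequality.\<close>

lemma measure_variation_diff:
  assumes \<mu>: "finite_signed_measure M \<mu>"
  shows "measure (positive_variation M \<mu>) (space M) - measure (negative_variation M \<mu>) (space M) = \<mu> (space M)"
proof -
  let ?S = "space M"
  have key: "measure (positive_variation M \<nu>) ?S \<le> \<nu> ?S + measure (positive_variation M (\<lambda>A. - \<nu> A)) ?S"
    if \<nu>: "finite_signed_measure M \<nu>" for \<nu>
  proof -
    let ?P = "positive_variation M \<nu>" and ?N = "positive_variation M (\<lambda>A. - \<nu> A)"
    interpret P: finite_measure ?P by (rule finite_measure_positive_variation[OF \<nu>])
    interpret N: finite_measure ?N
      by (rule finite_measure_positive_variation[OF finite_signed_measure_uminus[OF \<nu>]])
    let ?r = "\<nu> ?S + measure ?N ?S"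
    have bound: "\<nu> B \<le> ?r" if B: "B \<in> sets M" for B
    proof -
      have "ennreal (- \<nu> (?S - B)) \<le> emeasure ?N ?S"
        using B by (subst emeasure_positive_variation[OF finite_signed_measure_uminus[OF \<nu>]])
          (auto intro!: upper_variation_upper[of _ _ _ "\<lambda>A. - \<nu> A"])
      then have "- \<nu> (?S - B) \<le> measure ?N ?S"
        by (simp add: N.emeasure_eq_measure ennreal_le_iff)
      then show ?thesis
        using finite_signed_measure_Diff[OF \<nu> sets.top B sets.sets_into_space[OF B]] by simp
    qed
    have "0 \<le> ?r" using bound[of "{}"] \<nu> by (simp add: finite_signed_measure_def)
    moreover have "emeasure ?P ?S \<le> ennreal ?r"
      unfolding emeasure_positive_variation[OF \<nu> sets.top] upper_variation_def
      using bound by (auto intro!: SUP_least ennreal_leI)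
    ultimately show ?thesis by (simp add: P.emeasure_eq_measure)
  qed
  show ?thesis
    using key[OF \<mu>] key[OF finite_signed_measure_uminus[OF \<mu>]] by (simp add: negative_variation_def)
qed

section \<open>Hausdorff measure as a metric outer measure\<close>

definition hausdorff_gauge :: "nat \<Rightarrow> real \<Rightarrow> 'a::metric_space set \<Rightarrow> ennreal" where
  "hausdorff_gauge k \<delta> C =
     (if bounded C \<and> diameter C \<le> \<delta> then ennreal (unit_ball_vol (real k) * (diameter C / 2) ^ k) else top)"

lemma hausdorff_gauge_mono:
  assumes "C \<subseteq> D"
  shows "hausdorff_gauge k \<delta> C \<le> hausdorff_gauge k \<delta> D"
proof (cases "bounded D \<and> diameter D \<le> \<delta>")
  case True
  then have "bounded C" "diameter C \<le> diameter D"
    using assms bounded_subset diameter_subset by blast+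
  with True show ?thesis
    by (auto simp: hausdorff_gauge_def diameter_ge_0 intro!: ennreal_leI mult_left_mono power_mono)
qed (auto simp: hausdorff_gauge_def)

lemma hausdorff_gauge_empty: "1 \<le> k \<Longrightarrow> 0 \<le> \<delta> \<Longrightarrow> hausdorff_gauge k \<delta> {} = 0"
  by (simp add: hausdorff_gauge_def)

lemma hausdorff_gauge_positive: "1 \<le> k \<Longrightarrow> 0 \<le> \<delta> \<Longrightarrow> positive M (hausdorff_gauge k \<delta>)"
  by (simp add: positive_def hausdorff_gauge_empty)

lemma hausdorff_gauge_increasing: "increasing M (hausdorff_gauge k \<delta>)"
  by (simp add: increasing_def hausdorff_gauge_mono)

text \<open>The value \<open>top\<close> on inadmissible sets turns the restriction on covers into a gauge defined on all sets,
  so that the library's construction of outer measures applies.\<close>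

lemma hausdorff_content_eq_outer_measure:
  assumes k: "1 \<le> k" and \<delta>: "0 \<le> \<delta>"
  shows "hausdorff_content k \<delta> A = outer_measure UNIV (hausdorff_gauge k \<delta>) A"
proof (rule antisym)
  interpret U: ring_of_sets UNIV "UNIV :: 'a set set"
    using ring_of_sets_Pow[of UNIV] by simp
  show "hausdorff_content k \<delta> A \<le> outer_measure UNIV (hausdorff_gauge k \<delta>) A"
    unfolding outer_measure_def
  proof (rule INF_greatest, clarify)
    fix C :: "nat \<Rightarrow> 'a set" assume C: "A \<subseteq> (\<Union>i. C i)"
    show "hausdorff_content k \<delta> A \<le> (\<Sum>i. hausdorff_gauge k \<delta> (C i))"
    proof (cases "\<forall>i. bounded (C i) \<and> diameter (C i) \<le> \<delta>")
      case True
      then show ?thesis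
        unfolding hausdorff_content_def hausdorff_gauge_def
        using C by (intro INF_lower2[of C]) auto
    next
      case False
      then obtain i where "\<not> (bounded (C i) \<and> diameter (C i) \<le> \<delta>)"
        by blast
      then have "hausdorff_gauge k \<delta> (C i) = top"
        by (auto simp: hausdorff_gauge_def)
      moreover have "hausdorff_gauge k \<delta> (C i) \<le> (\<Sum>i. hausdorff_gauge k \<delta> (C i))"
        using sum_le_suminf[of "\<lambda>i. hausdorff_gauge k \<delta> (C i)" "{i}"] by simp
      ultimately have "(\<Sum>i. hausdorff_gauge k \<delta> (C i)) = top"
        by (simp add: top_unique)
      then show ?thesis by simp
    qed
  qed
  show "outer_measure UNIV (hausdorff_gauge k \<delta>) A \<le> hausdorff_content k \<delta> A"
    unfolding hausdorff_content_def
  proof (rule INF_greatest, clarify)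
    fix C :: "nat \<Rightarrow> 'a set" assume C: "A \<subseteq> (\<Union>i. C i)" "\<forall>i. bounded (C i) \<and> diameter (C i) \<le> \<delta>"
    have "outer_measure UNIV (hausdorff_gauge k \<delta>) A \<le> (\<Sum>i. hausdorff_gauge k \<delta> (C i))"
      using C(1) by (intro U.outer_measure_le hausdorff_gauge_positive hausdorff_gauge_increasing k \<delta>) auto
    then show "outer_measure UNIV (hausdorff_gauge k \<delta>) A
        \<le> (\<Sum>i. ennreal (unit_ball_vol (real k) * (diameter (C i) / 2) ^ k))"
      using C(2) by (simp add: hausdorff_gauge_def)
  qed
qed

lemma outer_measure_space_content:
  assumes k: "1 \<le> k" and \<delta>: "0 \<le> \<delta>"
  shows "outer_measure_space UNIV (hausdorff_content k \<delta> :: 'a::metric_space set \<Rightarrow> ennreal)"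
proof -
  interpret U: ring_of_sets UNIV "UNIV :: 'a set set"
    using ring_of_sets_Pow[of UNIV] by simp
  have "hausdorff_content k \<delta> = outer_measure UNIV (hausdorff_gauge k \<delta> :: 'a set \<Rightarrow> ennreal)"
    using hausdorff_content_eq_outer_measure[OF assms] by blast
  then show ?thesis
    using U.outer_measure_space_outer_measure[OF hausdorff_gauge_positive[OF assms] hausdorff_gauge_increasing]
    by simp
qed

lemma outer_measure_space_hausdorff:
  assumes k: "1 \<le> k"
  shows "outer_measure_space UNIV (hausdorff_outer k :: 'a::metric_space set \<Rightarrow> ennreal)"
proof -
  have O: "outer_measure_space UNIV (hausdorff_content k \<delta> :: 'a set \<Rightarrow> ennreal)" if "0 < \<delta>" for \<delta>
    using outer_measure_space_content[OF k, of \<delta>] that by simp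
  show ?thesis
    unfolding outer_measure_space_def
  proof (intro conjI)
    show "positive UNIV (hausdorff_outer k :: 'a set \<Rightarrow> ennreal)"
      using O by (auto simp: positive_def hausdorff_outer_def outer_measure_space_def)
    show "increasing UNIV (hausdorff_outer k :: 'a set \<Rightarrow> ennreal)"
      unfolding increasing_def hausdorff_outer_def
    proof (intro ballI impI SUP_mono')
      fix x y :: "'a set" and \<delta> :: real assume "x \<subseteq> y"
      then show "hausdorff_content k \<delta> x \<le> hausdorff_content k \<delta> y"
        unfolding hausdorff_content_def by (intro INF_superset_mono) auto
    qed
    show "countably_subadditive UNIV (hausdorff_outer k :: 'a set \<Rightarrow> ennreal)"
      unfolding countably_subadditive_def
    proof (intro allI impI)
      fix A :: "nat \<Rightarrow> 'a set" assume d: "disjoint_family A"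
      show "hausdorff_outer k (\<Union>i. A i) \<le> (\<Sum>i. hausdorff_outer k (A i))"
        unfolding hausdorff_outer_def[of k "\<Union>i. A i"]
      proof (rule SUP_least)
        fix \<delta> :: real assume "\<delta> \<in> {0<..}"
        then have "countably_subadditive UNIV (hausdorff_content k \<delta> :: 'a set \<Rightarrow> ennreal)"
          using O by (simp add: outer_measure_space_def)
        then have "hausdorff_content k \<delta> (\<Union>i. A i) \<le> (\<Sum>i. hausdorff_content k \<delta> (A i))"
          using d by (simp add: countably_subadditive_def)
        also have "\<dots> \<le> (\<Sum>i. hausdorff_outer k (A i))"
          using \<open>\<delta> \<in> {0<..}\<close> unfolding hausdorff_outer_def
          by (intro suminf_le SUP_upper summableI)
        finally show "hausdorff_content k \<delta> (\<Union>i. A i) \<le> (\<Sum>i. hausdorff_outer k (A i))" .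
      qed
    qed
  qed
qed

lemma hausdorff_outer_empty: "1 \<le> k \<Longrightarrow> hausdorff_outer k ({} :: 'a::metric_space set) = 0"
  using outer_measure_space_hausdorff[of k, where 'a='a] by (simp add: outer_measure_space_def positive_def)

lemma hausdorff_outer_mono:
  fixes A :: "'a::metric_space set"
  shows "1 \<le> k \<Longrightarrow> A \<subseteq> B \<Longrightarrow> hausdorff_outer k A \<le> hausdorff_outer k B"
  using outer_measure_space_hausdorff[of k, where 'a='a]
  by (simp add: outer_measure_space_def increasing_def)

lemma hausdorff_outer_Un:
  fixes A :: "'a::metric_space set"
  assumes k: "1 \<le> k"
  shows "hausdorff_outer k (A \<union> B) \<le> hausdorff_outer k A + hausdorff_outer k B"
proof -
  interpret U: ring_of_sets UNIV "UNIV :: 'a set set"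
    using ring_of_sets_Pow[of UNIV] by simp
  have "subadditive UNIV (hausdorff_outer k :: 'a set \<Rightarrow> ennreal)"
    using U.countably_subadditive_subadditive outer_measure_space_hausdorff[OF k, where 'a='a]
    by (auto simp: outer_measure_space_def)
  then have "hausdorff_outer k (A \<union> (B - A)) \<le> hausdorff_outer k A + hausdorff_outer k (B - A)"
    unfolding subadditive_def by blast
  also have "\<dots> \<le> hausdorff_outer k A + hausdorff_outer k B"
    by (intro add_left_mono hausdorff_outer_mono[OF k]) auto
  finally show ?thesis by simp
qed

lemma hausdorff_content_antimono: "\<delta> \<le> \<epsilon> \<Longrightarrow> hausdorff_content k \<epsilon> A \<le> hausdorff_content k \<delta> A"
  unfolding hausdorff_content_def by (rule INF_superset_mono) (auto intro: order_trans)

text \<open>At a scale below the gap \<eta>, no set of a cover meets both \<open>A\<close> and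
  \<open>B\<close>, so the cover splits into separate covers of the two sets.\<close>

lemma hausdorff_outer_separated:
  fixes A B :: "'a::metric_space set"
  assumes k: "1 \<le> k" and \<eta>: "0 < \<eta>" and sep: "\<And>x y. x \<in> A \<Longrightarrow> y \<in> B \<Longrightarrow> \<eta> \<le> dist x y"
  shows "hausdorff_outer k A + hausdorff_outer k B \<le> hausdorff_outer k (A \<union> B)"
proof -
  have content: "hausdorff_content k \<delta> A + hausdorff_content k \<delta> B \<le> hausdorff_content k \<delta> (A \<union> B)"
    if \<delta>: "0 < \<delta>" "\<delta> < \<eta>" for \<delta>
    unfolding hausdorff_content_def[of k \<delta> "A \<union> B"]
  proof (rule INF_greatest, clarify)
    fix C :: "nat \<Rightarrow> 'a set" assume C: "A \<union> B \<subseteq> (\<Union>i. C i)" "\<forall>i. bounded (C i) \<and> diameter (C i) \<le> \<delta>"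
    let ?g = "\<lambda>C. ennreal (unit_ball_vol (real k) * (diameter C / 2) ^ k)"
    have g: "?g D = hausdorff_gauge k \<delta> D" if "D \<subseteq> C i" for D i
      using C(2) that bounded_subset diameter_subset order_trans
      unfolding hausdorff_gauge_def by metis
    have le: "hausdorff_content k \<delta> X \<le> (\<Sum>i. hausdorff_gauge k \<delta> (C i \<inter> X))" if "X \<subseteq> A \<union> B" for X
    proof -
      have "hausdorff_content k \<delta> X \<le> (\<Sum>i. ?g (C i \<inter> X))"
        unfolding hausdorff_content_def
        using C that
        by (intro INF_lower2[of "\<lambda>i. C i \<inter> X"])
           (auto intro: bounded_subset order_trans[OF diameter_subset])
      also have "\<dots> = (\<Sum>i. hausdorff_gauge k \<delta> (C i \<inter> X))"
        by (intro suminf_cong g) auto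
      finally show ?thesis .
    qed
    have "hausdorff_content k \<delta> A + hausdorff_content k \<delta> B
        \<le> (\<Sum>i. hausdorff_gauge k \<delta> (C i \<inter> A)) + (\<Sum>i. hausdorff_gauge k \<delta> (C i \<inter> B))"
      by (intro add_mono le) auto
    also have "\<dots> = (\<Sum>i. hausdorff_gauge k \<delta> (C i \<inter> A) + hausdorff_gauge k \<delta> (C i \<inter> B))"
      by (intro suminf_add summableI)
    also have "\<dots> \<le> (\<Sum>i. hausdorff_gauge k \<delta> (C i))"
    proof (intro suminf_le summableI)
      fix i
      have "C i \<inter> A = {} \<or> C i \<inter> B = {}"
      proof (rule ccontr)
        assume "\<not> ?thesis"
        then obtain x y where "x \<in> C i" "x \<in> A" "y \<in> C i" "y \<in> B" by auto
        then have "\<eta> \<le> dist x y" "dist x y \<le> diameter (C i)"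
          using sep C(2) by (auto intro: diameter_bounded_bound)
        with C(2) \<delta> show False by (smt (verit))
      qed
      then show "hausdorff_gauge k \<delta> (C i \<inter> A) + hausdorff_gauge k \<delta> (C i \<inter> B) \<le> hausdorff_gauge k \<delta> (C i)"
        using hausdorff_gauge_empty[OF k, of \<delta>, where 'a='a] \<delta> by (auto intro: hausdorff_gauge_mono)
    qed
    finally show "hausdorff_content k \<delta> A + hausdorff_content k \<delta> B \<le> (\<Sum>i. ?g (C i))"
      using g[OF order_refl] by simp
  qed
  \<comment> \<open>The suprema over the scales for \<open>A\<close> and \<open>B\<close> are taken
    one after the other, so the scales are decoupled here; contents grow as the scale shrinks, and a
    common finer scale below \<eta> dominates both.\<close>
  have split: "hausdorff_content k \<delta> A + hausdorff_content k \<epsilon> B \<le> hausdorff_outer k (A \<union> B)"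
    if "0 < \<delta>" "0 < \<epsilon>" for \<delta> \<epsilon>
  proof -
    define \<theta> where "\<theta> = min (min \<delta> \<epsilon>) (\<eta> / 2)"
    have \<theta>: "0 < \<theta>" "\<theta> < \<eta>" "\<theta> \<le> \<delta>" "\<theta> \<le> \<epsilon>" using that \<eta> by (auto simp: \<theta>_def)
    have "hausdorff_content k \<delta> A + hausdorff_content k \<epsilon> B \<le> hausdorff_content k \<theta> A + hausdorff_content k \<theta> B"
      using \<theta> by (intro add_mono hausdorff_content_antimono)
    also have "\<dots> \<le> hausdorff_content k \<theta> (A \<union> B)" using content \<theta> by simp
    also have "\<dots> \<le> hausdorff_outer k (A \<union> B)"
      unfolding hausdorff_outer_def using \<theta> by (intro SUP_upper) auto
    finally show ?thesis .
  qed
  have "hausdorff_outer k A + hausdorff_content k \<epsilon> B \<le> hausdorff_outer k (A \<union> B)" if "0 < \<epsilon>" for \<epsilon>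
    unfolding hausdorff_outer_def[of k A]
    using split that by (subst ennreal_SUP_add_left[symmetric]) (auto intro!: SUP_least)
  then show ?thesis
    unfolding hausdorff_outer_def[of k B]
    by (subst ennreal_SUP_add_right) (auto intro!: SUP_least)
qed

lemma ennreal_suminf_tail_less:
  fixes f :: "nat \<Rightarrow> ennreal"
  assumes "(\<Sum>i. f i) < top" and e: "0 < (e::real)"
  obtains n where "(\<Sum>i. f (i + n)) < ennreal e"
proof -
  have fin: "f i < top" for i
    using assms(1) by (rule ennreal_suminf_lessD)
  define g where "g i = enn2real (f i)" for i
  have fg: "f i = ennreal (g i)" for i using fin by (simp add: g_def)
  have g0: "0 \<le> g i" for i by (simp add: g_def)
  have sg: "summable g"
    using assms(1) g0 unfolding fg by (intro summable_suminf_not_top) auto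
  then obtain n where n: "norm (\<Sum>i. g (i + n)) < e"
    using suminf_exist_split[OF e sg] by blast
  have "(\<Sum>i. f (i + n)) = ennreal (\<Sum>i. g (i + n))"
    unfolding fg using g0 sg by (intro suminf_ennreal2) (auto simp: summable_iff_shift)
  also have "\<dots> < ennreal e" using n e by (intro ennreal_lessI) auto
  finally show thesis by (rule that)
qed

text \<open>The Caratheodory argument: the points of X off F are split into shells by their distance to F.
  Shells of index differing by at least 2 are separated, so the shells have summable measure.\<close>

lemma closed_in_lambda_system_hausdorff:
  fixes F :: "'a::metric_space set"
  assumes k: "1 \<le> k" and F: "closed F"
  shows "F \<in> lambda_system UNIV UNIV (hausdorff_outer k)"
proof (cases "F = {}")
  case True
  then show ?thesis using hausdorff_outer_empty[OF k] by (auto simp: lambda_system_def)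
next
  case ne: False
  let ?H = "hausdorff_outer k :: 'a set \<Rightarrow> ennreal"
  have main: "?H (X \<inter> F) + ?H (X - F) \<le> ?H X" for X
  proof (cases "?H X = top")
    case False
    then have fin: "?H X < top" by (simp add: less_top)
    \<comment> \<open>\<open>R j\<close> is the shell of points of \<open>X\<close> at distance
      between 1/(j+2) and 1/(j+1) from \<open>F\<close>; \<open>Y n\<close> collects the points at
      distance at least 1/(n+1).\<close>
    define R where "R j = {x \<in> X. 1 / (real j + 2) \<le> infdist x F \<and> infdist x F < 1 / (real j + 1)}" for j
    define Y where "Y n = {x \<in> X. 1 / (real n + 1) \<le> infdist x F}" for n
    have lip: "\<bar>infdist x F - infdist y F\<bar> \<le> dist x y" for x y
      using infdist_triangle[of x F y] infdist_triangle[of y F x] by (simp add: dist_commute)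
    \<comment> \<open>Distance to \<open>F\<close> is 1-Lipschitz: it is at least 1/(m+2) on
      \<open>A\<close> and below 1/(m+3) on \<open>R (m + 2)\<close>, which leaves a positive
      gap.\<close>
    have sepR: "?H A + ?H (R (m + 2)) \<le> ?H (A \<union> R (m + 2))"
      if A: "A \<subseteq> {x. 1 / (real m + 2) \<le> infdist x F}" for A m
    proof (rule hausdorff_outer_separated[OF k])
      show "0 < 1 / (real m + 2) - 1 / (real m + 3)" by (simp add: frac_less2)
      fix x y assume "x \<in> A" "y \<in> R (m + 2)"
      then show "1 / (real m + 2) - 1 / (real m + 3) \<le> dist x y"
        using A lip[of x y] by (force simp: R_def add.commute)
    qed
    \<comment> \<open>Only every second shell is summed; the offset \<open>c\<close> selects the
      even or the odd ones.\<close>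
    have partial: "(\<Sum>j<m. ?H (R (2 * j + c))) \<le> ?H (\<Union>j<m. R (2 * j + c))" for m c
    proof (induction m)
      case 0
      then show ?case by simp
    next
      case (Suc m)
      show ?case
      proof (cases m)
        case 0
        then show ?thesis by (simp add: lessThan_Suc)
      next
        case (Suc m')
        have sub: "(\<Union>j<m. R (2 * j + c)) \<subseteq> {x. 1 / (real (2 * m' + c) + 2) \<le> infdist x F}"
        proof clarify
          fix x j assume "j < m" "x \<in> R (2 * j + c)"
          moreover have "1 / (real (2 * m' + c) + 2) \<le> 1 / (real (2 * j + c) + 2)"
            using \<open>j < m\<close> Suc by (intro divide_left_mono) auto
          ultimately show "1 / (real (2 * m' + c) + 2) \<le> infdist x F" by (auto simp: R_def)
        qed
        have "(\<Sum>j<Suc m. ?H (R (2 * j + c))) \<le> ?H (\<Union>j<m. R (2 * j + c)) + ?H (R (2 * m + c))"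
          using Suc.IH by (simp add: add_mono)
        also have "\<dots> \<le> ?H ((\<Union>j<m. R (2 * j + c)) \<union> R (2 * m + c))"
          using sepR[OF sub] Suc by (simp add: algebra_simps)
        finally show ?thesis by (simp add: lessThan_Suc Un_commute)
      qed
    qed
    have half: "(\<Sum>j. ?H (R (2 * j + c))) \<le> ?H X" for c
    proof (rule suminf_le_const[OF summableI])
      fix m
      have "?H (\<Union>j<m. R (2 * j + c)) \<le> ?H X"
        by (rule hausdorff_outer_mono[OF k]) (auto simp: R_def)
      with partial[of c m] show "(\<Sum>j<m. ?H (R (2 * j + c))) \<le> ?H X" by (rule order_trans)
    qed
    have "(\<Sum>j. ?H (R j)) \<le> ?H X + ?H X"
    proof (rule suminf_le_const[OF summableI])
      fix m
      have "(\<Sum>j<m. ?H (R j)) \<le> (\<Sum>j<2 * m. ?H (R j))"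
        by (intro sum_mono2) auto
      also have "\<dots> = (\<Sum>j<m. ?H (R (2 * j + 0))) + (\<Sum>j<m. ?H (R (2 * j + 1)))"
        by (induction m) (auto simp: algebra_simps)
      also have "\<dots> \<le> (\<Sum>j. ?H (R (2 * j + 0))) + (\<Sum>j. ?H (R (2 * j + 1)))"
        by (intro add_mono sum_le_suminf summableI) auto
      also have "\<dots> \<le> ?H X + ?H X" using half by (intro add_mono)
      finally show "(\<Sum>j<m. ?H (R j)) \<le> ?H X + ?H X" .
    qed
    then have Rfin: "(\<Sum>j. ?H (R j)) < top" using fin by (simp add: order_le_less_trans)
    show ?thesis
    proof (rule ennreal_le_epsilon)
      fix e :: real assume e: "0 < e"
      obtain n where n: "(\<Sum>j. ?H (R (j + n))) < ennreal e"
        using ennreal_suminf_tail_less[OF Rfin e] by blast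
      have cover: "X - F \<subseteq> Y n \<union> (\<Union>j. R (j + n))"
      proof
        fix x assume x: "x \<in> X - F"
        then have pos: "0 < infdist x F"
          using F ne in_closed_iff_infdist_zero[of F x] infdist_nonneg[of x F] by auto
        define N where "N = (LEAST N. 1 / (real N + 1) \<le> infdist x F)"
        have ex: "\<exists>N. 1 / (real N + 1) \<le> infdist x F"
          using reals_Archimedean[OF pos] by (auto simp: inverse_eq_divide add.commute intro: less_imp_le)
        have N: "1 / (real N + 1) \<le> infdist x F" unfolding N_def by (rule LeastI_ex[OF ex])
        show "x \<in> Y n \<union> (\<Union>j. R (j + n))"
        proof (cases "N \<le> n")
          case True
          then have "1 / (real n + 1) \<le> 1 / (real N + 1)" by (intro divide_left_mono) auto
          with N x show ?thesis by (auto simp: Y_def)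
        next
          case False
          define j where "j = N - 1 - n"
          have Nj: "N = Suc (j + n)" using False by (simp add: j_def)
          have "\<not> 1 / (real (j + n) + 1) \<le> infdist x F"
            using not_less_Least[of "j + n" "\<lambda>N. 1 / (real N + 1) \<le> infdist x F"] Nj
            unfolding N_def by simp
          with N x Nj have "x \<in> R (j + n)" by (auto simp: R_def add.commute add.left_commute)
          then show ?thesis by blast
        qed
      qed
      have disj: "disjoint_family (\<lambda>j. R (j + n))"
        unfolding disjoint_family_on_def
      proof (intro ballI impI, rule ccontr)
        fix i j assume "i \<noteq> j" "R (i + n) \<inter> R (j + n) \<noteq> {}"
        then obtain x where x: "x \<in> R (i + n)" "x \<in> R (j + n)" by auto
        have *: False if "x \<in> R a" "x \<in> R b" "a < b" for a b
        proof -
          have "1 / (real b + 1) \<le> 1 / (real a + 2)" using that(3) by (intro divide_left_mono) auto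
          with that show False by (auto simp: R_def)
        qed
        from \<open>i \<noteq> j\<close> *[OF x] *[OF x(2,1)] show False by linarith
      qed
      have "?H (X - F) \<le> ?H (Y n \<union> (\<Union>j. R (j + n)))" by (rule hausdorff_outer_mono[OF k cover])
      also have "\<dots> \<le> ?H (Y n) + ?H (\<Union>j. R (j + n))" by (rule hausdorff_outer_Un[OF k])
      also have "?H (\<Union>j. R (j + n)) \<le> (\<Sum>j. ?H (R (j + n)))"
        using outer_measure_space_hausdorff[OF k] disj
        unfolding outer_measure_space_def countably_subadditive_def by blast
      also have "\<dots> \<le> ennreal e" using n by simp
      finally have 1: "?H (X - F) \<le> ?H (Y n) + ennreal e" by (simp add: add_left_mono)
      have "?H (X \<inter> F) + ?H (Y n) \<le> ?H ((X \<inter> F) \<union> Y n)"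
      proof (rule hausdorff_outer_separated[OF k])
        show "0 < 1 / (real n + 1)" by simp
        fix x y assume "x \<in> X \<inter> F" "y \<in> Y n"
        then show "1 / (real n + 1) \<le> dist x y"
          using infdist_le[of x F y] by (auto simp: Y_def dist_commute)
      qed
      also have "\<dots> \<le> ?H X" by (rule hausdorff_outer_mono[OF k]) (auto simp: Y_def)
      finally have 2: "?H (X \<inter> F) + ?H (Y n) \<le> ?H X" .
      have "?H (X \<inter> F) + ?H (X - F) \<le> ?H (X \<inter> F) + (?H (Y n) + ennreal e)"
        using 1 by (rule add_left_mono)
      also have "\<dots> \<le> ?H X + ennreal e" using 2 by (simp add: add.assoc[symmetric] add_right_mono)
      finally show "?H (X \<inter> F) + ?H (X - F) \<le> ?H X + ennreal e" .
    qed
  qed simp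
  have "?H (F \<inter> X) + ?H ((UNIV - F) \<inter> X) = ?H X" for X
  proof (rule antisym)
    have "(UNIV - F) \<inter> X = X - F" "F \<inter> X = X \<inter> F" by auto
    then show "?H (F \<inter> X) + ?H ((UNIV - F) \<inter> X) \<le> ?H X" using main[of X] by simp
    have "X = (F \<inter> X) \<union> ((UNIV - F) \<inter> X)" by auto
    then show "?H X \<le> ?H (F \<inter> X) + ?H ((UNIV - F) \<inter> X)"
      using hausdorff_outer_Un[OF k, of "F \<inter> X" "(UNIV - F) \<inter> X"] by simp
  qed
  then show ?thesis by (simp add: lambda_system_def)
qed

lemma sets_hausdorff_measure [simp, measurable_cong]: "sets (hausdorff_measure k) = sets borel"
  unfolding hausdorff_measure_def
  by (metis sets.sets_measure_of_eq space_borel)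

lemma space_hausdorff_measure [simp]: "space (hausdorff_measure k) = UNIV"
  unfolding hausdorff_measure_def by (simp add: space_measure_of_conv)

text \<open>By Caratheodory's theorem the outer measure is countably additive on its measurable
  sets. These form a sigma-algebra containing the closed sets, hence the Borel sets, so
  \<open>measure_of\<close> receives a genuine measure.\<close>

lemma emeasure_hausdorff_measure:
  fixes A :: "'a::metric_space set"
  assumes k: "1 \<le> k" and A: "A \<in> sets borel"
  shows "emeasure (hausdorff_measure k) A = hausdorff_outer k A"
proof -
  interpret U: sigma_algebra UNIV "UNIV :: 'a set set"
    using sigma_algebra_Pow[of UNIV] by simp
  let ?L = "lambda_system UNIV UNIV (hausdorff_outer k :: 'a set \<Rightarrow> ennreal)"
  have ms: "measure_space UNIV ?L (hausdorff_outer k)"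
    using U.caratheodory_lemma[OF outer_measure_space_hausdorff[OF k]] .
  interpret L: sigma_algebra UNIV ?L using ms by (simp add: measure_space_def)
  have sub: "sets borel \<subseteq> ?L"
  proof -
    have "Collect closed \<subseteq> ?L" using closed_in_lambda_system_hausdorff[OF k] by blast
    then have "sigma_sets UNIV (Collect closed) \<subseteq> ?L" by (rule L.sigma_sets_subset)
    then show ?thesis by (simp add: borel_eq_closed)
  qed
  show ?thesis
  proof (rule emeasure_measure_of[OF hausdorff_measure_def])
    show "positive (sets (hausdorff_measure k)) (hausdorff_outer k :: 'a set \<Rightarrow> ennreal)"
      by (simp add: positive_def hausdorff_outer_empty[OF k])
    show "countably_additive (sets (hausdorff_measure k)) (hausdorff_outer k :: 'a set \<Rightarrow> ennreal)"
      using ms sub by (auto simp: measure_space_def countably_additive_def)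
  qed (use A in auto)
qed

section \<open>Convex bodies have finite surface area\<close>

text \<open>A cover of \<open>A\<close> is first intersected with \<open>A\<close>, where the
  contraction property is available, and then pushed forward; the diameters do not grow.\<close>

lemma hausdorff_outer_contraction:
  fixes f :: "'a::euclidean_space \<Rightarrow> 'b::euclidean_space"
  assumes f: "\<And>x y. x \<in> A \<Longrightarrow> y \<in> A \<Longrightarrow> norm (f x - f y) \<le> norm (x - y)"
  shows "hausdorff_outer k (f ` A) \<le> hausdorff_outer k A"
  unfolding hausdorff_outer_def
proof (intro SUP_mono')
  fix \<delta> :: real
  show "hausdorff_content k \<delta> (f ` A) \<le> hausdorff_content k \<delta> A"
    unfolding hausdorff_content_def[of k \<delta> A]
  proof (rule INF_greatest, clarify)
    fix C :: "nat \<Rightarrow> 'a set" assume C: "A \<subseteq> (\<Union>i. C i)" "\<forall>i. bounded (C i) \<and> diameter (C i) \<le> \<delta>"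
    define D where "D i = f ` (C i \<inter> A)" for i
    have nf: "norm (f x - f y) \<le> diameter (C i)" if "x \<in> C i \<inter> A" "y \<in> C i \<inter> A" for x y i
    proof -
      have "norm (f x - f y) \<le> norm (x - y)" using f that by simp
      also have "\<dots> \<le> diameter (C i)"
        using diameter_bounded_bound[of "C i" x y] that C(2) by (simp add: dist_norm)
      finally show ?thesis .
    qed
    have diam: "diameter (D i) \<le> diameter (C i)" for i
      unfolding D_def using nf C(2) by (intro diameter_le) (auto simp: diameter_ge_0)
    have bdd: "bounded (D i)" for i
    proof -
      have "norm (u - w) \<le> diameter (C i)" if "u \<in> D i" "w \<in> D i" for u w
        using that nf unfolding D_def by blast
      then show ?thesis unfolding bounded_def dist_norm by (metis all_not_in_conv)
    qed
    have "hausdorff_content k \<delta> (f ` A) \<le> (\<Sum>i. ennreal (unit_ball_vol (real k) * (diameter (D i) / 2) ^ k))"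
      unfolding hausdorff_content_def
    proof (intro INF_lower CollectI conjI allI)
      show "f ` A \<subseteq> (\<Union>i. D i)" using C(1) by (fastforce simp: D_def)
      show "diameter (D i) \<le> \<delta>" for i using diam[of i] C(2) order_trans by blast
    qed (rule bdd)
    also have "\<dots> \<le> (\<Sum>i. ennreal (unit_ball_vol (real k) * (diameter (C i) / 2) ^ k))"
      using diam bdd
      by (intro suminf_le summableI ennreal_leI mult_left_mono power_mono divide_right_mono) 
         (auto simp: diameter_ge_0)
    finally show "hausdorff_content k \<delta> (f ` A) \<le> (\<Sum>i. ennreal (unit_ball_vol (real k) * (diameter (C i) / 2) ^ k))" .
  qed
qed

lemma hausdorff_outer_translation:
  fixes a :: "'a::euclidean_space"
  shows "hausdorff_outer k ((+) a ` A) = hausdorff_outer k A"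
proof (rule antisym)
  show "hausdorff_outer k ((+) a ` A) \<le> hausdorff_outer k A"
    by (rule hausdorff_outer_contraction) simp
  have "hausdorff_outer k ((+) (- a) ` (+) a ` A) \<le> hausdorff_outer k ((+) a ` A)"
    by (rule hausdorff_outer_contraction) simp
  then show "hausdorff_outer k A \<le> hausdorff_outer k ((+) a ` A)"
    by (simp add: image_image)
qed

lemma hausdorff_content_finite_cover:
  fixes A :: "'a::euclidean_space set"
  assumes k: "1 \<le> k" and fin: "finite C" and A: "A \<subseteq> (\<Union>x\<in>C. cball x \<rho>)" and \<rho>: "0 \<le> \<rho>" "2 * \<rho> \<le> \<delta>"
  shows "hausdorff_content k \<delta> A \<le> ennreal (real (card C) * (unit_ball_vol (real k) * \<rho> ^ k))"
proof -
  obtain h where h: "bij_betw h {..<card C} C"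
    using ex_bij_betw_nat_finite[OF fin] by (auto simp: atLeast0LessThan)
  define D where "D i = (if i < card C then cball (h i) \<rho> else {})" for i
  have "hausdorff_content k \<delta> A \<le> (\<Sum>i. ennreal (unit_ball_vol (real k) * (diameter (D i) / 2) ^ k))"
    unfolding hausdorff_content_def
  proof (intro INF_lower CollectI conjI allI)
    show "A \<subseteq> (\<Union>i. D i)"
    proof
      fix x assume "x \<in> A"
      then obtain y where y: "y \<in> C" "x \<in> cball y \<rho>" using A by auto
      then obtain i where "i < card C" "h i = y"
        using h by (force simp: bij_betw_def)
      with y show "x \<in> (\<Union>i. D i)" by (auto simp: D_def intro!: exI[of _ i])
    qed
  qed (use \<rho> in \<open>auto simp: D_def\<close>)
  also have "\<dots> = (\<Sum>i<card C. ennreal (unit_ball_vol (real k) * (diameter (D i) / 2) ^ k))"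
    using k by (intro suminf_finite) (auto simp: D_def)
  also have "\<dots> = (\<Sum>i<card C. ennreal (unit_ball_vol (real k) * \<rho> ^ k))"
    using \<rho> by (intro sum.cong) (auto simp: D_def)
  also have "\<dots> = ennreal (real (card C) * (unit_ball_vol (real k) * \<rho> ^ k))"
    using \<rho> by (simp add: ennreal_of_nat_eq_real_of_nat ennreal_mult)
  finally show ?thesis .
qed

text \<open>What matters is the linear dependence on \<open>s\<close>: it makes the volume of a
  boundary tube at most proportional to its radius. The factor in front is crude.\<close>

lemma power_diff_le:
  fixes s :: real
  assumes "0 \<le> s" "s \<le> 1"
  shows "(1 + s) ^ d - (1 - s) ^ d \<le> 2 * s * real d * 2 ^ d"
proof (induction d)
  case (Suc d)
  have 1: "(1 - s) ^ d \<le> 1" using assms by (intro power_le_one) auto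
  have 2: "1 \<le> (2::real) ^ d" by simp
  have "(1 + s) ^ Suc d - (1 - s) ^ Suc d = (1 + s) * ((1 + s) ^ d - (1 - s) ^ d) + (1 - s) ^ d * (2 * s)"
    by (simp add: algebra_simps)
  also have "\<dots> \<le> 2 * (2 * s * real d * 2 ^ d) + 1 * (2 * s)"
  proof (intro add_mono mult_right_mono 1)
    have "(1 - s) ^ d \<le> (1 + s) ^ d" using assms by (intro power_mono) auto
    then show "(1 + s) * ((1 + s) ^ d - (1 - s) ^ d) \<le> 2 * (2 * s * real d * 2 ^ d)"
      using assms Suc by (intro mult_mono) auto
  qed (use assms in auto)
  also have "\<dots> \<le> 2 * s * real (Suc d) * 2 ^ Suc d"
    using mult_left_mono[OF 2, of "2 * s"] assms by (simp add: algebra_simps)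
  finally show ?case .
qed simp

text \<open>The \<open>\<epsilon>\<close>-neighbourhood of the boundary lies between two homothetic copies of K.\<close>

lemma frontier_tube_volume:
  fixes K :: "'a::euclidean_space set"
  assumes K: "compact K" "convex K" and r: "cball 0 r \<subseteq> K" and \<epsilon>: "0 < \<epsilon>" "\<epsilon> < r"
    and T: "T \<in> lmeasurable" "T \<subseteq> (\<Union>x\<in>frontier K. cball x \<epsilon>)"
  shows "measure lebesgue T \<le> measure lebesgue K * (2 * (\<epsilon> / r) * real DIM('a) * 2 ^ DIM('a))"
proof -
  define s where "s = \<epsilon> / r"
  have s: "0 < s" "s < 1" using \<epsilon> by (auto simp: s_def)
  have Km: "K \<in> lmeasurable" by (rule lmeasurable_compact[OF K(1)])
  have bK: "bounded K" using K(1) compact_imp_bounded by blast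
  let ?o = "(\<lambda>x. (1 + s) *\<^sub>R x) ` K" and ?i = "(\<lambda>x. (1 - s) *\<^sub>R x) ` interior K"
  \<comment> \<open>Since the ball of radius \<open>r\<close> lies in \<open>K\<close>, a
    displacement of length at most \<open>\<epsilon> = s * r\<close> lies in the scaled copy of
    \<open>K\<close> by \<open>s\<close>. It is used for both inclusions below.\<close>
  have small: "\<exists>w\<in>K. z = s *\<^sub>R w" if "norm z \<le> \<epsilon>" for z
  proof
    have "norm (z /\<^sub>R s) \<le> r" using that s \<epsilon> by (simp add: s_def field_simps)
    then show "z /\<^sub>R s \<in> K" using r by auto
    show "z = s *\<^sub>R (z /\<^sub>R s)" using s by simp
  qed
  have sub: "T \<subseteq> ?o - ?i"
  proof
    fix y assume "y \<in> T"
    then obtain x where x: "x \<in> frontier K" "norm (y - x) \<le> \<epsilon>" using T(2) by (auto simp: dist_norm norm_minus_commute)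
    have xK: "x \<in> K" using x(1) K(1) by (auto simp: frontier_def compact_imp_closed)
    obtain w where w: "w \<in> K" "y - x = s *\<^sub>R w" using small[OF x(2)] by auto
    have "y = (1 + s) *\<^sub>R ((1 / (1 + s)) *\<^sub>R x + (s / (1 + s)) *\<^sub>R w)"
    proof -
      have "(1 + s) *\<^sub>R ((1 / (1 + s)) *\<^sub>R x + (s / (1 + s)) *\<^sub>R w) = x + s *\<^sub>R w"
        using s by (simp add: scaleR_add_right del: scaleR_left.add)
      also have "\<dots> = y" using w(2) by (metis add.commute diff_add_cancel)
      finally show ?thesis by simp
    qed
    moreover have "(1 / (1 + s)) *\<^sub>R x + (s / (1 + s)) *\<^sub>R w \<in> K"
      using s by (intro convexD[OF K(2) xK w(1)]) (auto simp: field_simps)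
    ultimately have "y \<in> ?o" by blast
    moreover have "y \<notin> ?i"
    proof
      assume "y \<in> ?i"
      then obtain z where z: "z \<in> interior K" "y = (1 - s) *\<^sub>R z" by auto
      obtain v where v: "v \<in> K" "x - y = s *\<^sub>R v"
        using small[of "x - y"] x(2) by (auto simp: norm_minus_commute)
      \<comment> \<open>This point is \<open>(1 - s) z + s v\<close>, a proper convex combination of
        an interior point and a point of \<open>K\<close>; it equals \<open>x\<close>, which would
        then be interior.\<close>
      have "v - (1 - s) *\<^sub>R (v - z) \<in> interior K"
        using s v z by (intro mem_interior_convex_shrink K) auto
      moreover have "v - (1 - s) *\<^sub>R (v - z) = x" using v(2) z(2) by (simp add: algebra_simps)
      ultimately show False using x(1) by (simp add: frontier_def)
    qed
    ultimately show "y \<in> ?o - ?i" by simp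
  qed
  have o: "measure lebesgue ?o = (1 + s) ^ DIM('a) * measure lebesgue K"
    using measure_lebesgue_affine[of "1 + s" 0 K] s by simp
  have "measure lebesgue (interior K) = measure lebesgue K"
    by (intro measure_interior bK negligible_convex_frontier K)
  then have i: "measure lebesgue ?i = (1 - s) ^ DIM('a) * measure lebesgue K"
    using measure_lebesgue_affine[of "1 - s" 0 "interior K"] s by simp
  have om: "?o \<in> lmeasurable"
    by (intro lmeasurable_compact compact_scaling K)
  have im: "?i \<in> lmeasurable"
    using s by (intro lmeasurable_open bounded_scaling bounded_interior bK open_scaling) auto
  have io: "?i \<subseteq> ?o"
  proof clarify
    fix z assume z: "z \<in> interior K"
    then have "z \<in> K" "0 \<in> K" using interior_subset r \<epsilon> by auto
    then have "((1 - s) / (1 + s)) *\<^sub>R z + (2 * s / (1 + s)) *\<^sub>R 0 \<in> K"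
      using s by (intro convexD[OF K(2)]) (auto simp flip: add_divide_distrib)
    moreover have "(1 - s) *\<^sub>R z = (1 + s) *\<^sub>R (((1 - s) / (1 + s)) *\<^sub>R z + (2 * s / (1 + s)) *\<^sub>R 0)"
      using s by simp
    ultimately show "(1 - s) *\<^sub>R z \<in> ?o" by blast
  qed
  have "measure lebesgue T \<le> measure lebesgue (?o - ?i)"
    using sub T(1) om im by (intro measure_mono_fmeasurable fmeasurable_Diff) (auto dest: fmeasurableD)
  also have "\<dots> = measure lebesgue ?o - measure lebesgue ?i"
    using om im io by (intro measurable_measure_Diff) (auto dest: fmeasurableD)
  also have "\<dots> = measure lebesgue K * ((1 + s) ^ DIM('a) - (1 - s) ^ DIM('a))"
    unfolding o i by (simp add: right_diff_distrib mult.commute)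
  also have "\<dots> \<le> measure lebesgue K * (2 * s * real DIM('a) * 2 ^ DIM('a))"
    using s by (intro mult_left_mono power_diff_le) auto
  finally show ?thesis by (simp add: s_def)
qed

text \<open>Packing against covering: disjoint \<epsilon>-balls centred on the boundary fit into a
  tube of volume O(\<epsilon>), so there are at most a constant times \<open>\<epsilon>\<close> to
  the power 1-d of them. By Vitali's lemma their fivefold enlargements cover the boundary, with
  total content bounded independently of \<epsilon>.\<close>

lemma hausdorff_outer_frontier_finite_0:
  fixes K :: "'a::euclidean_space set"
  assumes K: "compact K" "convex K" "0 \<in> interior K" and d: "2 \<le> DIM('a)"
  shows "hausdorff_outer (DIM('a) - 1) (frontier K) < top"
proof -
  let ?d = "DIM('a)"
  obtain r where r: "0 < r" "cball 0 r \<subseteq> K"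
    using K(3) by (auto simp: mem_interior_cball)
  define M where "M = measure lebesgue K * (2 * real ?d * 2 ^ ?d) / r"
  define u where "u = unit_ball_vol (real ?d)"
  have u: "0 < u" by (simp add: u_def)
  \<comment> \<open>\<open>M * \<epsilon>\<close> bounds the tube volume and \<open>u\<close> is the
    volume of the unit ball, so \<open>M / u\<close> bounds the number of balls times
    \<open>\<epsilon> ^ (d - 1)\<close>. The 5 is Vitali's enlargement factor, and
    \<open>10 * \<epsilon>\<close> below is the diameter of an enlarged ball.\<close>
  define L where "L = M / u * (unit_ball_vol (real (?d - 1)) * 5 ^ (?d - 1))"
  have small: "hausdorff_content (?d - 1) (10 * \<epsilon>) (frontier K) \<le> ennreal L" if \<epsilon>: "0 < \<epsilon>" "\<epsilon> < r" for \<epsilon>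
  proof -
    obtain C where C: "C \<subseteq> frontier K" "pairwise (\<lambda>i j. disjnt (cball i \<epsilon>) (cball j \<epsilon>)) C"
        "frontier K \<subseteq> (\<Union>i\<in>C. cball i (5 * \<epsilon>))"
      using Vitali_covering_lemma_cballs[where S="frontier K" and K="frontier K" and a="\<lambda>x. x"
        and r="\<lambda>_. \<epsilon>" and B=\<epsilon>] \<epsilon>
      by (metis (no_types, lifting) UN_iff centre_in_cball less_imp_le order_refl subsetI)
    have card_le: "real (card F) * \<epsilon> ^ (?d - 1) \<le> M / u" if F: "finite F" "F \<subseteq> C" for F
    proof -
      have "measure lebesgue (\<Union>x\<in>F. cball x \<epsilon>) = (\<Sum>x\<in>F. measure lebesgue (cball x \<epsilon>))"
        using F pairwise_subset[OF C(2) F(2)] by (intro measure_UNION') auto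
      also have "\<dots> = real (card F) * (u * \<epsilon> ^ ?d)"
        using \<epsilon> by (simp add: content_cball u_def)
      finally have eq: "measure lebesgue (\<Union>x\<in>F. cball x \<epsilon>) = real (card F) * (u * \<epsilon> ^ ?d)" .
      have "measure lebesgue (\<Union>x\<in>F. cball x \<epsilon>) \<le> measure lebesgue K * (2 * (\<epsilon> / r) * real ?d * 2 ^ ?d)"
        using F C(1) by (intro frontier_tube_volume K r \<epsilon> fmeasurable.finite_UN) auto
      also have "\<dots> = M * \<epsilon>" by (simp add: M_def)
      finally have "real (card F) * (u * \<epsilon> ^ ?d) \<le> M * \<epsilon>" by (simp add: eq)
      moreover have "\<epsilon> ^ ?d = \<epsilon> * \<epsilon> ^ (?d - 1)" using d by (simp add: power_eq_if)
      ultimately have "\<epsilon> * (real (card F) * \<epsilon> ^ (?d - 1) * u) \<le> \<epsilon> * M" by (simp add: algebra_simps)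
      then show ?thesis using \<epsilon> u by (simp add: field_simps)
    qed
    \<comment> \<open>The volume bound holds for every finite subfamily with the same constant,
      which rules out an infinite family.\<close>
    have fin: "finite C"
    proof -
      define B where "B = nat \<lceil>M / u / \<epsilon> ^ (?d - 1)\<rceil>"
      have "card F \<le> B" if "F \<subseteq> C" "finite F" for F
      proof -
        have "real (card F) \<le> M / u / \<epsilon> ^ (?d - 1)"
          using card_le[OF that(2,1)] \<epsilon> by (subst pos_le_divide_eq) simp_all
        then show ?thesis unfolding B_def by linarith
      qed
      then show ?thesis by (metis finite_if_finite_subsets_card_bdd)
    qed
    have "hausdorff_content (?d - 1) (10 * \<epsilon>) (frontier K)
        \<le> ennreal (real (card C) * (unit_ball_vol (real (?d - 1)) * (5 * \<epsilon>) ^ (?d - 1)))"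
      using \<epsilon> d by (intro hausdorff_content_finite_cover fin C) auto
    also have "\<dots> \<le> ennreal L"
    proof (rule ennreal_leI)
      have "real (card C) * (unit_ball_vol (real (?d - 1)) * (5 * \<epsilon>) ^ (?d - 1))
          = (real (card C) * \<epsilon> ^ (?d - 1)) * (unit_ball_vol (real (?d - 1)) * 5 ^ (?d - 1))"
        by (simp add: power_mult_distrib)
      also have "\<dots> \<le> L"
        unfolding L_def using card_le[OF fin order_refl] by (intro mult_right_mono) auto
      finally show "real (card C) * (unit_ball_vol (real (?d - 1)) * (5 * \<epsilon>) ^ (?d - 1)) \<le> L" .
    qed
    finally show ?thesis .
  qed
  have "hausdorff_outer (?d - 1) (frontier K) \<le> ennreal L"
    unfolding hausdorff_outer_def
  proof (rule SUP_least)
    fix \<delta> :: real assume "\<delta> \<in> {0<..}"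
    define \<epsilon> where "\<epsilon> = min (\<delta> / 10) (r / 2)"
    have \<epsilon>: "0 < \<epsilon>" "\<epsilon> < r" "10 * \<epsilon> \<le> \<delta>" using r \<open>\<delta> \<in> {0<..}\<close> by (auto simp: \<epsilon>_def)
    have "hausdorff_content (?d - 1) \<delta> (frontier K) \<le> hausdorff_content (?d - 1) (10 * \<epsilon>) (frontier K)"
      by (rule hausdorff_content_antimono[OF \<epsilon>(3)])
    with small[OF \<epsilon>(1,2)] show "hausdorff_content (?d - 1) \<delta> (frontier K) \<le> ennreal L" by (rule order_trans[rotated])
  qed
  then show ?thesis by (simp add: order_le_less_trans)
qed

lemma hausdorff_outer_frontier_finite:
  fixes K :: "'a::euclidean_space set"
  assumes K: "convex_body K" and d: "2 \<le> DIM('a)"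
  shows "hausdorff_outer (DIM('a) - 1) (frontier K) < top"
proof -
  obtain c where c: "c \<in> interior K" using K by (auto simp: convex_body_def)
  have "hausdorff_outer (DIM('a) - 1) (frontier ((+) (- c) ` K)) < top"
  proof (intro hausdorff_outer_frontier_finite_0 d)
    show "compact ((+) (- c) ` K)" using K by (intro compact_translation) (simp add: convex_body_def)
    show "convex ((+) (- c) ` K)" using K by (intro convex_translation) (simp add: convex_body_def)
    show "0 \<in> interior ((+) (- c) ` K)" using c unfolding interior_translation by force
  qed
  then show ?thesis by (simp only: frontier_translation hausdorff_outer_translation)
qed

section \<open>Measurability of the regular boundary points and of the Gauss map\<close>

text \<open>Both measurability results below rest on this: sets of boundary points that are
  described by their normals become projections of compact sets.\<close>

lemma compact_normal_pairs:
  fixes K :: "'a::euclidean_space set"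
  assumes "compact K"
  shows "compact {(x, u). x \<in> frontier K \<and> outer_unit_normal K x u}"
proof -
  have "{(x, u). x \<in> frontier K \<and> outer_unit_normal K x u}
      = (frontier K \<times> unit_sphere) \<inter> (\<Inter>y\<in>K. {p. snd p \<bullet> y \<le> snd p \<bullet> fst p})"
    by (auto simp: outer_unit_normal_def)
  moreover have "compact (frontier K \<times> (unit_sphere :: 'a set))"
    using assms by (intro compact_Times compact_frontier) auto
  moreover have "closed (\<Inter>y\<in>K. {p :: 'a \<times> 'a. snd p \<bullet> y \<le> snd p \<bullet> fst p})"
    by (intro closed_INT ballI closed_Collect_le continuous_intros)
  ultimately show ?thesis by (simp add: compact_Int_closed)
qed

text \<open>Points with two normals at distance at least 1/(n+1) form the projection
  \<open>T n\<close> of a compact set. The regular points are those with some normal that lie in no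
  \<open>T n\<close>.\<close>

lemma regular_points_borel:
  fixes K :: "'a::euclidean_space set"
  assumes K: "compact K"
  shows "regular_points K \<in> sets borel"
proof -
  define N where "N = {(x, u). x \<in> frontier K \<and> outer_unit_normal K x u}"
  have N: "compact N" unfolding N_def by (rule compact_normal_pairs[OF K])
  define T where "T n = (\<lambda>q. fst (fst q)) `
      ((N \<times> N) \<inter> {q. fst (fst q) = fst (snd q) \<and> inverse (real (Suc n)) \<le> dist (snd (fst q)) (snd (snd q))})" for n
  have T: "compact (T n)" for n
    unfolding T_def
    by (intro compact_continuous_image continuous_intros compact_Int_closed compact_Times N
        closed_Collect_conj closed_Collect_eq closed_Collect_le)
  have F: "compact (fst ` N)" by (intro compact_continuous_image continuous_intros N)
  have "regular_points K = fst ` N - (\<Union>n. T n)"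
  proof (intro set_eqI iffI)
    fix x assume "x \<in> regular_points K"
    then obtain u where u: "x \<in> frontier K" "outer_unit_normal K x u" "\<And>w. outer_unit_normal K x w \<Longrightarrow> w = u"
      by (auto simp: regular_points_def)
    then have "x \<in> fst ` N" by (force simp: N_def)
    moreover have "x \<notin> T n" for n
    proof
      assume "x \<in> T n"
      then obtain v w where vw: "(x, v) \<in> N" "(x, w) \<in> N" "inverse (real (Suc n)) \<le> dist v w"
        by (auto simp: T_def)
      then have "v = u" "w = u" using u(3) by (auto simp: N_def)
      with vw(3) show False by simp
    qed
    ultimately show "x \<in> fst ` N - (\<Union>n. T n)" by simp
  next
    fix x assume x: "x \<in> fst ` N - (\<Union>n. T n)"
    then obtain u where u: "(x, u) \<in> N" by auto
    have "w = u" if w: "outer_unit_normal K x w" for w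
    proof (rule ccontr)
      assume "w \<noteq> u"
      then have "0 < dist w u" by simp
      then obtain n where n: "inverse (real (Suc n)) < dist w u" using reals_Archimedean by blast
      have "(x, w) \<in> N" using u w by (simp add: N_def)
      then have "x \<in> T n"
        unfolding T_def using u n by (intro image_eqI[of _ _ "((x, w), (x, u))"]) auto
      with x show False by blast
    qed
    with u show "x \<in> regular_points K" by (auto simp: regular_points_def N_def)
  qed
  moreover have "(\<Union>n. T n) \<in> sets borel"
    using T by (intro sets.countable_UN') (auto intro: borel_compact)
  ultimately show ?thesis using borel_compact[OF F] by simp
qed

lemma gauss_map_eq:
  assumes "x \<in> regular_points K" "outer_unit_normal K x u"
  shows "gauss_map K x = u"
  using assms unfolding regular_points_def gauss_map_def by (auto intro!: the1_equality)

lemma gauss_map_normal: "x \<in> regular_points K \<Longrightarrow> outer_unit_normal K x (gauss_map K x)"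
  unfolding regular_points_def gauss_map_def by (auto intro: theI')

text \<open>On regular points the normal is unique, so the preimage of a closed set is the trace of
  a projected compact set of point-normal pairs.\<close>

lemma gauss_map_measurable:
  fixes K :: "'a::euclidean_space set"
  assumes K: "compact K"
  shows "gauss_map K \<in> measurable (restrict_space (hausdorff_measure k) (regular_points K)) borel_sphere"
  unfolding borel_sphere_def
proof (rule measurable_restrict_space2)
  let ?M = "restrict_space (hausdorff_measure k) (regular_points K)"
  have sp: "space ?M = regular_points K" by (simp add: space_restrict_space)
  show "gauss_map K \<in> space ?M \<rightarrow> unit_sphere"
    using gauss_map_normal[of _ K] by (auto simp: sp outer_unit_normal_def)
  show "gauss_map K \<in> borel_measurable ?M"
    unfolding borel_eq_closed
  proof (rule measurable_measure_of)
    fix C :: "'a set" assume "C \<in> Collect closed"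
    define N where "N = {(x, u). x \<in> frontier K \<and> outer_unit_normal K x u}"
    have "compact (fst ` (N \<inter> (UNIV \<times> C)))"
      using \<open>C \<in> Collect closed\<close> unfolding N_def
      by (intro compact_continuous_image continuous_intros compact_Int_closed compact_normal_pairs K closed_Times) auto
    moreover have "gauss_map K -` C \<inter> regular_points K = regular_points K \<inter> fst ` (N \<inter> (UNIV \<times> C))"
    proof (intro set_eqI iffI)
      fix x assume x: "x \<in> gauss_map K -` C \<inter> regular_points K"
      then have "(x, gauss_map K x) \<in> N \<inter> (UNIV \<times> C)"
        using gauss_map_normal[of x K] by (simp add: N_def regular_points_def)
      then show "x \<in> regular_points K \<inter> fst ` (N \<inter> (UNIV \<times> C))"
        using x by (metis IntD2 IntI fst_conv imageI)
    next
      fix x assume "x \<in> regular_points K \<inter> fst ` (N \<inter> (UNIV \<times> C))"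
      then obtain u where "x \<in> regular_points K" "outer_unit_normal K x u" "u \<in> C" by (auto simp: N_def)
      then show "x \<in> gauss_map K -` C \<inter> regular_points K" by (simp add: gauss_map_eq)
    qed
    ultimately show "gauss_map K -` C \<inter> space ?M \<in> sets ?M"
      unfolding sp by (auto simp: sets_restrict_space intro: borel_compact)
  qed auto
qed

lemma sets_surface_area_measure [simp]: "sets (surface_area_measure K) = sets borel_sphere"
  by (simp add: surface_area_measure_def)

lemma emeasure_surface_area_measure:
  fixes K :: "'a::euclidean_space set"
  assumes K: "compact K" and A: "A \<in> sets borel_sphere" and d: "2 \<le> DIM('a)"
  shows "emeasure (surface_area_measure K) A
    = hausdorff_outer (DIM('a) - 1) {x \<in> regular_points K. gauss_map K x \<in> A}"
proof -
  let ?H = "hausdorff_measure (DIM('a) - 1) :: 'a measure"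
  let ?R = "restrict_space ?H (regular_points K)"
  have eq: "gauss_map K -` A \<inter> space ?R = {x \<in> regular_points K. gauss_map K x \<in> A}"
    by (auto simp: space_restrict_space)
  have "gauss_map K -` A \<inter> space ?R \<in> sets ?R"
    by (rule measurable_sets[OF gauss_map_measurable[OF K] A])
  then have S: "{x \<in> regular_points K. gauss_map K x \<in> A} \<in> sets borel"
    unfolding eq using regular_points_borel[OF K] by (simp add: sets_restrict_space_iff)
  have "emeasure (surface_area_measure K) A = emeasure ?R {x \<in> regular_points K. gauss_map K x \<in> A}"
    unfolding surface_area_measure_def emeasure_distr[OF gauss_map_measurable[OF K] A] eq ..
  also have "\<dots> = emeasure ?H {x \<in> regular_points K. gauss_map K x \<in> A}"
    using regular_points_borel[OF K] by (intro emeasure_restrict_space) auto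
  also have "\<dots> = hausdorff_outer (DIM('a) - 1) {x \<in> regular_points K. gauss_map K x \<in> A}"
    using d S by (intro emeasure_hausdorff_measure) auto
  finally show ?thesis .
qed

text \<open>Regular points lie on the boundary. Finiteness makes continuous functions on the sphere
  integrable, which gives the integrals in \<open>B_op\<close> their intended meaning.\<close>

lemma finite_surface_area_measure:
  fixes K :: "'a::euclidean_space set"
  assumes K: "convex_body K" and d: "2 \<le> DIM('a)"
  shows "finite_measure (surface_area_measure K)"
proof (rule finite_measureI)
  let ?S = "surface_area_measure K"
  have cK: "compact K" using K by (simp add: convex_body_def)
  have "space ?S \<in> sets borel_sphere"
    using sets.top[of ?S] by simp
  from emeasure_surface_area_measure[OF cK this d]
  have "emeasure ?S (space ?S) \<le> hausdorff_outer (DIM('a) - 1) (frontier K)"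
    using d by (simp only:, intro hausdorff_outer_mono) (auto simp: regular_points_def)
  also have "\<dots> < top" by (rule hausdorff_outer_frontier_finite[OF K d])
  finally show "emeasure ?S (space ?S) \<noteq> \<infinity>" by simp
qed

section \<open>Flat cylinders\<close>

text \<open>For a unit vector \<open>v\<close> this is the orthogonal projection onto the hyperplane
  orthogonal to \<open>v\<close>, written inside the ambient space so that no coordinates on the
  hyperplane have to be chosen.\<close>

definition perp :: "'a::euclidean_space \<Rightarrow> 'a \<Rightarrow> 'a" where
  "perp v x = x - (x \<bullet> v) *\<^sub>R v"

lemma continuous_on_perp [continuous_intros]:
  "continuous_on S f \<Longrightarrow> continuous_on S (\<lambda>x. perp v (f x))"
  unfolding perp_def by (intro continuous_intros)

lemma perp_add: "perp v (x + y) = perp v x + perp v y"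
  by (simp add: perp_def inner_add_left scaleR_add_left)

lemma perp_diff: "perp v (x - y) = perp v x - perp v y"
  by (simp add: perp_def inner_diff_left scaleR_diff_left)

lemma perp_scaleR: "perp v (c *\<^sub>R x) = c *\<^sub>R perp v x"
  by (simp add: perp_def scaleR_diff_right)

lemma perp_self: "norm v = 1 \<Longrightarrow> perp v v = 0"
  by (simp add: perp_def norm_eq_1)

lemma inner_perp: "norm v = 1 \<Longrightarrow> perp v x \<bullet> v = 0"
  by (simp add: perp_def inner_diff_left norm_eq_1)

lemma perp_perp: "norm v = 1 \<Longrightarrow> perp v (perp v x) = perp v x"
  by (simp add: perp_def[of v "perp v x"] inner_perp)

lemma norm_perp_le: "norm v = 1 \<Longrightarrow> norm (perp v x) \<le> norm x"
proof -
  assume v: "norm v = 1"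
  have "(norm x)\<^sup>2 = (norm (perp v x))\<^sup>2 + (norm ((x \<bullet> v) *\<^sub>R v))\<^sup>2"
    using norm_add_Pythagorean[of "perp v x" "(x \<bullet> v) *\<^sub>R v"] inner_perp[OF v, of x]
    by (simp add: orthogonal_def perp_def)
  then have "(norm (perp v x))\<^sup>2 \<le> (norm x)\<^sup>2" by simp
  then show ?thesis by (rule power2_le_imp_le) simp
qed

lemma norm_le_perp: "norm v = 1 \<Longrightarrow> norm x \<le> norm (perp v x) + \<bar>x \<bullet> v\<bar>"
  using norm_triangle_ineq[of "perp v x" "(x \<bullet> v) *\<^sub>R v"] by (simp add: perp_def)

text \<open>A tube of length 1 and radius \<open>\<rho>\<close> is covered by \<open>O(1/\<rho>)\<close> balls of radius \<open>2 \<rho>\<close>.\<close>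

lemma tube_volume:
  fixes v :: "'a::euclidean_space"
  assumes v: "norm v = 1" and \<rho>: "0 < \<rho>" "\<rho> \<le> 1"
  shows "emeasure lborel {x. 0 \<le> x \<bullet> v \<and> x \<bullet> v \<le> 1 \<and> norm (perp v (x - y)) \<le> \<rho>}
    \<le> ennreal (2 ^ (DIM('a) + 2) * unit_ball_vol (real DIM('a)) * \<rho> ^ (DIM('a) - 1))"
    (is "emeasure lborel ?T \<le> _")
proof -
  let ?d = "DIM('a)"
  \<comment> \<open>The centres along the axis are spaced by at most \<rho>, which together with the
    distance \<rho> from the axis gives radius \<open>2 * \<rho>\<close>. There are
    \<open>m + 1 \<le> 4 / \<rho>\<close> balls of volume proportional to
    \<open>(2 * \<rho>) ^ d\<close>, whence the factor \<open>2 ^ (d + 2)\<close>.\<close>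
  define m where "m = nat \<lceil>1 / \<rho>\<rceil>"
  have m: "1 / \<rho> \<le> real m" "real m \<le> 1 / \<rho> + 1"
    using \<rho> by (auto simp: m_def of_nat_ceiling)
  have m0: "0 < real m" using m(1) \<rho> by (smt (verit) divide_pos_pos)
  have m2: "real m \<le> 2 / \<rho>" using m(2) \<rho> by (simp add: field_simps)
  have im: "1 / real m \<le> \<rho>" using m(1) m0 \<rho> by (simp add: field_simps)
  let ?c = "\<lambda>j::nat. perp v y + (real j / real m) *\<^sub>R v"
  have sub: "?T \<subseteq> (\<Union>j\<in>{..m}. cball (?c j) (2 * \<rho>))"
  proof clarify
    fix x assume x: "0 \<le> x \<bullet> v" "x \<bullet> v \<le> 1" "norm (perp v (x - y)) \<le> \<rho>"
    define j where "j = nat \<lfloor>(x \<bullet> v) * real m\<rfloor>"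
    have j: "real j \<le> (x \<bullet> v) * real m" "(x \<bullet> v) * real m < real j + 1"
      using x(1) m0 by (auto simp: j_def)
    have "(x \<bullet> v) * real m \<le> 1 * real m" using x m0 by (intro mult_right_mono) auto
    then have "j \<le> m" using j(1) by linarith
    have "\<bar>x \<bullet> v - real j / real m\<bar> \<le> 1 / real m"
    proof -
      have "real j / real m \<le> x \<bullet> v" using j(1) m0 by (subst pos_divide_le_eq) simp_all
      moreover have "x \<bullet> v < (real j + 1) / real m" using j(2) m0 by (subst pos_less_divide_eq) simp_all
      ultimately show ?thesis by (simp add: add_divide_distrib abs_le_iff)
    qed
    then have b: "\<bar>x \<bullet> v - real j / real m\<bar> \<le> \<rho>" using im by linarith
    have "x - ?c j = perp v (x - y) + (x \<bullet> v - real j / real m) *\<^sub>R v"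
      unfolding perp_diff by (simp add: perp_def scaleR_diff_left)
    then have "norm (x - ?c j) \<le> \<rho> + \<rho>"
      using x(3) b v norm_triangle_ineq[of "perp v (x - y)" "(x \<bullet> v - real j / real m) *\<^sub>R v"] by simp
    then have "x \<in> cball (?c j) (2 * \<rho>)" by (simp add: dist_norm norm_minus_commute)
    with \<open>j \<le> m\<close> show "x \<in> (\<Union>j\<in>{..m}. cball (?c j) (2 * \<rho>))" by blast
  qed
  have "emeasure lborel ?T \<le> emeasure lborel (\<Union>j\<in>{..m}. cball (?c j) (2 * \<rho>))"
    using sub by (intro emeasure_mono) auto
  also have "\<dots> \<le> (\<Sum>j\<in>{..m}. emeasure lborel (cball (?c j) (2 * \<rho>)))"
    by (intro emeasure_subadditive_finite) auto
  also have "\<dots> = ennreal ((real m + 1) * (unit_ball_vol (real ?d) * (2 * \<rho>) ^ ?d))"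
    using \<rho> by (simp add: emeasure_cball ennreal_mult ennreal_of_nat_eq_real_of_nat add.commute)
  also have "\<dots> \<le> ennreal (2 ^ (?d + 2) * unit_ball_vol (real ?d) * \<rho> ^ (?d - 1))"
  proof (rule ennreal_leI)
    have "real m + 1 \<le> 4 / \<rho>" using m2 \<rho> by (simp add: field_simps)
    then have "(real m + 1) * (unit_ball_vol (real ?d) * (2 * \<rho>) ^ ?d)
        \<le> 4 / \<rho> * (unit_ball_vol (real ?d) * (2 * \<rho>) ^ ?d)"
      using \<rho> by (intro mult_right_mono) auto
    also have "\<rho> ^ ?d = \<rho> * \<rho> ^ (?d - 1)" by (simp add: power_eq_if)
    then have "4 / \<rho> * (unit_ball_vol (real ?d) * (2 * \<rho>) ^ ?d)
        = 2 ^ (?d + 2) * unit_ball_vol (real ?d) * \<rho> ^ (?d - 1)"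
      using \<rho> by (simp add: power_mult_distrib)
    finally show "(real m + 1) * (unit_ball_vol (real ?d) * (2 * \<rho>) ^ ?d)
        \<le> 2 ^ (?d + 2) * unit_ball_vol (real ?d) * \<rho> ^ (?d - 1)" .
  qed
  finally show ?thesis .
qed

text \<open>Each set of a cover of the disc is thickened to a tube of length 1 along
  \<open>v\<close> whose radius is the diameter of the set. The tubes cover a fixed ball standing on
  the disc, and their volumes are at most proportional to the terms of the content, which is thus
  bounded below.\<close>

lemma hausdorff_outer_disc_pos:
  fixes v :: "'a::euclidean_space"
  assumes v: "norm v = 1" and d: "2 \<le> DIM('a)"
  shows "0 < hausdorff_outer (DIM('a) - 1) {x. x \<bullet> v = 0 \<and> norm (perp v x) < 1}"
proof -
  let ?d = "DIM('a)" and ?D = "{x. x \<bullet> v = 0 \<and> norm (perp v x) < 1}"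
  define c where "c = 2 ^ (?d + 2) * unit_ball_vol (real ?d)"
  have c: "0 < c" by (simp add: c_def)
  define q where "q = unit_ball_vol (real (?d - 1)) / 2 ^ (?d - 1)"
  have q: "0 < q" by (simp add: q_def)
  define T where "T y \<rho> = {x. 0 \<le> x \<bullet> v \<and> x \<bullet> v \<le> 1 \<and> norm (perp v (x - y)) \<le> \<rho>}" for y \<rho>
  have Tb: "T y \<rho> \<in> sets borel" for y \<rho>
    unfolding T_def by (intro borel_closed closed_Collect_conj closed_Collect_le continuous_intros)
  \<comment> \<open>Covering sets may be single points, so radius 0 must be allowed; the bound is
    extended by letting the radius decrease to \<open>r\<close>. The scale 1/2 used below keeps all
    diameters under 1.\<close>
  have tube: "emeasure lborel (T y r) \<le> ennreal (c * r ^ (?d - 1))" if r: "0 \<le> r" "r < 1" for y r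
  proof -
    have "((\<lambda>\<rho>. ennreal (c * \<rho> ^ (?d - 1))) \<longlongrightarrow> ennreal (c * r ^ (?d - 1))) (at_right r)"
      by (intro tendsto_intros tendsto_ennrealI)
    moreover have "eventually (\<lambda>\<rho>. emeasure lborel (T y r) \<le> ennreal (c * \<rho> ^ (?d - 1))) (at_right r)"
    proof (rule eventually_at_rightI[OF _ r(2)])
      fix \<rho> assume \<rho>: "\<rho> \<in> {r<..<1}"
      have "emeasure lborel (T y r) \<le> emeasure lborel (T y \<rho>)"
        using \<rho> Tb by (intro emeasure_mono) (auto simp: T_def)
      also have "\<dots> \<le> ennreal (c * \<rho> ^ (?d - 1))"
        using tube_volume[OF v, of \<rho> y] \<rho> r by (simp add: T_def c_def)
      finally show "emeasure lborel (T y r) \<le> ennreal (c * \<rho> ^ (?d - 1))" .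
    qed
    ultimately show ?thesis by (rule tendsto_lowerbound) simp
  qed
  define V where "V = emeasure lborel (ball ((1/2) *\<^sub>R v) (1/2))"
  have V: "V = ennreal (unit_ball_vol (real ?d) * (1/2) ^ ?d)"
    unfolding V_def by (simp add: emeasure_ball)
  have content: "V / ennreal (c / q) \<le> hausdorff_content (?d - 1) (1/2) ?D"
  proof -
    have "V \<le> ennreal (c / q) * (\<Sum>i. ennreal (unit_ball_vol (real (?d - 1)) * (diameter (C i) / 2) ^ (?d - 1)))"
      if C: "?D \<subseteq> (\<Union>i. C i)" "\<forall>i. bounded (C i) \<and> diameter (C i) \<le> 1/2" for C :: "nat \<Rightarrow> 'a set"
    proof -
      \<comment> \<open>The axis passes through an arbitrary point of \<open>C i\<close>; a radius
        equal to the diameter then captures everything above \<open>C i\<close>.\<close>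
      define W where "W i = (if C i = {} then {} else T (SOME y. y \<in> C i) (diameter (C i)))" for i
      have Wb: "W i \<in> sets borel" for i by (simp add: W_def Tb)
      have sub: "ball ((1/2) *\<^sub>R v) (1/2) \<subseteq> (\<Union>i. W i)"
      proof
        fix x assume "x \<in> ball ((1/2) *\<^sub>R v) (1/2)"
        then have x: "norm (x - (1/2) *\<^sub>R v) < 1/2" by (simp add: dist_norm norm_minus_commute)
        have "\<bar>(x - (1/2) *\<^sub>R v) \<bullet> v\<bar> < 1/2"
          using Cauchy_Schwarz_ineq2[of "x - (1/2) *\<^sub>R v" v] v x by simp
        moreover have "(x - (1/2) *\<^sub>R v) \<bullet> v = x \<bullet> v - 1/2"
          using v by (simp add: inner_diff_left norm_eq_1)
        ultimately have xv: "0 \<le> x \<bullet> v" "x \<bullet> v \<le> 1" unfolding abs_less_iff by linarith+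
        have "perp v (x - (1/2) *\<^sub>R v) = perp v x" using perp_self[OF v] by (simp add: perp_diff perp_scaleR)
        then have "norm (perp v x) < 1" using norm_perp_le[OF v, of "x - (1/2) *\<^sub>R v"] x by simp
        then have "perp v x \<in> ?D" by (simp add: inner_perp perp_perp v)
        then obtain i where i: "perp v x \<in> C i" using C(1) by blast
        define y where "y = (SOME y. y \<in> C i)"
        have y: "y \<in> C i" unfolding y_def using i by (rule someI)
        have "norm (perp v (x - y)) = norm (perp v (perp v x - y))"
          by (simp add: perp_diff perp_perp v)
        also have "\<dots> \<le> norm (perp v x - y)" by (rule norm_perp_le[OF v])
        also have "\<dots> \<le> diameter (C i)"
          using diameter_bounded_bound[of "C i" "perp v x" y] C(2) i y by (simp add: dist_norm)
        finally have "x \<in> W i" using i xv by (auto simp: W_def T_def y_def)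
        then show "x \<in> (\<Union>i. W i)" by blast
      qed
      have "V \<le> emeasure lborel (\<Union>i. W i)"
        unfolding V_def using Wb by (intro emeasure_mono sub) auto
      also have "\<dots> \<le> (\<Sum>i. emeasure lborel (W i))"
        using Wb by (intro emeasure_subadditive_countably) auto
      also have "\<dots> \<le> (\<Sum>i. ennreal (c / q) * ennreal (unit_ball_vol (real (?d - 1)) * (diameter (C i) / 2) ^ (?d - 1)))"
      proof (intro suminf_le summableI)
        fix i
        have dC: "0 \<le> diameter (C i)" "diameter (C i) < 1"
          using C(2) diameter_ge_0[of "C i"] by (auto intro: le_less_trans[of _ "1/2"])
        have "emeasure lborel (W i) \<le> ennreal (c * diameter (C i) ^ (?d - 1))"
          using tube[OF dC] by (simp add: W_def)
        also have "c * diameter (C i) ^ (?d - 1)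
            = (c / q) * (unit_ball_vol (real (?d - 1)) * (diameter (C i) / 2) ^ (?d - 1))"
        proof -
          obtain w where w: "w = unit_ball_vol (real (?d - 1))" "0 < w" by simp
          then show ?thesis unfolding q_def w(1)[symmetric] by (simp add: power_divide)
        qed
        also have "ennreal \<dots> = ennreal (c / q) * ennreal (unit_ball_vol (real (?d - 1)) * (diameter (C i) / 2) ^ (?d - 1))"
          using c q dC by (intro ennreal_mult) auto
        finally show "emeasure lborel (W i)
          \<le> ennreal (c / q) * ennreal (unit_ball_vol (real (?d - 1)) * (diameter (C i) / 2) ^ (?d - 1))" .
      qed
      also have "\<dots> = ennreal (c / q) * (\<Sum>i. ennreal (unit_ball_vol (real (?d - 1)) * (diameter (C i) / 2) ^ (?d - 1)))"
        by (rule ennreal_suminf_cmult)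
      finally show ?thesis .
    qed
    note * = this
    show ?thesis
      unfolding hausdorff_content_def
      using * c q by (intro INF_greatest divide_le_posI_ennreal) auto
  qed
  have "0 < V" by (simp add: V)
  then have "0 < V / ennreal (c / q)" by (simp add: ennreal_zero_less_divide)
  also note content
  also have "hausdorff_content (?d - 1) (1/2) ?D \<le> hausdorff_outer (?d - 1) ?D"
    unfolding hausdorff_outer_def by (intro SUP_upper) auto
  finally show ?thesis .
qed

section \<open>Boundary structure of a cylinder\<close>

definition cylinder :: "'a::euclidean_space \<Rightarrow> real \<Rightarrow> 'a set" where
  "cylinder v h = {x. \<bar>x \<bullet> v\<bar> \<le> h \<and> norm (perp v x) \<le> 1}"

lemma interior_cylinder_superset: "{x. \<bar>x \<bullet> v\<bar> < h \<and> norm (perp v x) < 1} \<subseteq> interior (cylinder v h)"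
proof (rule interior_maximal)
  show "open {x. \<bar>x \<bullet> v\<bar> < h \<and> norm (perp v x) < 1}"
    by (intro open_Collect_conj open_Collect_less continuous_intros)
qed (auto simp: cylinder_def)

lemma compact_cylinder:
  assumes v: "norm v = 1"
  shows "compact (cylinder v h)"
proof -
  have "closed (cylinder v h)"
    unfolding cylinder_def by (intro closed_Collect_conj closed_Collect_le continuous_intros)
  moreover have "bounded (cylinder v h)"
    unfolding bounded_iff
  proof (intro exI[of _ "1 + h"] ballI)
    fix x assume "x \<in> cylinder v h"
    then show "norm x \<le> 1 + h" using norm_le_perp[OF v, of x] by (simp add: cylinder_def)
  qed
  ultimately show ?thesis by (simp add: compact_eq_bounded_closed)
qed

lemma convex_body_cylinder:
  assumes v: "norm v = 1" and h: "0 < h"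
  shows "convex_body (cylinder v h)"
proof -
  have "convex (cylinder v h)"
  proof (rule convexI)
    fix x y :: 'a and a b :: real
    assume xy: "x \<in> cylinder v h" "y \<in> cylinder v h" and ab: "0 \<le> a" "0 \<le> b" "a + b = 1"
    have "\<bar>a * (x \<bullet> v) + b * (y \<bullet> v)\<bar> \<le> a * \<bar>x \<bullet> v\<bar> + b * \<bar>y \<bullet> v\<bar>"
      using ab abs_triangle_ineq[of "a * (x \<bullet> v)" "b * (y \<bullet> v)"] by (simp add: abs_mult)
    also have "\<dots> \<le> h" using xy ab by (intro convex_bound_le) (auto simp: cylinder_def)
    finally have 1: "\<bar>a * (x \<bullet> v) + b * (y \<bullet> v)\<bar> \<le> h" .
    have "norm (a *\<^sub>R perp v x + b *\<^sub>R perp v y) \<le> a * norm (perp v x) + b * norm (perp v y)"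
      using ab norm_triangle_ineq[of "a *\<^sub>R perp v x" "b *\<^sub>R perp v y"] by simp
    also have "\<dots> \<le> 1" using xy ab by (intro convex_bound_le) (auto simp: cylinder_def)
    finally show "a *\<^sub>R x + b *\<^sub>R y \<in> cylinder v h"
      using 1 by (simp add: cylinder_def inner_add_left perp_add perp_scaleR)
  qed
  moreover have "0 \<in> interior (cylinder v h)"
    using interior_cylinder_superset[of v h] h by (auto simp: perp_def)
  ultimately show ?thesis using compact_cylinder[OF v] by (auto simp: convex_body_def)
qed

text \<open>The sign \<open>s\<close> treats both caps at once. A normal \<open>u\<close> at
  \<open>x\<close> cannot have a component in the hyperplane, because \<open>x\<close> can be moved
  a little in that direction within the cap; comparison with the opposite cap then fixes its
  sign.\<close>

lemma cylinder_cap_normal: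
  assumes v: "norm v = 1" and h: "0 < h" and s: "s \<in> {1, -1}"
    and x: "x \<bullet> v = s * h" "norm (perp v x) < 1"
  shows "x \<in> frontier (cylinder v h)" "outer_unit_normal (cylinder v h) x u \<longleftrightarrow> u = s *\<^sub>R v"
proof -
  have xK: "x \<in> cylinder v h" using s h x by (auto simp: cylinder_def)
  have ss: "s * s = 1" "\<bar>s\<bar> = 1" using s by auto
  have n: "outer_unit_normal (cylinder v h) x (s *\<^sub>R v)"
    unfolding outer_unit_normal_def
  proof (intro conjI ballI)
    show "s *\<^sub>R v \<in> unit_sphere" using v ss by simp
    fix y assume "y \<in> cylinder v h"
    then have "s * (y \<bullet> v) \<le> h" using s by (auto simp: cylinder_def)
    moreover have "s * (x \<bullet> v) = h" using x ss by (simp add: algebra_simps)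
    ultimately show "(s *\<^sub>R v) \<bullet> y \<le> (s *\<^sub>R v) \<bullet> x" by (simp add: inner_commute)
  qed
  have "x \<notin> interior (cylinder v h)"
  proof
    assume "x \<in> interior (cylinder v h)"
    then obtain e where e: "0 < e" "cball x e \<subseteq> cylinder v h" by (auto simp: mem_interior_cball)
    have "x + (e * s) *\<^sub>R v \<in> cball x e" using v ss e by (simp add: dist_norm abs_mult)
    then have "x + (e * s) *\<^sub>R v \<in> cylinder v h" using e by blast
    moreover have "(x + (e * s) *\<^sub>R v) \<bullet> v = s * (h + e)" using v x by (simp add: inner_add_left norm_eq_1 algebra_simps)
    ultimately have "\<bar>s * (h + e)\<bar> \<le> h" by (simp add: cylinder_def)
    then show False using ss e h by (simp add: abs_mult)
  qed
  then show "x \<in> frontier (cylinder v h)" using xK closure_subset by (auto simp: frontier_def)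
  have "u = s *\<^sub>R v" if u: "outer_unit_normal (cylinder v h) x u"
  proof -
    have un: "norm u = 1" and uK: "\<And>y. y \<in> cylinder v h \<Longrightarrow> u \<bullet> y \<le> u \<bullet> x"
      using u by (auto simp: outer_unit_normal_def)
    define \<eta> where "\<eta> = 1 - norm (perp v x)"
    have \<eta>: "0 < \<eta>" using x by (simp add: \<eta>_def)
    have "norm (perp v x + \<eta> *\<^sub>R perp v u) \<le> 1"
    proof -
      have "norm (\<eta> *\<^sub>R perp v u) \<le> \<eta>"
        using norm_perp_le[OF v, of u] un \<eta> mult_left_mono[of "norm (perp v u)" 1 \<eta>] by simp
      then show ?thesis
        using norm_triangle_ineq[of "perp v x" "\<eta> *\<^sub>R perp v u"] unfolding \<eta>_def by linarith
    qed
    then have "x + \<eta> *\<^sub>R perp v u \<in> cylinder v h"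
      using xK by (simp add: cylinder_def inner_add_left inner_perp perp_add perp_scaleR perp_perp v)
    from uK[OF this] have "\<eta> * (u \<bullet> perp v u) \<le> 0" by (simp add: inner_add_right)
    then have "u \<bullet> perp v u \<le> 0" using \<eta> by (simp add: mult_le_0_iff)
    moreover have "u \<bullet> perp v u = perp v u \<bullet> perp v u"
    proof -
      have "perp v u \<bullet> perp v u = u \<bullet> perp v u - (u \<bullet> v) * (v \<bullet> perp v u)"
        by (simp add: perp_def[of v u] inner_diff_left)
      moreover have "v \<bullet> perp v u = 0" using inner_perp[OF v, of u] by (simp add: inner_commute)
      ultimately show ?thesis by simp
    qed
    ultimately have "perp v u = 0" by (metis inner_eq_zero_iff inner_ge_zero order_antisym)
    then have uv: "u = (u \<bullet> v) *\<^sub>R v" by (simp add: perp_def)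
    then have "\<bar>u \<bullet> v\<bar> = 1" using un v by (metis mult.right_neutral norm_scaleR)
    moreover have "0 \<le> s * (u \<bullet> v)"
    proof -
      \<comment> \<open>This is the point opposite \<open>x\<close> on the other cap, at height
        \<open>- s * h\<close>.\<close>
      have "x - (2 * h * s) *\<^sub>R v \<in> cylinder v h"
        using xK x s h v by (auto simp: cylinder_def perp_diff perp_scaleR perp_self inner_diff_left norm_eq_1)
      from uK[OF this] have "0 \<le> 2 * h * (s * (u \<bullet> v))" by (simp add: inner_diff_right algebra_simps)
      then show ?thesis using h by (simp add: zero_le_mult_iff)
    qed
    ultimately have "u \<bullet> v = s" using s by auto
    with uv show ?thesis by simp
  qed
  with n show "outer_unit_normal (cylinder v h) x u \<longleftrightarrow> u = s *\<^sub>R v" by auto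
qed

lemma cylinder_cap_regular:
  assumes v: "norm v = 1" and h: "0 < h" and s: "s \<in> {1, -1}"
    and x: "x \<bullet> v = s * h" "norm (perp v x) < 1"
  shows "x \<in> regular_points (cylinder v h)" "gauss_map (cylinder v h) x = s *\<^sub>R v"
proof -
  show r: "x \<in> regular_points (cylinder v h)"
    using cylinder_cap_normal[OF assms] by (auto simp: regular_points_def)
  show "gauss_map (cylinder v h) x = s *\<^sub>R v"
    using gauss_map_eq[OF r] cylinder_cap_normal(2)[OF assms] by blast
qed

text \<open>A boundary point whose projection lies in the open disc belongs to a cap and has normal
  \<open>v\<close> or \<open>- v\<close>. All remaining surface area is therefore carried by the
  lateral side including its rims.\<close>

lemma cylinder_side:
  assumes v: "norm v = 1" and h: "0 < h"
    and x: "x \<in> regular_points (cylinder v h)" "gauss_map (cylinder v h) x \<notin> {v, - v}"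
  shows "\<bar>x \<bullet> v\<bar> \<le> h \<and> norm (perp v x) = 1"
proof -
  have xf: "x \<in> frontier (cylinder v h)" using x(1) by (simp add: regular_points_def)
  then have xK: "x \<in> cylinder v h"
    using compact_cylinder[OF v, of h] by (simp add: frontier_def compact_imp_closed)
  have "\<not> norm (perp v x) < 1"
  proof
    assume p: "norm (perp v x) < 1"
    have "x \<notin> interior (cylinder v h)" using xf by (simp add: frontier_def)
    then have "\<not> \<bar>x \<bullet> v\<bar> < h" using interior_cylinder_superset[of v h] p by blast
    then have "x \<bullet> v = 1 * h \<or> x \<bullet> v = - 1 * h" using xK by (auto simp: cylinder_def)
    then show False
      using cylinder_cap_regular(2)[OF v h _ _ p, of 1] cylinder_cap_regular(2)[OF v h _ _ p, of "-1"] x(2) by auto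
  qed
  then show ?thesis using xK by (auto simp: cylinder_def)
qed

text \<open>The lateral surface with its rims. For \<open>h = 0\<close> it degenerates to the unit
  sphere of the hyperplane, the limit of the sides of flat cylinders.\<close>

definition side :: "'a::euclidean_space \<Rightarrow> real \<Rightarrow> 'a set" where
  "side v h = {x. \<bar>x \<bullet> v\<bar> \<le> h \<and> norm (perp v x) = 1}"

lemma side_borel: "side v h \<in> sets borel"
  unfolding side_def
  by (intro borel_closed closed_Collect_conj closed_Collect_le closed_Collect_eq continuous_intros)

text \<open>Places all flat sides in the boundary of one fixed convex body, whose finite measure
  permits continuity from above.\<close>

lemma side_frontier:
  assumes v: "norm v = 1" and h: "h \<le> 1"
  shows "side v h \<subseteq> frontier (cylinder v 1)"
proof
  fix x assume x: "x \<in> side v h"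
  then have xK: "x \<in> cylinder v 1" using h by (auto simp: side_def cylinder_def)
  have "x \<notin> interior (cylinder v 1)"
  proof
    assume "x \<in> interior (cylinder v 1)"
    then obtain e where e: "0 < e" "cball x e \<subseteq> cylinder v 1" by (auto simp: mem_interior_cball)
    have "x + e *\<^sub>R perp v x \<in> cball x e" using e x by (simp add: dist_norm side_def)
    then have "norm (perp v (x + e *\<^sub>R perp v x)) \<le> 1" using e by (auto simp: cylinder_def)
    moreover have "perp v (x + e *\<^sub>R perp v x) = (1 + e) *\<^sub>R perp v x"
      by (simp add: perp_add perp_scaleR perp_perp v scaleR_add_left)
    ultimately show False using x e by (simp add: side_def)
  qed
  then show "x \<in> frontier (cylinder v 1)" using xK closure_subset by (auto simp: frontier_def)
qed

lemma side_mono: "a \<le> b \<Longrightarrow> side v a \<subseteq> side v b"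
  by (auto simp: side_def)

text \<open>The rim has measure zero because the side of a cylinder contains infinitely many disjoint
  translates of it; hence the sides of flat cylinders have small measure.\<close>

lemma side_measure_tendsto_0:
  fixes v :: "'a::euclidean_space"
  assumes v: "norm v = 1" and d: "2 \<le> DIM('a)"
  shows "(\<lambda>n. hausdorff_outer (DIM('a) - 1) (side v (inverse (real (Suc n))))) \<longlonglongrightarrow> 0"
proof -
  let ?H = "hausdorff_measure (DIM('a) - 1) :: 'a measure"
  have H: "emeasure ?H A = hausdorff_outer (DIM('a) - 1) A" if "A \<in> sets borel" for A
    using that d by (intro emeasure_hausdorff_measure) auto
  have M: "emeasure ?H (frontier (cylinder v 1)) < top"
    using hausdorff_outer_frontier_finite[OF convex_body_cylinder[OF v] d, of 1]
    by (subst H) (auto intro: borel_closed)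
  have le: "emeasure ?H A \<le> emeasure ?H (frontier (cylinder v 1))" if "A \<subseteq> frontier (cylinder v 1)" for A
    using that by (intro emeasure_mono) auto
  let ?S = "\<lambda>n. side v (inverse (real (Suc n)))"
  have sub: "?S n \<subseteq> frontier (cylinder v 1)" for n
    by (rule side_frontier[OF v]) (simp add: inverse_le_1_iff)
  have "(\<lambda>n. emeasure ?H (?S n)) \<longlonglongrightarrow> emeasure ?H (\<Inter>n. ?S n)"
  proof (rule Lim_emeasure_decseq)
    show "decseq ?S"
    proof (rule decseq_SucI)
      fix n
      have "inverse (real (Suc (Suc n))) \<le> inverse (real (Suc n))" by (intro le_imp_inverse_le) auto
      then show "?S (Suc n) \<subseteq> ?S n" by (rule side_mono)
    qed
    show "emeasure ?H (?S n) \<noteq> \<infinity>" for n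
      using le[OF sub[of n]] M by (auto simp: top_unique)
  qed (auto simp: side_borel)
  moreover have "(\<Inter>n. ?S n) = side v 0"
  proof (intro set_eqI iffI)
    fix x assume x: "x \<in> (\<Inter>n. ?S n)"
    have "\<not> 0 < \<bar>x \<bullet> v\<bar>"
    proof
      assume "0 < \<bar>x \<bullet> v\<bar>"
      then obtain n where "inverse (real (Suc n)) < \<bar>x \<bullet> v\<bar>" using reals_Archimedean by blast
      moreover have "x \<in> ?S n" using x by blast
      ultimately show False by (simp add: side_def)
    qed
    then show "x \<in> side v 0" using x by (auto simp: side_def)
  qed (auto simp: side_def)
  moreover have "emeasure ?H (side v 0) = 0"
  proof -
    define A where "A n = (+) (inverse (real (Suc n)) *\<^sub>R v) ` side v 0" for n
    have Ae: "A n = {x. x \<bullet> v = inverse (real (Suc n)) \<and> norm (perp v x) = 1}" for n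
    proof (intro set_eqI iffI)
      fix x assume "x \<in> {x. x \<bullet> v = inverse (real (Suc n)) \<and> norm (perp v x) = 1}"
      then have "x - inverse (real (Suc n)) *\<^sub>R v \<in> side v 0"
        using v by (simp add: side_def inner_diff_left norm_eq_1 perp_diff perp_scaleR perp_self)
      then show "x \<in> A n" unfolding A_def by (intro image_eqI) auto
    qed (use v in \<open>auto simp: A_def side_def inner_add_left norm_eq_1 perp_add perp_scaleR perp_self\<close>)
    have Ab: "A n \<in> sets borel" for n
      unfolding Ae by (intro borel_closed closed_Collect_conj closed_Collect_eq continuous_intros)
    have "(\<Sum>n. emeasure ?H (A n)) = emeasure ?H (\<Union>n. A n)"
      using Ab by (intro suminf_emeasure) (auto simp: disjoint_family_on_def Ae)
    also have "\<dots> \<le> emeasure ?H (frontier (cylinder v 1))"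
    proof (rule le, clarify)
      fix x n assume "x \<in> A n"
      then have "x \<in> side v 1" by (auto simp: Ae side_def inverse_le_1_iff)
      then show "x \<in> frontier (cylinder v 1)" using side_frontier[OF v, of 1] by auto
    qed
    finally have "(\<Sum>n. emeasure ?H (A n)) < top" using M by (rule order_le_less_trans)
    moreover have "emeasure ?H (A n) = emeasure ?H (side v 0)" for n
      unfolding H[OF Ab] H[OF side_borel] by (simp add: A_def hausdorff_outer_translation)
    ultimately have fin: "(\<Sum>n::nat. emeasure ?H (side v 0)) < top" by simp
    show ?thesis
    proof -
      \<comment> \<open>A tail of a constant series is the series itself, so a finite sum lies below
        every positive \<open>e\<close>.\<close>
      have "emeasure ?H (side v 0) \<le> 0"
      proof (rule ennreal_le_epsilon)
        fix e :: real assume "0 < e"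
        then obtain n where n: "(\<Sum>i::nat. emeasure ?H (side v 0)) < ennreal e"
          using ennreal_suminf_tail_less[OF fin] by blast
        have "emeasure ?H (side v 0) \<le> (\<Sum>i::nat. emeasure ?H (side v 0))"
          using sum_le_suminf[of "\<lambda>_::nat. emeasure ?H (side v 0)" "{0}"] by simp
        with n show "emeasure ?H (side v 0) \<le> 0 + ennreal e" by simp
      qed
      then show ?thesis by simp
    qed
  qed
  ultimately show ?thesis by (simp only: H[OF side_borel, symmetric])
qed

lemma even_function_zero_if_surface_integrals_zero:
  fixes g :: "'a::euclidean_space \<Rightarrow> real"
  assumes d: "2 \<le> DIM('a)" and v: "norm v = 1"
    and g: "continuous_on unit_sphere g" and even: "g (- v) = g v"
    and zero: "\<And>K. convex_body K \<Longrightarrow> (\<integral>x. g x \<partial>surface_area_measure K) = 0"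
  shows "g v = 0"
proof -
  let ?k = "DIM('a) - 1"
  obtain B where B: "\<And>x. x \<in> unit_sphere \<Longrightarrow> \<bar>g x\<bar> \<le> B"
    using compact_imp_bounded[OF compact_continuous_image[OF g compact_sphere]]
    unfolding bounded_iff real_norm_def by blast
  have B0: "0 \<le> B" using B[of v] v by simp
  \<comment> \<open>Translation by \<open>h *\<^sub>R v\<close> carries the open disc to the upper
    cap, so \<open>c\<close> bounds the mass at \<open>v\<close> and \<open>- v\<close> from below
    for every height.\<close>
  define c where "c = hausdorff_outer ?k {x. x \<bullet> v = 0 \<and> norm (perp v x) < 1}"
  have c: "0 < c" unfolding c_def by (rule hausdorff_outer_disc_pos[OF v d])
  have main: "ennreal \<bar>g v\<bar> * c \<le> ennreal B * hausdorff_outer ?k (side v h)" if h: "0 < h" for h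
  proof -
    let ?K = "cylinder v h"
    let ?S = "surface_area_measure ?K"
    interpret finite_measure ?S
      by (rule finite_surface_area_measure[OF convex_body_cylinder[OF v h] d])
    have sp: "space ?S = unit_sphere"
      using sets_eq_imp_space_eq[OF sets_surface_area_measure[of ?K]]
      by (simp add: borel_sphere_def space_restrict_space)
    have em: "emeasure ?S A = hausdorff_outer ?k {x \<in> regular_points ?K. gauss_map ?K x \<in> A}"
      if "A \<in> sets borel_sphere" for A
      by (rule emeasure_surface_area_measure[OF compact_cylinder[OF v] that d])
    have Pm: "{v, - v} \<in> sets borel_sphere"
      using v by (simp add: borel_sphere_def sets_restrict_space_iff)
    have Cm: "unit_sphere - {v, - v} \<in> sets borel_sphere"
      using v by (simp add: borel_sphere_def sets_restrict_space_iff)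
    have gm: "g \<in> borel_measurable ?S"
    proof -
      have "g \<in> borel_measurable borel_sphere"
        unfolding borel_sphere_def by (intro borel_measurable_continuous_on_restrict g)
      then show ?thesis by (simp cong: measurable_cong_sets add: measurable_cong_sets[OF sets_surface_area_measure refl])
    qed
    have gi: "integrable ?S g"
      by (rule integrable_const_bound[of _ B]) (use gm B in \<open>auto simp: sp\<close>)
    \<comment> \<open>Evenness gives \<open>g\<close> the same value on both atoms, so their
      contributions cannot cancel.\<close>
    have split: "g x = g v * indicator {v, - v} x + g x * indicator (unit_sphere - {v, - v}) x"
      if "x \<in> unit_sphere" for x
      using that even by (auto simp: indicator_def)
    have "(\<integral>x. g x \<partial>?S) = (\<integral>x. g v * indicator {v, - v} x + g x * indicator (unit_sphere - {v, - v}) x \<partial>?S)"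
      using split by (intro Bochner_Integration.integral_cong) (auto simp: sp)
    also have "\<dots> = g v * measure ?S {v, - v} + (\<integral>x. g x * indicator (unit_sphere - {v, - v}) x \<partial>?S)"
    proof (subst Bochner_Integration.integral_add)
      show "integrable ?S (\<lambda>x. g v * indicator {v, - v} x)"
        using Pm by (intro integrable_mult_right integrable_real_indicator) (auto simp: emeasure_eq_measure)
      show "integrable ?S (\<lambda>x. g x * indicator (unit_sphere - {v, - v}) x)"
        using Cm gi by (intro integrable_real_mult_indicator) auto
      have "{v, - v} \<inter> unit_sphere = {v, - v}" using v by auto
      then show "(\<integral>x. g v * indicator {v, - v} x \<partial>?S) + (\<integral>x. g x * indicator (unit_sphere - {v, - v}) x \<partial>?S)
          = g v * measure ?S {v, - v} + (\<integral>x. g x * indicator (unit_sphere - {v, - v}) x \<partial>?S)"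
        by (simp add: sp)
    qed
    finally have "g v * measure ?S {v, - v} = - (\<integral>x. g x * indicator (unit_sphere - {v, - v}) x \<partial>?S)"
      using zero[OF convex_body_cylinder[OF v h]] by simp
    then have "\<bar>g v\<bar> * measure ?S {v, - v} = \<bar>\<integral>x. g x * indicator (unit_sphere - {v, - v}) x \<partial>?S\<bar>"
      by (metis abs_minus_cancel abs_mult abs_of_nonneg measure_nonneg)
    also have "\<dots> \<le> (\<integral>x. \<bar>g x * indicator (unit_sphere - {v, - v}) x\<bar> \<partial>?S)"
      by (rule integral_abs_bound)
    also have "\<dots> \<le> (\<integral>x. B * indicator (unit_sphere - {v, - v}) x \<partial>?S)"
    proof (intro integral_mono integrable_abs)
      show "integrable ?S (\<lambda>x. g x * indicator (unit_sphere - {v, - v}) x)"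
        using Cm gi by (intro integrable_real_mult_indicator) auto
      show "integrable ?S (\<lambda>x. B * indicator (unit_sphere - {v, - v}) x)"
        using Cm by (intro integrable_mult_right integrable_real_indicator) (auto simp: emeasure_eq_measure)
    qed (use B in \<open>auto simp: sp indicator_def\<close>)
    also have "\<dots> = B * measure ?S (unit_sphere - {v, - v})"
      using Cm by (simp add: sp Int_absorb2)
    finally have "\<bar>g v\<bar> * measure ?S {v, - v} \<le> B * measure ?S (unit_sphere - {v, - v})" .
    then have 1: "ennreal \<bar>g v\<bar> * emeasure ?S {v, - v} \<le> ennreal B * emeasure ?S (unit_sphere - {v, - v})"
      using B0 by (simp add: emeasure_eq_measure ennreal_leI flip: ennreal_mult)
    have "c = hausdorff_outer ?k ((+) (h *\<^sub>R v) ` {x. x \<bullet> v = 0 \<and> norm (perp v x) < 1})"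
      by (simp add: c_def hausdorff_outer_translation)
    also have "\<dots> \<le> emeasure ?S {v, - v}"
      unfolding em[OF Pm]
    proof (intro hausdorff_outer_mono)
      show "(+) (h *\<^sub>R v) ` {x. x \<bullet> v = 0 \<and> norm (perp v x) < 1} \<subseteq> {x \<in> regular_points ?K. gauss_map ?K x \<in> {v, - v}}"
      proof clarify
        fix x assume x: "x \<bullet> v = 0" "norm (perp v x) < 1"
        have "(h *\<^sub>R v + x) \<bullet> v = 1 * h" "norm (perp v (h *\<^sub>R v + x)) < 1"
          using v x by (auto simp: inner_add_left norm_eq_1 perp_add perp_scaleR perp_self)
        from cylinder_cap_regular[OF v h _ this]
        show "h *\<^sub>R v + x \<in> regular_points ?K \<and> gauss_map ?K (h *\<^sub>R v + x) \<in> {v, - v}" by simp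
      qed
    qed (use d in simp)
    finally have 2: "c \<le> emeasure ?S {v, - v}" .
    have 3: "emeasure ?S (unit_sphere - {v, - v}) \<le> hausdorff_outer ?k (side v h)"
      unfolding em[OF Cm] using d cylinder_side[OF v h]
      by (intro hausdorff_outer_mono) (auto simp: side_def)
    have "ennreal \<bar>g v\<bar> * c \<le> ennreal \<bar>g v\<bar> * emeasure ?S {v, - v}" using 2 by (intro mult_left_mono) auto
    also note 1
    also have "ennreal B * emeasure ?S (unit_sphere - {v, - v}) \<le> ennreal B * hausdorff_outer ?k (side v h)"
      using 3 by (intro mult_left_mono) auto
    finally show ?thesis .
  qed
  have "(\<lambda>n. ennreal B * hausdorff_outer ?k (side v (inverse (real (Suc n))))) \<longlonglongrightarrow> ennreal B * 0"
    by (intro ennreal_tendsto_cmult side_measure_tendsto_0 v d) simp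
  then have "ennreal \<bar>g v\<bar> * c \<le> ennreal B * 0"
    by (rule LIMSEQ_le_const) (intro exI allI impI main, simp)
  then show "g v = 0" using c by auto
qed

section \<open>Homogeneous polynomials and the Laplacian\<close>

text \<open>An inductive form of \<open>homogeneous_polynomial\<close>: algebraic closure,
  derivatives and Euler's identity follow by rule induction instead of manipulation of multi-index
  sums.\<close>

inductive hom_poly :: "nat \<Rightarrow> (real^'n \<Rightarrow> real) \<Rightarrow> bool" where
  hom_poly_const: "hom_poly 0 (\<lambda>x. c)"
| hom_poly_var: "hom_poly l p \<Longrightarrow> hom_poly (Suc l) (\<lambda>x. x $ i * p x)"
| hom_poly_add: "hom_poly l p \<Longrightarrow> hom_poly l q \<Longrightarrow> hom_poly l (\<lambda>x. p x + q x)"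

lemma hom_poly_zero: "hom_poly l (\<lambda>x. 0)"
proof (induction l)
  case (Suc l)
  then show ?case using hom_poly_var[of l "\<lambda>x. 0"] by simp
qed (rule hom_poly_const)

lemma hom_poly_mult:
  assumes "hom_poly l p" "hom_poly m q"
  shows "hom_poly (l + m) (\<lambda>x. p x * q x)"
  using assms(1)
proof induction
  case (hom_poly_const c)
  from assms(2) show ?case
  proof induction
    case (hom_poly_const c')
    then show ?case using hom_poly.hom_poly_const[of "c * c'"] by simp
  next
    case (hom_poly_var l p i)
    then show ?case using hom_poly.hom_poly_var[of "0 + l" "\<lambda>x. c * p x" i] by (simp add: mult.left_commute)
  next
    case (hom_poly_add l p q)
    then show ?case using hom_poly.hom_poly_add by (simp add: distrib_left)
  qed
next
  case (hom_poly_var l p i)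
  then show ?case using hom_poly.hom_poly_var[of "l + m" "\<lambda>x. p x * q x" i] by (simp add: mult.assoc)
next
  case (hom_poly_add l p q)
  then show ?case using hom_poly.hom_poly_add by (simp add: distrib_right)
qed

lemma hom_poly_cmult: "hom_poly l p \<Longrightarrow> hom_poly l (\<lambda>x. c * p x)"
  using hom_poly_mult[OF hom_poly_const] by fastforce

lemma hom_poly_diff: "hom_poly l p \<Longrightarrow> hom_poly l q \<Longrightarrow> hom_poly l (\<lambda>x. p x - q x)"
  using hom_poly_add[OF _ hom_poly_cmult, of l p q "-1"] by simp

lemma hom_poly_sum: "(\<And>i. i \<in> I \<Longrightarrow> hom_poly l (f i)) \<Longrightarrow> hom_poly l (\<lambda>x. \<Sum>i\<in>I. f i x)"
proof (induction I rule: infinite_finite_induct)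
  case (insert i I)
  then show ?case using hom_poly_add[of l "f i" "\<lambda>x. \<Sum>i\<in>I. f i x"] by simp
qed (auto intro: hom_poly_zero)

lemma hom_poly_coord: "hom_poly 1 (\<lambda>x. x $ i)"
  using hom_poly_var[OF hom_poly_const, of i 1] by simp

lemma hom_poly_power:
  assumes "hom_poly l p"
  shows "hom_poly (k * l) (\<lambda>x. p x ^ k)"
proof (induction k)
  case 0
  show ?case using hom_poly_const[of 1] by simp
next
  case (Suc k)
  then show ?case using hom_poly_mult[OF assms Suc] by simp
qed

lemma hom_poly_inner: "hom_poly 1 (\<lambda>x. u \<bullet> x)"
  unfolding inner_vec_def inner_real_def by (intro hom_poly_sum hom_poly_cmult hom_poly_coord)

lemma hom_poly_norm2: "hom_poly 2 (\<lambda>x. (norm x)\<^sup>2)"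
proof -
  have "hom_poly 2 (\<lambda>x. \<Sum>i\<in>UNIV. x $ i * x $ i)"
    using hom_poly_mult[OF hom_poly_coord hom_poly_coord] by (intro hom_poly_sum) (simp add: numeral_2_eq_2)
  then show ?thesis by (simp add: power2_norm_eq_inner inner_vec_def)
qed

lemma finite_exponents: "finite {\<alpha> :: 'n::finite \<Rightarrow> nat. (\<Sum>i\<in>UNIV. \<alpha> i) = l}"
proof (rule finite_subset)
  show "{\<alpha> :: 'n \<Rightarrow> nat. (\<Sum>i\<in>UNIV. \<alpha> i) = l} \<subseteq> PiE UNIV (\<lambda>_. {..l})"
    by (auto simp: PiE_UNIV_domain intro: member_le_sum)
qed (intro finite_PiE, auto)

lemma hom_poly_monomial: "finite I \<Longrightarrow> hom_poly (\<Sum>i\<in>I. \<alpha> i) (\<lambda>x. \<Prod>i\<in>I. x $ i ^ \<alpha> i)"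
proof (induction I rule: finite_induct)
  case empty
  show ?case using hom_poly_const[of 1] by simp
next
  case (insert i I)
  then show ?case using hom_poly_mult[OF hom_poly_power[OF hom_poly_coord, of "\<alpha> i" i]] by fastforce
qed

lemma homogeneous_polynomial_iff_hom_poly: "homogeneous_polynomial l p \<longleftrightarrow> hom_poly l p"
proof
  assume "homogeneous_polynomial l p"
  then obtain c where c: "\<And>x. p x = (\<Sum>\<alpha> | (\<Sum>i\<in>UNIV. \<alpha> i) = l. c \<alpha> * (\<Prod>i\<in>UNIV. x $ i ^ \<alpha> i))"
    by (auto simp: homogeneous_polynomial_def)
  have "hom_poly l (\<lambda>x. \<Sum>\<alpha> | (\<Sum>i\<in>UNIV. \<alpha> i) = l. c \<alpha> * (\<Prod>i\<in>UNIV. x $ i ^ \<alpha> i))"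
  proof (intro hom_poly_sum hom_poly_cmult)
    fix \<alpha> :: "'a \<Rightarrow> nat" assume "\<alpha> \<in> {\<alpha>. (\<Sum>i\<in>UNIV. \<alpha> i) = l}"
    then show "hom_poly l (\<lambda>x. \<Prod>i\<in>UNIV. x $ i ^ \<alpha> i)"
      using hom_poly_monomial[of UNIV \<alpha>] by simp
  qed
  then show "hom_poly l p" using c by presburger
next
  assume "hom_poly l p"
  then show "homogeneous_polynomial l p"
  proof induction
    case (hom_poly_const c)
    have "{\<alpha> :: 'a \<Rightarrow> nat. (\<Sum>i\<in>UNIV. \<alpha> i) = 0} = {\<lambda>_. 0}" by (auto simp: fun_eq_iff)
    then show ?case unfolding homogeneous_polynomial_def by (intro exI[of _ "\<lambda>_. c"]) simp
  next
    case (hom_poly_var l p i)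
    then obtain c where c: "\<And>x. p x = (\<Sum>\<alpha> | (\<Sum>i\<in>UNIV. \<alpha> i) = l. c \<alpha> * (\<Prod>i\<in>UNIV. x $ i ^ \<alpha> i))"
      by (auto simp: homogeneous_polynomial_def)
    \<comment> \<open>Multiplication by \<open>x $ i\<close> raises the i-th exponent by one.
      \<open>c'\<close> transports the coefficients along this shift and is 0 on exponents outside
      its image.\<close>
    define g where "g = (\<lambda>\<alpha> :: 'a \<Rightarrow> nat. \<alpha>(i := Suc (\<alpha> i)))"
    define c' where "c' \<beta> = (if \<beta> i = 0 then 0 else c (\<beta>(i := \<beta> i - 1)))" for \<beta>
    let ?S = "\<lambda>l. {\<alpha> :: 'a \<Rightarrow> nat. (\<Sum>i\<in>UNIV. \<alpha> i) = l}"
    have sum_g: "(\<Sum>j\<in>UNIV. g \<alpha> j) = Suc (\<Sum>j\<in>UNIV. \<alpha> j)" for \<alpha>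
      by (simp add: g_def sum.remove[of UNIV i])
    have inj: "inj_on g A" for A
    proof (rule inj_onI, rule ext)
      fix \<alpha> \<beta> j assume "g \<alpha> = g \<beta>"
      then have "g \<alpha> j = g \<beta> j" by simp
      then show "\<alpha> j = \<beta> j" by (simp add: g_def split: if_splits)
    qed
    have img: "g ` ?S l \<subseteq> ?S (Suc l)" by (auto simp: sum_g)
    have "x $ i * p x = (\<Sum>\<beta>\<in>?S (Suc l). c' \<beta> * (\<Prod>j\<in>UNIV. x $ j ^ \<beta> j))" for x
    proof -
      have "(\<Sum>\<beta>\<in>?S (Suc l). c' \<beta> * (\<Prod>j\<in>UNIV. x $ j ^ \<beta> j)) = (\<Sum>\<beta>\<in>g ` ?S l. c' \<beta> * (\<Prod>j\<in>UNIV. x $ j ^ \<beta> j))"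
      proof (rule sum.mono_neutral_right[OF finite_exponents img], rule ballI)
        fix \<beta> assume \<beta>: "\<beta> \<in> ?S (Suc l) - g ` ?S l"
        have "\<beta> i = 0"
        proof (rule ccontr)
          assume "\<beta> i \<noteq> 0"
          then have e: "\<beta> = g (\<beta>(i := \<beta> i - 1))" by (auto simp: g_def fun_eq_iff)
          with \<beta> sum_g[of "\<beta>(i := \<beta> i - 1)"] have "\<beta>(i := \<beta> i - 1) \<in> ?S l" by auto
          with e \<beta> show False by blast
        qed
        then show "c' \<beta> * (\<Prod>j\<in>UNIV. x $ j ^ \<beta> j) = 0" by (simp add: c'_def)
      qed
      also have "\<dots> = (\<Sum>\<alpha>\<in>?S l. c' (g \<alpha>) * (\<Prod>j\<in>UNIV. x $ j ^ g \<alpha> j))"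
        by (simp add: sum.reindex[OF inj])
      also have "\<dots> = (\<Sum>\<alpha>\<in>?S l. x $ i * (c \<alpha> * (\<Prod>j\<in>UNIV. x $ j ^ \<alpha> j)))"
      proof (rule sum.cong[OF refl])
        fix \<alpha>
        have "c' (g \<alpha>) = c \<alpha>" by (simp add: c'_def g_def)
        moreover have "(\<Prod>j\<in>UNIV. x $ j ^ g \<alpha> j) = x $ i * (\<Prod>j\<in>UNIV. x $ j ^ \<alpha> j)"
          by (simp add: g_def prod.remove[of UNIV i])
        ultimately show "c' (g \<alpha>) * (\<Prod>j\<in>UNIV. x $ j ^ g \<alpha> j) = x $ i * (c \<alpha> * (\<Prod>j\<in>UNIV. x $ j ^ \<alpha> j))" by simp
      qed
      finally show ?thesis by (simp add: c sum_distrib_left)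
    qed
    then show ?case unfolding homogeneous_polynomial_def by blast
  next
    case (hom_poly_add l p q)
    then obtain c c' where "\<And>x. p x = (\<Sum>\<alpha> | (\<Sum>i\<in>UNIV. \<alpha> i) = l. c \<alpha> * (\<Prod>i\<in>UNIV. x $ i ^ \<alpha> i))"
        "\<And>x. q x = (\<Sum>\<alpha> | (\<Sum>i\<in>UNIV. \<alpha> i) = l. c' \<alpha> * (\<Prod>i\<in>UNIV. x $ i ^ \<alpha> i))"
      by (auto simp: homogeneous_polynomial_def)
    then show ?case unfolding homogeneous_polynomial_def
      by (intro exI[of _ "\<lambda>\<alpha>. c \<alpha> + c' \<alpha>"]) (simp add: distrib_right sum.distrib)
  qed
qed

section \<open>Partial derivatives and the Laplacian of polynomials\<close>

definition partial_deriv :: "'n \<Rightarrow> (real^'n \<Rightarrow> real) \<Rightarrow> real^'n \<Rightarrow> real" where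
  "partial_deriv j p x = deriv (\<lambda>t. p (x + t *\<^sub>R axis j 1)) 0"

text \<open>Iterates \<open>partial_deriv\<close> as an operator on functions, so that product rule,
  Euler's identity and commutation can be applied at each order; \<open>laplacian\<close> takes a
  second derivative along each coordinate line.\<close>

definition laplace :: "(real^'n \<Rightarrow> real) \<Rightarrow> real^'n \<Rightarrow> real" where
  "laplace p x = (\<Sum>j\<in>UNIV. partial_deriv j (partial_deriv j p) x)"

lemma laplacian_eq_laplace: "laplacian p = laplace p"
proof
  fix x
  have "deriv (\<lambda>t. p (x + t *\<^sub>R axis i 1)) s = partial_deriv i p (x + s *\<^sub>R axis i 1)" for i s
  proof -
    have "((\<lambda>t. p (x + t *\<^sub>R axis i 1)) has_field_derivative D) (at s)
        \<longleftrightarrow> ((\<lambda>t. p ((x + s *\<^sub>R axis i 1) + t *\<^sub>R axis i 1)) has_field_derivative D) (at 0)" for D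
      using DERIV_shift[of "\<lambda>t. p (x + t *\<^sub>R axis i 1)" D 0 s]
      by (simp add: scaleR_add_left algebra_simps)
    then show ?thesis by (simp add: partial_deriv_def deriv_def)
  qed
  then have "deriv (\<lambda>t. p (x + t *\<^sub>R axis i 1)) = (\<lambda>s. partial_deriv i p (x + s *\<^sub>R axis i 1))" for i by blast
  then show "laplacian p x = laplace p x"
    unfolding laplacian_def laplace_def
    by (simp add: numeral_2_eq_2 partial_deriv_def[of _ "partial_deriv _ p"])
qed

lemma hom_poly_differentiable:
  assumes "hom_poly l p"
  shows "\<exists>D. ((\<lambda>t. p (x + t *\<^sub>R axis j 1)) has_real_derivative D) (at 0)"
  using assms
proof induction
  case (hom_poly_var l p i)
  then obtain D where D: "((\<lambda>t. p (x + t *\<^sub>R axis j 1)) has_real_derivative D) (at 0)" by blast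
  have "((\<lambda>t. (x + t *\<^sub>R axis j 1) $ i) has_real_derivative (axis j 1 $ i)) (at 0)"
    by (auto intro!: derivative_eq_intros)
  from DERIV_mult[OF this D] show ?case by blast
next
  case (hom_poly_add l p q)
  then show ?case using DERIV_add by blast
qed (auto intro: DERIV_const)

lemma hom_poly_has_partial_deriv:
  "hom_poly l p \<Longrightarrow> ((\<lambda>t. p (x + t *\<^sub>R axis j 1)) has_real_derivative partial_deriv j p x) (at 0)"
  unfolding partial_deriv_def by (metis hom_poly_differentiable DERIV_imp_deriv)

lemma partial_deriv_eqI: "((\<lambda>t. p (x + t *\<^sub>R axis j 1)) has_real_derivative D) (at 0) \<Longrightarrow> partial_deriv j p x = D"
  unfolding partial_deriv_def by (rule DERIV_imp_deriv)

lemma partial_deriv_const [simp]: "partial_deriv j (\<lambda>x. c) = (\<lambda>x. 0)"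
  by (rule ext, rule partial_deriv_eqI) simp

lemma partial_deriv_coord [simp]: "partial_deriv j (\<lambda>x. x $ i) = (\<lambda>x. if i = j then 1 else 0)"
  by (rule ext, rule partial_deriv_eqI) (auto intro!: derivative_eq_intros simp: axis_def)

lemma partial_deriv_add: "hom_poly l p \<Longrightarrow> hom_poly m q \<Longrightarrow> partial_deriv j (\<lambda>x. p x + q x) = (\<lambda>x. partial_deriv j p x + partial_deriv j q x)"
  by (rule ext, rule partial_deriv_eqI) (intro DERIV_add hom_poly_has_partial_deriv)

lemma partial_deriv_mult:
  "hom_poly l p \<Longrightarrow> hom_poly m q \<Longrightarrow> partial_deriv j (\<lambda>x. p x * q x) = (\<lambda>x. partial_deriv j p x * q x + p x * partial_deriv j q x)"
  by (rule ext, rule partial_deriv_eqI)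
     (auto intro!: derivative_eq_intros hom_poly_has_partial_deriv simp: algebra_simps)

lemma partial_deriv_cmult: "hom_poly l p \<Longrightarrow> partial_deriv j (\<lambda>x. c * p x) = (\<lambda>x. c * partial_deriv j p x)"
  using partial_deriv_mult[OF hom_poly_const, of l p j c] by simp

lemma partial_deriv_diff: "hom_poly l p \<Longrightarrow> hom_poly m q \<Longrightarrow> partial_deriv j (\<lambda>x. p x - q x) = (\<lambda>x. partial_deriv j p x - partial_deriv j q x)"
  by (rule ext, rule partial_deriv_eqI) (intro DERIV_diff hom_poly_has_partial_deriv)

lemma partial_deriv_sum:
  "finite I \<Longrightarrow> (\<And>i. i \<in> I \<Longrightarrow> hom_poly l (f i)) \<Longrightarrow> partial_deriv j (\<lambda>x. \<Sum>i\<in>I. f i x) = (\<lambda>x. \<Sum>i\<in>I. partial_deriv j (f i) x)"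
  by (rule ext, rule partial_deriv_eqI) (intro DERIV_sum hom_poly_has_partial_deriv, auto)

lemma hom_poly_0_const: "hom_poly 0 p \<Longrightarrow> \<exists>c. p = (\<lambda>x. c)"
proof (induction "0::nat" p rule: hom_poly.induct)
  case (hom_poly_add p q)
  then show ?case by auto
qed auto

lemma partial_deriv_hom_poly_0: "hom_poly 0 p \<Longrightarrow> partial_deriv j p = (\<lambda>x. 0)"
  using hom_poly_0_const partial_deriv_const by blast

lemma partial_deriv_var: "hom_poly l p \<Longrightarrow> partial_deriv j (\<lambda>x. x $ i * p x) = (\<lambda>x. (if i = j then 1 else 0) * p x + x $ i * partial_deriv j p x)"
  using partial_deriv_mult[OF hom_poly_coord, of l p j i] by simp

text \<open>Truncated subtraction is harmless in degree 0: the derivative is the zero function,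
  which is homogeneous of every degree.\<close>

lemma hom_poly_partial_deriv: "hom_poly l p \<Longrightarrow> hom_poly (l - 1) (partial_deriv j p)"
proof (induction rule: hom_poly.induct)
  case (hom_poly_const c)
  show ?case by (simp add: hom_poly_zero)
next
  case (hom_poly_var l p i)
  have "hom_poly l (\<lambda>x. x $ i * partial_deriv j p x)"
  proof (cases l)
    case 0
    then show ?thesis using partial_deriv_hom_poly_0[of p j] hom_poly_var(1) by (simp add: hom_poly_zero)
  next
    case (Suc l')
    then show ?thesis using hom_poly.hom_poly_var[OF hom_poly_var(2), of i] by simp
  qed
  then show ?case
    unfolding partial_deriv_var[OF hom_poly_var(1)] using hom_poly_add[OF hom_poly_cmult[OF hom_poly_var(1)]] by simp
next
  case (hom_poly_add l p q)
  then show ?case by (simp add: partial_deriv_add hom_poly.hom_poly_add)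
qed

lemma hom_poly_laplace: "hom_poly l p \<Longrightarrow> hom_poly (l - 2) (laplace p)"
  unfolding laplace_def using hom_poly_partial_deriv[OF hom_poly_partial_deriv] by (intro hom_poly_sum) (simp add: numeral_2_eq_2)

lemma partial_deriv_commute: "hom_poly l p \<Longrightarrow> partial_deriv i (partial_deriv j p) = partial_deriv j (partial_deriv i p)"
proof (induction rule: hom_poly.induct)
  case (hom_poly_var l p k)
  note h = hom_poly_var(1)
  have eq: "partial_deriv i (partial_deriv j (\<lambda>x. x $ k * p x)) =
      (\<lambda>x. (if k = j then 1 else 0) * partial_deriv i p x + ((if k = i then 1 else 0) * partial_deriv j p x + x $ k * partial_deriv i (partial_deriv j p) x))" for i j
    unfolding partial_deriv_var[OF h]
    by (subst partial_deriv_add[OF hom_poly_cmult[OF h] hom_poly.hom_poly_var[OF hom_poly_partial_deriv[OF h]]])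
       (simp only: partial_deriv_cmult[OF h] partial_deriv_var[OF hom_poly_partial_deriv[OF h]])
  show ?case unfolding eq hom_poly_var.IH by (auto simp: fun_eq_iff)
next
  case (hom_poly_add l p q)
  then show ?case by (simp add: partial_deriv_add[OF hom_poly_add(1,2)] partial_deriv_add[OF hom_poly_partial_deriv hom_poly_partial_deriv])
qed simp

lemma hom_poly_euler: "hom_poly l p \<Longrightarrow> (\<Sum>j\<in>UNIV. x $ j * partial_deriv j p x) = real l * p x"
proof (induction rule: hom_poly.induct)
  case (hom_poly_var l p i)
  have "(\<Sum>j\<in>UNIV. x $ j * partial_deriv j (\<lambda>x. x $ i * p x) x)
      = (\<Sum>j\<in>UNIV. (if i = j then x $ j * p x else 0)) + x $ i * (\<Sum>j\<in>UNIV. x $ j * partial_deriv j p x)"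
    unfolding partial_deriv_var[OF hom_poly_var(1)] sum_distrib_left sum.distrib[symmetric]
    by (intro sum.cong) (auto simp: algebra_simps)
  then show ?case by (simp add: hom_poly_var.IH algebra_simps)
next
  case (hom_poly_add l p q)
  then show ?case by (simp add: partial_deriv_add distrib_left sum.distrib)
qed simp

lemma laplace_mult:
  assumes p: "hom_poly l p" and q: "hom_poly m q"
  shows "laplace (\<lambda>x. p x * q x) x = laplace p x * q x + 2 * (\<Sum>j\<in>UNIV. partial_deriv j p x * partial_deriv j q x) + p x * laplace q x"
proof -
  have "partial_deriv j (partial_deriv j (\<lambda>x. p x * q x)) x = partial_deriv j (partial_deriv j p) x * q x + 2 * (partial_deriv j p x * partial_deriv j q x) + p x * partial_deriv j (partial_deriv j q) x" for j
    unfolding partial_deriv_mult[OF p q]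
    by (subst partial_deriv_add[OF hom_poly_mult[OF hom_poly_partial_deriv[OF p] q] hom_poly_mult[OF p hom_poly_partial_deriv[OF q]]])
       (simp add: partial_deriv_mult[OF hom_poly_partial_deriv[OF p] q] partial_deriv_mult[OF p hom_poly_partial_deriv[OF q]])
  then show ?thesis
    by (simp add: laplace_def sum.distrib sum_distrib_left sum_distrib_right)
qed

lemma laplace_cmult: "hom_poly l p \<Longrightarrow> laplace (\<lambda>x. c * p x) x = c * laplace p x"
  unfolding laplace_def by (simp add: partial_deriv_cmult partial_deriv_cmult[OF hom_poly_partial_deriv] sum_distrib_left)

lemma laplace_diff: "hom_poly l p \<Longrightarrow> hom_poly m q \<Longrightarrow> laplace (\<lambda>x. p x - q x) x = laplace p x - laplace q x"
  unfolding laplace_def by (simp add: partial_deriv_diff partial_deriv_diff[OF hom_poly_partial_deriv hom_poly_partial_deriv] sum_subtractf)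

lemma hom_poly_inner_power: "hom_poly k (\<lambda>x. (u \<bullet> x) ^ k)"
  using hom_poly_power[OF hom_poly_inner, of k u] by simp

lemma partial_deriv_inner_power: "partial_deriv j (\<lambda>x. (u \<bullet> x) ^ k) = (\<lambda>x. real k * u $ j * (u \<bullet> x) ^ (k - 1))"
proof (rule ext, rule partial_deriv_eqI)
  fix x
  show "((\<lambda>t. (u \<bullet> (x + t *\<^sub>R axis j 1)) ^ k) has_real_derivative real k * u $ j * (u \<bullet> x) ^ (k - 1)) (at 0)"
    by (auto intro!: derivative_eq_intros simp: inner_axis inner_add_right)
qed

lemma laplace_inner_power:
  "laplace (\<lambda>x. (u \<bullet> x) ^ k) x = real k * real (k - 1) * (norm u)\<^sup>2 * (u \<bullet> x) ^ (k - 2)"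
proof -
  have "partial_deriv j (partial_deriv j (\<lambda>x. (u \<bullet> x) ^ k)) x = real k * real (k - 1) * (u \<bullet> x) ^ (k - 2) * (u $ j * u $ j)" for j
    unfolding partial_deriv_inner_power partial_deriv_cmult[OF hom_poly_inner_power] by (simp add: partial_deriv_inner_power numeral_2_eq_2)
  then show ?thesis
    by (simp add: laplace_def power2_norm_eq_inner inner_vec_def sum_distrib_left[symmetric])
qed

lemma partial_deriv_norm2: "partial_deriv j (\<lambda>x. (norm x)\<^sup>2) = (\<lambda>x. 2 * x $ j)"
proof (rule ext, rule partial_deriv_eqI)
  fix x :: "real^'a"
  have "(norm (x + t *\<^sub>R axis j 1))\<^sup>2 = (norm x)\<^sup>2 + 2 * t * x $ j + t\<^sup>2" for t
    unfolding power2_norm_eq_inner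
    by (simp add: inner_add_left inner_add_right inner_axis inner_axis' power2_eq_square algebra_simps)
  then show "((\<lambda>t. (norm (x + t *\<^sub>R axis j 1))\<^sup>2) has_real_derivative 2 * x $ j) (at 0)"
    by (auto intro!: derivative_eq_intros)
qed

lemma laplace_norm2: "laplace (\<lambda>x::real^'n. (norm x)\<^sup>2) x = 2 * real CARD('n)"
  unfolding laplace_def partial_deriv_norm2 partial_deriv_cmult[OF hom_poly_coord] by simp

text \<open>The gradient of the squared norm is \<open>2 * x\<close>, so the cross term of the
  product rule is a multiple of Euler's sum; this produces \<open>4 * real m\<close>.\<close>

lemma laplace_norm2_mult:
  fixes q :: "real^'n \<Rightarrow> real"
  assumes q: "hom_poly m q"
  shows "laplace (\<lambda>x. (norm x)\<^sup>2 * q x) x = (2 * real CARD('n) + 4 * real m) * q x + (norm x)\<^sup>2 * laplace q x"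
proof -
  have "(\<Sum>j\<in>UNIV. partial_deriv j (\<lambda>x. (norm x)\<^sup>2) x * partial_deriv j q x) = 2 * (real m * q x)"
    unfolding partial_deriv_norm2 hom_poly_euler[OF q, symmetric] by (simp add: sum_distrib_left mult.assoc)
  then show ?thesis unfolding laplace_mult[OF hom_poly_norm2 q] laplace_norm2 by (simp add: algebra_simps)
qed

lemma laplace_low_degree: "hom_poly l p \<Longrightarrow> l < 2 \<Longrightarrow> laplace p x = 0"
proof -
  assume p: "hom_poly l p" and "l < 2"
  then have "hom_poly 0 (partial_deriv j p)" for j using hom_poly_partial_deriv[OF p, of j] by (cases l) auto
  then show ?thesis by (simp add: laplace_def partial_deriv_hom_poly_0)
qed

text \<open>The ansatz \<open>q = (r - \<bar>x\<bar>\<^sup>2 s) / a\<close> reduces the equation to one of the same shape for s,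
  with a larger constant and in lower degree.\<close>

lemma radial_laplace_solvable:
  fixes r :: "real^'n \<Rightarrow> real"
  assumes "hom_poly n r" "0 < a"
  shows "\<exists>q. hom_poly n q \<and> (\<forall>x. a * q x + (norm x)\<^sup>2 * laplace q x = r x)"
  using assms
proof (induction n arbitrary: a r rule: less_induct)
  case (less n)
  show ?case
  proof (cases "n < 2")
    case True
    have "hom_poly n (\<lambda>x. 1 / a * r x)" by (rule hom_poly_cmult[OF less.prems(1)])
    then show ?thesis
      using laplace_low_degree[of n "\<lambda>x. 1 / a * r x"] True less.prems(2) by (intro exI[of _ "\<lambda>x. 1 / a * r x"]) auto
  next
    case False
    \<comment> \<open>The constant of \<open>laplace_norm2_mult\<close> in degree
      \<open>n - 2\<close>. With \<open>a + b\<close> in the equation for \<open>s\<close>, the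
      ansatz gets Laplacian exactly \<open>s\<close>.\<close>
    define b where "b = 2 * real CARD('n) + 4 * real (n - 2)"
    have "0 < a + b" using less.prems(2) by (simp add: b_def add_pos_nonneg)
    then obtain s where s: "hom_poly (n - 2) s" "\<And>x. (a + b) * s x + (norm x)\<^sup>2 * laplace s x = laplace r x"
      using less.IH[of "n - 2" "laplace r" "a + b"] hom_poly_laplace[OF less.prems(1)] False by auto
    have ns: "hom_poly n (\<lambda>x. (norm x)\<^sup>2 * s x)"
      using hom_poly_mult[OF hom_poly_norm2 s(1)] False by (metis add_diff_inverse_nat)
    define q where "q x = 1 / a * (r x - (norm x)\<^sup>2 * s x)" for x
    have rs: "hom_poly n (\<lambda>x. r x - (norm x)\<^sup>2 * s x)" by (rule hom_poly_diff[OF less.prems(1) ns])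
    have q: "hom_poly n q" unfolding q_def[abs_def] by (rule hom_poly_cmult[OF rs])
    have "laplace q x = s x" for x
    proof -
      have "laplace q x = 1 / a * (laplace r x - (b * s x + (norm x)\<^sup>2 * laplace s x))"
        unfolding q_def[abs_def] laplace_cmult[OF rs] laplace_diff[OF less.prems(1) ns] laplace_norm2_mult[OF s(1)] b_def ..
      also have "laplace r x - (b * s x + (norm x)\<^sup>2 * laplace s x) = a * s x"
        using s(2)[of x] by (simp add: algebra_simps)
      finally show ?thesis using less.prems(2) by simp
    qed
    then have "a * q x + (norm x)\<^sup>2 * laplace q x = r x" for x
      using less.prems(2) by (simp add: q_def)
    with q show ?thesis by blast
  qed
qed

text \<open>\<open>q\<close> is chosen so that the Laplacian of
  \<open>(norm x)\<^sup>2 * q x\<close> equals that of \<open>p\<close>, which is the equation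
  solved above; the difference is then harmonic. On the sphere the radial factor is 1, so the
  remainder has lower degree.\<close>

lemma harmonic_decomposition:
  fixes p :: "real^'n \<Rightarrow> real"
  assumes p: "hom_poly n p"
  obtains h where "hom_poly n h" "\<And>x. laplace h x = 0" "n < 2 \<Longrightarrow> p = h"
    "2 \<le> n \<Longrightarrow> \<exists>q. hom_poly (n - 2) q \<and> (\<forall>x. p x = h x + (norm x)\<^sup>2 * q x)"
proof (cases "n < 2")
  case True
  show thesis using that[of p] p laplace_low_degree[OF p True] True by auto
next
  case False
  let ?a = "2 * real CARD('n) + 4 * real (n - 2)"
  have "0 < ?a" by (simp add: add_pos_nonneg)
  then obtain q where q: "hom_poly (n - 2) q" "\<And>x. ?a * q x + (norm x)\<^sup>2 * laplace q x = laplace p x"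
    using radial_laplace_solvable[OF hom_poly_laplace[OF p]] by blast
  have nq: "hom_poly n (\<lambda>x. (norm x)\<^sup>2 * q x)"
    using hom_poly_mult[OF hom_poly_norm2 q(1)] False by (metis add_diff_inverse_nat)
  show thesis
  proof (rule that[of "\<lambda>x. p x - (norm x)\<^sup>2 * q x"])
    show "hom_poly n (\<lambda>x. p x - (norm x)\<^sup>2 * q x)" by (rule hom_poly_diff[OF p nq])
    show "laplace (\<lambda>x. p x - (norm x)\<^sup>2 * q x) x = 0" for x
      unfolding laplace_diff[OF p nq] laplace_norm2_mult[OF q(1)] using q(2)[of x] by simp
    show "\<exists>q'. hom_poly (n - 2) q' \<and> (\<forall>x. p x = p x - (norm x)\<^sup>2 * q x + (norm x)\<^sup>2 * q' x)"
      using q(1) by auto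
  qed (use False in auto)
qed

definition dir_deriv :: "real^'n \<Rightarrow> (real^'n \<Rightarrow> real) \<Rightarrow> real^'n \<Rightarrow> real" where
  "dir_deriv u p x = (\<Sum>j\<in>UNIV. u $ j * partial_deriv j p x)"

lemma hom_poly_dir_deriv: "hom_poly l p \<Longrightarrow> hom_poly (l - 1) (dir_deriv u p)"
  unfolding dir_deriv_def by (intro hom_poly_sum hom_poly_cmult hom_poly_partial_deriv)

lemma dir_deriv_self: "hom_poly l p \<Longrightarrow> dir_deriv u p u = real l * p u"
  unfolding dir_deriv_def by (rule hom_poly_euler)

text \<open>Partial derivatives commute and the coefficients \<open>u $ j\<close> are constant, so
  the Laplacian passes through to \<open>p\<close>.\<close>

lemma laplace_dir_deriv:
  assumes p: "hom_poly l p" and h: "\<And>x. laplace p x = 0"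
  shows "laplace (dir_deriv u p) x = 0"
proof -
  note h1 = hom_poly_cmult[OF hom_poly_partial_deriv[OF p]] and h2 = hom_poly_cmult[OF hom_poly_partial_deriv[OF hom_poly_partial_deriv[OF p]]]
  have pd1: "partial_deriv i (dir_deriv u p) = (\<lambda>x. \<Sum>j\<in>UNIV. u $ j * partial_deriv i (partial_deriv j p) x)" for i
    unfolding dir_deriv_def partial_deriv_sum[OF finite h1] partial_deriv_cmult[OF hom_poly_partial_deriv[OF p]] ..
  have pd2: "partial_deriv i (partial_deriv i (dir_deriv u p)) = (\<lambda>x. \<Sum>j\<in>UNIV. u $ j * partial_deriv i (partial_deriv i (partial_deriv j p)) x)" for i
    unfolding pd1 partial_deriv_sum[OF finite h2] partial_deriv_cmult[OF hom_poly_partial_deriv[OF hom_poly_partial_deriv[OF p]]] ..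
  have "partial_deriv i (partial_deriv i (partial_deriv j p)) = partial_deriv j (partial_deriv i (partial_deriv i p))" for i j
    using partial_deriv_commute[OF p] partial_deriv_commute[OF hom_poly_partial_deriv[OF p]] by metis
  then have "laplace (dir_deriv u p) x = (\<Sum>j\<in>UNIV. u $ j * (\<Sum>i\<in>UNIV. partial_deriv j (partial_deriv i (partial_deriv i p)) x))"
    unfolding laplace_def pd2 sum_distrib_left by (subst sum.swap) simp
  moreover have "(\<Sum>i\<in>UNIV. partial_deriv j (partial_deriv i (partial_deriv i p)) x) = partial_deriv j (\<lambda>x. laplace p x) x" for j
    using partial_deriv_sum[of UNIV "l - 1 - 1" "\<lambda>i. partial_deriv i (partial_deriv i p)" j] hom_poly_partial_deriv[OF hom_poly_partial_deriv[OF p]]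
    unfolding laplace_def by simp
  ultimately show ?thesis by (simp add: h)
qed

lemma hom_poly_continuous: "hom_poly l p \<Longrightarrow> continuous_on S p"
  by (induction rule: hom_poly.induct) (auto intro!: continuous_intros)

section \<open>The Funk--Hecke formula\<close>

text \<open>The common frame for \<sigma>, surface area measures and both variations of a signed
  measure: continuous functions on the sphere are integrable for all of them.\<close>

definition sphere_measure :: "'a::euclidean_space measure \<Rightarrow> bool" where
  "sphere_measure M \<longleftrightarrow> finite_measure M \<and> sets M = sets borel_sphere"

lemma space_sphere_measure: "sphere_measure M \<Longrightarrow> space M = unit_sphere"
  using sets_eq_imp_space_eq[of M borel_sphere]
  by (simp add: sphere_measure_def borel_sphere_def space_restrict_space)

lemma measurable_sphere:
  fixes f :: "'a::euclidean_space \<Rightarrow> real"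
  assumes M: "sphere_measure M" and f: "continuous_on unit_sphere f"
  shows "f \<in> borel_measurable M"
proof -
  have "f \<in> borel_measurable borel_sphere"
    unfolding borel_sphere_def by (intro borel_measurable_continuous_on_restrict f)
  moreover have "sets M = sets borel_sphere" using M by (simp add: sphere_measure_def)
  ultimately show ?thesis using measurable_cong_sets by blast
qed

lemma continuous_on_sphere_bounded:
  fixes f :: "'a::euclidean_space \<Rightarrow> real"
  assumes "continuous_on unit_sphere f"
  obtains B where "0 < B" "\<And>x. norm x = 1 \<Longrightarrow> \<bar>f x\<bar> \<le> B"
proof -
  have "bounded (f ` unit_sphere)"
    using assms by (intro compact_imp_bounded compact_continuous_image) auto
  then obtain B where "0 < B" "\<forall>y\<in>f ` unit_sphere. norm y \<le> B" by (auto simp: bounded_pos)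
  then show thesis by (intro that[of B]) auto
qed

lemma integrable_sphere:
  fixes f :: "'a::euclidean_space \<Rightarrow> real"
  assumes M: "sphere_measure M" and f: "continuous_on unit_sphere f"
  shows "integrable M f"
proof -
  interpret finite_measure M using M by (simp add: sphere_measure_def)
  obtain B where B: "\<And>x. norm x = 1 \<Longrightarrow> \<bar>f x\<bar> \<le> B"
    using continuous_on_sphere_bounded[OF f] by blast
  show ?thesis
    by (rule integrable_const_bound[of _ B])
       (use measurable_sphere[OF M f] B in \<open>auto simp: space_sphere_measure[OF M]\<close>)
qed

lemma integral_sphere_cong:
  "sphere_measure M \<Longrightarrow> (\<And>x. norm x = 1 \<Longrightarrow> f x = g x) \<Longrightarrow> (\<integral>x. f x \<partial>M) = (\<integral>x. g x \<partial>M)"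
  by (rule Bochner_Integration.integral_cong) (auto simp: space_sphere_measure)

section \<open>Plane rotations and their generators\<close>

text \<open>Rotation by \<theta> in the plane of the coordinates \<open>i\<close> and
  \<open>j\<close>; it has this meaning only for \<open>i \<noteq> j\<close>.\<close>

definition rot :: "'n \<Rightarrow> 'n \<Rightarrow> real \<Rightarrow> real^'n \<Rightarrow> real^'n" where
  "rot i j \<theta> x = (\<chi> k. if k = i then cos \<theta> * x $ i - sin \<theta> * x $ j
     else if k = j then sin \<theta> * x $ i + cos \<theta> * x $ j else x $ k)"

lemma norm_rot:
  fixes x :: "real^'n"
  assumes ij: "i \<noteq> j"
  shows "norm (rot i j \<theta> x) = norm x"
proof -
  have U: "(UNIV :: 'n set) = insert i (insert j (UNIV - {i, j}))" by auto
  have sq: "(\<Sum>k\<in>UNIV. f k) = f i + f j + (\<Sum>k\<in>UNIV - {i, j}. f k)" for f :: "'n \<Rightarrow> real"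
    using ij by (subst U) simp
  have "rot i j \<theta> x \<bullet> rot i j \<theta> x = (cos \<theta> * x $ i - sin \<theta> * x $ j)\<^sup>2 + (sin \<theta> * x $ i + cos \<theta> * x $ j)\<^sup>2
      + (\<Sum>k\<in>UNIV - {i, j}. x $ k * x $ k)"
    unfolding inner_vec_def using ij by (subst sq) (simp add: rot_def power2_eq_square)
  also have "(cos \<theta> * x $ i - sin \<theta> * x $ j)\<^sup>2 + (sin \<theta> * x $ i + cos \<theta> * x $ j)\<^sup>2
      = ((cos \<theta>)\<^sup>2 + (sin \<theta>)\<^sup>2) * (x $ i * x $ i + x $ j * x $ j)"
  proof -
    have "(a * p - b * q)\<^sup>2 + (b * p + a * q)\<^sup>2 = (a\<^sup>2 + b\<^sup>2) * (p * p + q * q)" for a b p q :: real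
      by (simp add: power2_eq_square algebra_simps)
    then show ?thesis .
  qed
  also have "\<dots> + (\<Sum>k\<in>UNIV - {i, j}. x $ k * x $ k) = x \<bullet> x"
    unfolding inner_vec_def by (subst sq) simp
  finally show ?thesis by (simp add: norm_eq)
qed

lemma linear_rot: "linear (rot i j \<theta>)"
  by (rule linearI) (auto simp: rot_def vec_eq_iff algebra_simps)

lemma rot_matrix: "rot i j \<theta> x = matrix (rot i j \<theta>) *v x"
  using fun_cong[OF matrix_vector_mul(2)[OF linear_rot], of i j \<theta> x] by (rule sym)

text \<open>The determinant is 1 because the rotation by \<open>\<theta>\<close> is the square of the rotation by \<open>\<theta> / 2\<close>.\<close>

lemma rotation_matrix_rot:
  assumes ij: "i \<noteq> j"
  shows "rotation_matrix (matrix (rot i j \<theta>))"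
proof -
  have orth: "orthogonal_matrix (matrix (rot i j \<theta>))" for \<theta>
    using norm_rot[OF ij] linear_rot orthogonal_transformation_matrix
    by (metis orthogonal_transformation)
  have "rot i j \<theta> = rot i j (\<theta> / 2) \<circ> rot i j (\<theta> / 2)"
  proof (rule ext)
    fix x
    have cs: "cos \<theta> = cos (\<theta> / 2) * cos (\<theta> / 2) - sin (\<theta> / 2) * sin (\<theta> / 2)"
      "sin \<theta> = sin (\<theta> / 2) * cos (\<theta> / 2) + cos (\<theta> / 2) * sin (\<theta> / 2)"
      using cos_add[of "\<theta> / 2" "\<theta> / 2"] sin_add[of "\<theta> / 2" "\<theta> / 2"] by auto
    then show "rot i j \<theta> x = (rot i j (\<theta> / 2) \<circ> rot i j (\<theta> / 2)) x"
      using ij by (auto simp: rot_def vec_eq_iff cs algebra_simps)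
  qed
  then have "matrix (rot i j \<theta>) = matrix (rot i j (\<theta> / 2)) ** matrix (rot i j (\<theta> / 2))"
    using matrix_compose[OF linear_rot linear_rot] by metis
  then have "det (matrix (rot i j \<theta>)) = det (matrix (rot i j (\<theta> / 2))) * det (matrix (rot i j (\<theta> / 2)))"
    by (simp add: det_mul)
  then have "det (matrix (rot i j \<theta>)) = 1" using det_orthogonal_matrix[OF orth[of "\<theta> / 2"]] by auto
  with orth show ?thesis by (simp add: rotation_matrix_def)
qed

text \<open>The angular derivative, that is, the infinitesimal generator of
  \<open>rot i j\<close>.\<close>

definition rot_deriv :: "'n \<Rightarrow> 'n \<Rightarrow> (real^'n \<Rightarrow> real) \<Rightarrow> real^'n \<Rightarrow> real" where
  "rot_deriv i j p x = x $ i * partial_deriv j p x - x $ j * partial_deriv i p x"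

lemma hom_poly_rot_deriv:
  assumes "hom_poly l p" "i \<noteq> j"
  shows "((\<lambda>\<theta>. p (rot i j \<theta> x)) has_real_derivative rot_deriv i j p (rot i j \<theta> x)) (at \<theta>)"
  using assms(1)
proof induction
  case (hom_poly_const c)
  then show ?case by (simp add: rot_deriv_def)
next
  case (hom_poly_var l p k)
  let ?y = "rot i j \<theta> x"
  let ?D = "?y $ i * (if k = j then 1 else 0) - ?y $ j * (if k = i then 1 else 0)"
  have "((\<lambda>\<theta>. rot i j \<theta> x $ k) has_real_derivative ?D) (at \<theta>)"
  proof -
    consider "k = i" | "k = j" "k \<noteq> i" | "k \<noteq> i" "k \<noteq> j" by blast
    then show ?thesis
      using assms(2) by cases (auto simp: rot_def intro!: derivative_eq_intros)
  qed
  from DERIV_mult[OF this hom_poly_var.IH] show ?case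
    unfolding rot_deriv_def partial_deriv_var[OF hom_poly_var(1)] by (simp add: algebra_simps)
next
  case (hom_poly_add l p q)
  from DERIV_add[OF hom_poly_add.IH] show ?case
    unfolding rot_deriv_def partial_deriv_add[OF hom_poly_add(1,2)] by (simp add: algebra_simps)
qed

lemma continuous_rot_deriv: "hom_poly l p \<Longrightarrow> continuous_on S (rot_deriv i j p)"
  unfolding rot_deriv_def by (intro continuous_intros hom_poly_continuous[OF hom_poly_partial_deriv])

locale spherical_prob =
  fixes \<sigma> :: "(real^'n) measure"
  assumes spherical: "is_spherical_prob \<sigma>" and dim: "2 \<le> CARD('n)"
begin

sublocale prob_space \<sigma>
  using spherical by (simp add: is_spherical_prob_def)

lemma sphere_measure_sigma: "sphere_measure \<sigma>"
  using spherical finite_measure_axioms by (simp add: sphere_measure_def is_spherical_prob_def)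

lemmas integrable_sigma = integrable_sphere[OF sphere_measure_sigma]

lemma matrix_measurable:
  fixes Q :: "real^'n^'n"
  assumes "rotation_matrix Q"
  shows "(\<lambda>x. Q *v x) \<in> measurable \<sigma> \<sigma>"
proof -
  have nQ: "norm (Q *v x) = norm x" for x
    using assms orthogonal_transformation_matrix[of "\<lambda>x. Q *v x"]
    by (simp add: rotation_matrix_def orthogonal_transformation)
  have "(\<lambda>x. Q *v x) \<in> measurable borel_sphere borel_sphere"
    unfolding borel_sphere_def
    by (intro measurable_restrict_space3 borel_measurable_continuous_onI linear_continuous_on
          matrix_vector_mul_bounded_linear) (auto simp: nQ)
  then show ?thesis
    using spherical measurable_cong_sets[of \<sigma> borel_sphere \<sigma> borel_sphere] by (simp add: is_spherical_prob_def)
qed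

lemma integral_rotation:
  fixes f :: "real^'n \<Rightarrow> real"
  assumes Q: "rotation_matrix Q" and f: "f \<in> borel_measurable \<sigma>"
  shows "(\<integral>x. f (Q *v x) \<partial>\<sigma>) = (\<integral>x. f x \<partial>\<sigma>)"
  using integral_distr[OF matrix_measurable[OF Q] f] spherical Q by (simp add: is_spherical_prob_def)

text \<open>By rotation invariance every difference quotient along the rotation has integral 0. The
  quotients converge pointwise to the angular derivative and, by the mean value theorem, are bounded
  by its maximum on the sphere, so the limit has integral 0 too.\<close>

lemma integral_rot_deriv:
  assumes p: "hom_poly l p"
  shows "(\<integral>x. rot_deriv i j p x \<partial>\<sigma>) = 0"
proof (cases "i = j")
  case True
  then show ?thesis by (simp add: rot_deriv_def)
next
  case ij: False
  define s where "s n x = (p (rot i j (inverse (real (Suc n))) x) - p x) * real (Suc n)" for n x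
  obtain B where B: "\<And>x. norm x = 1 \<Longrightarrow> \<bar>rot_deriv i j p x\<bar> \<le> B"
    using continuous_on_sphere_bounded[OF continuous_rot_deriv[OF p]] by blast
  have rot0: "rot i j 0 x = x" for x using ij by (auto simp: rot_def vec_eq_iff)
  have pm: "p \<in> borel_measurable \<sigma>" by (rule measurable_sphere[OF sphere_measure_sigma hom_poly_continuous[OF p]])
  have "continuous_on unit_sphere (\<lambda>x. p (rot i j \<theta> x))" for \<theta>
    using linear_continuous_on[OF linear_rot[unfolded linear_conv_bounded_linear], of _ i j \<theta>]
    by (intro continuous_on_compose2[OF hom_poly_continuous[OF p, of UNIV]]) auto
  then have rm: "integrable \<sigma> (\<lambda>x. p (rot i j \<theta> x))" for \<theta>
    by (rule integrable_sigma)
  have ip: "integrable \<sigma> p" by (rule integrable_sigma[OF hom_poly_continuous[OF p]])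
  have s0: "(\<integral>x. s n x \<partial>\<sigma>) = 0" for n
    using integral_rotation[OF rotation_matrix_rot[OF ij] pm, of "inverse (real (Suc n))"] rm ip
    by (simp add: s_def rot_matrix[symmetric])
  have "(\<lambda>n. \<integral>x. s n x \<partial>\<sigma>) \<longlonglongrightarrow> (\<integral>x. rot_deriv i j p x \<partial>\<sigma>)"
  proof (rule integral_dominated_convergence[where w = "\<lambda>_. B"])
    show "rot_deriv i j p \<in> borel_measurable \<sigma>"
      by (rule measurable_sphere[OF sphere_measure_sigma continuous_rot_deriv[OF p]])
    show "s n \<in> borel_measurable \<sigma>" for n
      unfolding s_def using rm ip by (auto dest: borel_measurable_integrable)
    have lim: "(\<lambda>n. s n x) \<longlonglongrightarrow> rot_deriv i j p x" for x
    proof -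
      have "((\<lambda>h. (p (rot i j (0 + h) x) - p (rot i j 0 x)) / h) \<longlongrightarrow> rot_deriv i j p (rot i j 0 x)) (at 0)"
        using hom_poly_rot_deriv[OF p ij, of x 0] by (simp only: DERIV_def)
      moreover have "filterlim (\<lambda>n. inverse (real (Suc n))) (at 0) sequentially"
        unfolding filterlim_at using LIMSEQ_inverse_real_of_nat by auto
      ultimately have "(\<lambda>n. (p (rot i j (0 + inverse (real (Suc n))) x) - p (rot i j 0 x)) / inverse (real (Suc n)))
          \<longlonglongrightarrow> rot_deriv i j p (rot i j 0 x)"
        by (rule filterlim_compose)
      then show ?thesis by (simp add: rot0 s_def[abs_def] divide_inverse del: of_nat_Suc)
    qed
    then show "AE x in \<sigma>. (\<lambda>n. s n x) \<longlonglongrightarrow> rot_deriv i j p x" by simp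
    have bound: "norm (s n x) \<le> B" if x: "norm x = 1" for n x
    proof -
      let ?h = "inverse (real (Suc n))"
      obtain z where z: "p (rot i j ?h x) - p (rot i j 0 x) = (?h - 0) * rot_deriv i j p (rot i j z x)"
        using MVT2[of 0 ?h "\<lambda>\<theta>. p (rot i j \<theta> x)" "\<lambda>\<theta>. rot_deriv i j p (rot i j \<theta> x)"]
          hom_poly_rot_deriv[OF p ij] by auto
      then have "s n x = rot_deriv i j p (rot i j z x)" by (simp add: s_def rot0 del: of_nat_Suc)
      then show ?thesis using B[of "rot i j z x"] x by (simp add: norm_rot[OF ij])
    qed
    show "AE x in \<sigma>. norm (s n x) \<le> B" for n
      by (rule AE_I2) (use bound in \<open>auto simp: space_sphere_measure[OF sphere_measure_sigma]\<close>)
  qed simp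
  then show ?thesis unfolding s0 by (simp add: LIMSEQ_const_iff)
qed

text \<open>On the sphere the integrand is, up to the multiple of f, the sum over all i, j of the rotational
  derivatives of \<open>x\<^sub>i \<partial>\<^sub>j f\<close>, which have integral 0.\<close>

lemma integral_laplace:
  assumes f: "hom_poly m f"
  shows "(\<integral>x. laplace f x \<partial>\<sigma>) = real m * (real m + real CARD('n) - 2) * (\<integral>x. f x \<partial>\<sigma>)"
proof -
  have hf: "hom_poly (Suc (m - 1)) (\<lambda>x. x $ i * partial_deriv j f x)" for i j
    by (rule hom_poly_var[OF hom_poly_partial_deriv[OF f]])
  have term_eq: "rot_deriv i j (\<lambda>x. x $ i * partial_deriv j f x) x
      = (if i = j then x $ i * partial_deriv i f x else 0) + x $ i * x $ i * partial_deriv j (partial_deriv j f) x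
        - x $ j * partial_deriv j f x - x $ j * (x $ i * partial_deriv i (partial_deriv j f) x)" for i j x
    unfolding rot_deriv_def partial_deriv_var[OF hom_poly_partial_deriv[OF f]] by (simp add: algebra_simps)
  have point: "(\<Sum>i\<in>UNIV. \<Sum>j\<in>UNIV. rot_deriv i j (\<lambda>x. x $ i * partial_deriv j f x) x)
      = laplace f x - real m * (real m + real CARD('n) - 2) * f x" if x: "norm x = 1" for x
  proof -
    \<comment> \<open>The sums come from Euler's identity in degree \<open>m\<close> for
      \<open>f\<close> and in degree \<open>m - 1\<close> for its partial derivatives; with d the
      dimension, m - d m - (m - 1) m = - m (m + d - 2).\<close>
    have nx: "(\<Sum>i\<in>UNIV. x $ i * x $ i) = 1"
      using x by (simp add: norm_eq_1 inner_vec_def)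
    have 1: "(\<Sum>i\<in>UNIV. \<Sum>j\<in>UNIV. (if i = j then x $ i * partial_deriv i f x else 0)) = real m * f x"
      by (simp add: hom_poly_euler[OF f])
    have 2: "(\<Sum>i\<in>UNIV. \<Sum>j\<in>UNIV. x $ i * x $ i * partial_deriv j (partial_deriv j f) x) = laplace f x"
      using nx by (simp add: laplace_def sum_distrib_left[symmetric] sum_distrib_right[symmetric])
    have 3: "(\<Sum>i\<in>(UNIV::'n set). \<Sum>j\<in>UNIV. x $ j * partial_deriv j f x) = real CARD('n) * (real m * f x)"
      by (simp add: hom_poly_euler[OF f])
    have 4: "(\<Sum>i\<in>UNIV. \<Sum>j\<in>UNIV. x $ j * (x $ i * partial_deriv i (partial_deriv j f) x)) = real (m - 1) * (real m * f x)"
    proof -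
      have "(\<Sum>i\<in>UNIV. \<Sum>j\<in>UNIV. x $ j * (x $ i * partial_deriv i (partial_deriv j f) x))
          = (\<Sum>j\<in>UNIV. x $ j * (\<Sum>i\<in>UNIV. x $ i * partial_deriv i (partial_deriv j f) x))"
        by (subst sum.swap) (simp add: sum_distrib_left)
      also have "\<dots> = real (m - 1) * (\<Sum>j\<in>UNIV. x $ j * partial_deriv j f x)"
        unfolding hom_poly_euler[OF hom_poly_partial_deriv[OF f]] by (simp add: sum_distrib_left mult.left_commute)
      finally show ?thesis unfolding hom_poly_euler[OF f] .
    qed
    have m: "real (m - 1) * (real m * y) = (real m - 1) * (real m * y)" for y by (cases m) auto
    show ?thesis
      unfolding term_eq sum.distrib sum_subtractf 1 2 3 4 m by (simp add: algebra_simps)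
  qed
  have int: "integrable \<sigma> (\<lambda>x. rot_deriv i j (\<lambda>x. x $ i * partial_deriv j f x) x)" for i j
    by (rule integrable_sigma[OF continuous_rot_deriv[OF hf]])
  have "(\<integral>x. (\<Sum>i\<in>UNIV. \<Sum>j\<in>UNIV. rot_deriv i j (\<lambda>x. x $ i * partial_deriv j f x) x) \<partial>\<sigma>) = 0"
    by (simp add: int integral_rot_deriv[OF hf])
  moreover have "(\<integral>x. (\<Sum>i\<in>UNIV. \<Sum>j\<in>UNIV. rot_deriv i j (\<lambda>x. x $ i * partial_deriv j f x) x) \<partial>\<sigma>)
      = (\<integral>x. laplace f x - real m * (real m + real CARD('n) - 2) * f x \<partial>\<sigma>)"
    using point by (rule integral_sphere_cong[OF sphere_measure_sigma])
  ultimately show ?thesis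
    using integrable_sigma[OF hom_poly_continuous[OF f]] integrable_sigma[OF hom_poly_continuous[OF hom_poly_laplace[OF f]]]
    by simp
qed

text \<open>Applying \<open>integral_laplace\<close> to \<open>(u \<bullet> v)\<^sup>k Y(v)\<close> gives a recursion in which Y is replaced by
  its derivative in direction u, whose value at u is \<open>l Y(u)\<close> by Euler's identity.\<close>

lemma funk_hecke_power:
  "\<exists>c. \<forall>Y u. hom_poly l Y \<longrightarrow> (\<forall>x. laplace Y x = 0) \<longrightarrow> norm u = 1
     \<longrightarrow> (\<integral>v. (u \<bullet> v) ^ k * Y v \<partial>\<sigma>) = c * Y u"
proof (induction "k + l" arbitrary: k l rule: less_induct)
  case less
  define G where "G = real (k + l) * (real (k + l) + real CARD('n) - 2)"
  have rec: "G * (\<integral>v. (u \<bullet> v) ^ k * Y v \<partial>\<sigma>) = real k * real (k - 1) * (\<integral>v. (u \<bullet> v) ^ (k - 2) * Y v \<partial>\<sigma>)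
        + 2 * real k * (\<integral>v. (u \<bullet> v) ^ (k - 1) * dir_deriv u Y v \<partial>\<sigma>)"
    if Y: "hom_poly l Y" "\<And>x. laplace Y x = 0" and u: "norm u = 1" for Y u
  proof -
    have i: "integrable \<sigma> (\<lambda>v. (u \<bullet> v) ^ (k - 2) * Y v)" "integrable \<sigma> (\<lambda>v. (u \<bullet> v) ^ (k - 1) * dir_deriv u Y v)"
      by (rule integrable_sigma[OF hom_poly_continuous[OF hom_poly_mult[OF hom_poly_inner_power Y(1)]]])
        (rule integrable_sigma[OF hom_poly_continuous[OF hom_poly_mult[OF hom_poly_inner_power hom_poly_dir_deriv[OF Y(1)]]]])
    have laplace_eq: "laplace (\<lambda>v. (u \<bullet> v) ^ k * Y v) v
        = real k * real (k - 1) * ((u \<bullet> v) ^ (k - 2) * Y v) + 2 * real k * ((u \<bullet> v) ^ (k - 1) * dir_deriv u Y v)" for v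
    proof -
      have "(\<Sum>j\<in>UNIV. partial_deriv j (\<lambda>v. (u \<bullet> v) ^ k) v * partial_deriv j Y v) = real k * ((u \<bullet> v) ^ (k - 1) * dir_deriv u Y v)"
        unfolding partial_deriv_inner_power dir_deriv_def sum_distrib_left by (intro sum.cong) auto
      then show ?thesis
        unfolding laplace_mult[OF hom_poly_inner_power Y(1)] laplace_inner_power using Y(2) u by simp
    qed
    have "G * (\<integral>v. (u \<bullet> v) ^ k * Y v \<partial>\<sigma>) = (\<integral>v. laplace (\<lambda>v. (u \<bullet> v) ^ k * Y v) v \<partial>\<sigma>)"
      unfolding G_def integral_laplace[OF hom_poly_mult[OF hom_poly_inner_power Y(1)]] ..
    also have "\<dots> = (\<integral>v. real k * real (k - 1) * ((u \<bullet> v) ^ (k - 2) * Y v)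
        + 2 * real k * ((u \<bullet> v) ^ (k - 1) * dir_deriv u Y v) \<partial>\<sigma>)"
      unfolding laplace_eq ..
    finally show ?thesis using i by simp
  qed
  show ?case
  proof (cases "k + l = 0")
    case True
    \<comment> \<open>Here \<open>G\<close> is 0 and the recursion gives no information, but the
      integrand is constant and \<sigma> has mass 1.\<close>
    have "(\<integral>v. (u \<bullet> v) ^ k * Y v \<partial>\<sigma>) = 1 * Y u" if hY: "hom_poly l Y" for Y and u :: "real^'n"
    proof -
      obtain c where "Y = (\<lambda>_. c)" using hom_poly_0_const[of Y] hY True by auto
      then show ?thesis using True by (simp add: prob_space)
    qed
    then show ?thesis by blast
  next
    case False
    have G: "0 < G" unfolding G_def using False dim by (intro mult_pos_pos) auto
    \<comment> \<open>The guards \<open>2 \<le> k\<close> here and \<open>1 \<le> k\<close> for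
      \<open>c2\<close> mark where the induction hypothesis is used; for smaller \<open>k\<close>
      the coefficient \<open>k (k - 1)\<close> or \<open>k\<close> of the term vanishes.\<close>
    obtain c1 where c1: "2 \<le> k \<Longrightarrow> hom_poly l Y \<Longrightarrow> (\<And>x. laplace Y x = 0) \<Longrightarrow> norm u = 1
        \<Longrightarrow> (\<integral>v. (u \<bullet> v) ^ (k - 2) * Y v \<partial>\<sigma>) = c1 * Y u" for Y u
    proof (cases "2 \<le> k")
      case True
      then show thesis using less[of "k - 2" l] that by auto
    qed (use that in auto)
    obtain c2 where c2: "1 \<le> k \<Longrightarrow> hom_poly l Y \<Longrightarrow> (\<And>x. laplace Y x = 0) \<Longrightarrow> norm u = 1
        \<Longrightarrow> (\<integral>v. (u \<bullet> v) ^ (k - 1) * dir_deriv u Y v \<partial>\<sigma>) = c2 * Y u" for Y u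
    proof (cases "1 \<le> k \<and> 1 \<le> l")
      case True
      then obtain c where c: "\<And>Y u. hom_poly (l - 1) Y \<Longrightarrow> (\<And>x. laplace Y x = 0) \<Longrightarrow> norm u = 1
          \<Longrightarrow> (\<integral>v. (u \<bullet> v) ^ (k - 1) * Y v \<partial>\<sigma>) = c * Y u"
        using less[of "k - 1" "l - 1"] by auto
      show thesis
      proof (rule that[of "c * real l"])
        fix Y :: "real^'n \<Rightarrow> real" and u :: "real^'n" assume Y: "hom_poly l Y" "\<And>x. laplace Y x = 0" and u: "norm u = 1"
        show "(\<integral>v. (u \<bullet> v) ^ (k - 1) * dir_deriv u Y v \<partial>\<sigma>) = c * real l * Y u"
          using c[OF hom_poly_dir_deriv[OF Y(1)] laplace_dir_deriv[OF Y] u] dir_deriv_self[OF Y(1), of u] by simp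
      qed
    next
      case False
      have "dir_deriv u Y = (\<lambda>_. 0)" if "1 \<le> k" "hom_poly l Y" for Y and u :: "real^'n"
      proof -
        have "l = 0" using False that(1) by simp
        then show ?thesis using that(2) by (simp add: dir_deriv_def[abs_def] partial_deriv_hom_poly_0)
      qed
      then show thesis by (intro that[of 0]) auto
    qed
    have "(\<integral>v. (u \<bullet> v) ^ k * Y v \<partial>\<sigma>) = (real k * real (k - 1) * c1 + 2 * real k * c2) / G * Y u"
      if Y: "hom_poly l Y" "\<And>x. laplace Y x = 0" and u: "norm u = 1" for Y u
    proof -
      have m1: "real k * real (k - 1) * (\<integral>v. (u \<bullet> v) ^ (k - 2) * Y v \<partial>\<sigma>) = real k * real (k - 1) * (c1 * Y u)"
        using c1[OF _ Y u] by (cases "2 \<le> k") (auto simp: not_le less_Suc_eq numeral_2_eq_2)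
      have m2: "2 * real k * (\<integral>v. (u \<bullet> v) ^ (k - 1) * dir_deriv u Y v \<partial>\<sigma>) = 2 * real k * (c2 * Y u)"
        using c2[OF _ Y u] by (cases "1 \<le> k") (auto simp: not_le)
      have "G * (\<integral>v. (u \<bullet> v) ^ k * Y v \<partial>\<sigma>) = (real k * real (k - 1) * c1 + 2 * real k * c2) * Y u"
        unfolding rec[OF Y u] m1 m2 by (simp add: algebra_simps)
      then show ?thesis using G by (simp add: field_simps)
    qed
    then show ?thesis by blast
  qed
qed

end

section \<open>Integrals of continuous kernels on the sphere\<close>

lemma inner_unit_range: "norm u = 1 \<Longrightarrow> norm v = 1 \<Longrightarrow> u \<bullet> v \<in> {-1..1}"
  using Cauchy_Schwarz_ineq2[of u v] by auto

lemma continuous_on_zonal: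
  assumes \<psi>: "continuous_on {-1..1} \<psi>"
  shows "continuous_on (unit_sphere \<times> unit_sphere) (\<lambda>(u, v). \<psi> (u \<bullet> v))"
  unfolding split_beta
  by (rule continuous_on_compose2[OF \<psi>]) (auto intro!: continuous_intros inner_unit_range simp del: atLeastAtMost_iff)

lemma continuous_on_zonal_right:
  assumes \<psi>: "continuous_on {-1..1} \<psi>" and u: "norm u = 1"
  shows "continuous_on unit_sphere (\<lambda>v. \<psi> (u \<bullet> v))"
  by (rule continuous_on_compose2[OF \<psi>]) (use inner_unit_range[OF u] in \<open>auto intro!: continuous_intros\<close>)

lemma kernel_bounded:
  fixes k :: "'a::euclidean_space \<Rightarrow> 'a \<Rightarrow> real"
  assumes "continuous_on (unit_sphere \<times> unit_sphere) (case_prod k)"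
  obtains B where "\<And>u v. norm u = 1 \<Longrightarrow> norm v = 1 \<Longrightarrow> \<bar>k u v\<bar> \<le> B"
proof -
  have "bounded (case_prod k ` (unit_sphere \<times> unit_sphere))"
    using assms by (intro compact_imp_bounded compact_continuous_image compact_Times) auto
  then obtain B where "\<forall>y\<in>case_prod k ` (unit_sphere \<times> unit_sphere). norm y \<le> B" by (auto simp: bounded_iff)
  then show thesis by (intro that[of B]) force
qed

lemma kernel_section:
  assumes "continuous_on (unit_sphere \<times> unit_sphere) (case_prod k)"
  shows "norm v = 1 \<Longrightarrow> continuous_on unit_sphere (\<lambda>u. k u v)"
    and "norm u = 1 \<Longrightarrow> continuous_on unit_sphere (\<lambda>v. k u v)"
  by (rule continuous_on_compose2[OF assms, where f="\<lambda>u. (u, v)", simplified];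
      auto intro!: continuous_intros)
     (rule continuous_on_compose2[OF assms, where f="\<lambda>v. (u, v)", simplified];
      auto intro!: continuous_intros)

text \<open>Continuity on the product of the spheres gives joint measurability once pairs are mapped
  into the Borel space restricted to that product; compactness gives a bound, hence
  integrability.\<close>

lemma sphere_fubini:
  fixes k :: "'a::euclidean_space \<Rightarrow> 'a \<Rightarrow> real"
  assumes M: "sphere_measure M" and N: "sphere_measure N"
    and k: "continuous_on (unit_sphere \<times> unit_sphere) (case_prod k)"
  shows "(\<integral>v. (\<integral>u. k u v \<partial>M) \<partial>N) = (\<integral>u. (\<integral>v. k u v \<partial>N) \<partial>M)"
proof -
  interpret M: finite_measure M using M by (simp add: sphere_measure_def)
  interpret N: finite_measure N using N by (simp add: sphere_measure_def)
  interpret MN: pair_sigma_finite M N by unfold_locales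
  interpret P: finite_measure "M \<Otimes>\<^sub>M N"
    by (rule finite_measure_pair_measure) unfold_locales
  have sp: "space (M \<Otimes>\<^sub>M N) = unit_sphere \<times> unit_sphere"
    by (simp add: space_pair_measure space_sphere_measure[OF M] space_sphere_measure[OF N])
  have id: "(\<lambda>x. x) \<in> borel_measurable L" if "sphere_measure L" for L :: "'a measure"
  proof -
    have "(\<lambda>x. x) \<in> borel_measurable (borel_sphere :: 'a measure)"
      unfolding borel_sphere_def by (intro measurable_restrict_space1) simp
    then show ?thesis using that measurable_cong_sets[of L borel_sphere] by (auto simp: sphere_measure_def)
  qed
  have "(\<lambda>p. (fst p, snd p)) \<in> measurable (M \<Otimes>\<^sub>M N) (borel \<Otimes>\<^sub>M borel)"
    using measurable_compose[OF measurable_fst id[OF M]] measurable_compose[OF measurable_snd id[OF N]]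
    by (intro measurable_Pair)
  then have "(\<lambda>p. p) \<in> borel_measurable (M \<Otimes>\<^sub>M N)" by (simp add: borel_prod)
  then have "(\<lambda>p. p) \<in> measurable (M \<Otimes>\<^sub>M N) (restrict_space borel (unit_sphere \<times> unit_sphere))"
    by (intro measurable_restrict_space2) (auto simp: sp)
  from measurable_compose[OF this borel_measurable_continuous_on_restrict[OF k]]
  have km: "case_prod k \<in> borel_measurable (M \<Otimes>\<^sub>M N)" by simp
  obtain B where B: "\<And>u v. norm u = 1 \<Longrightarrow> norm v = 1 \<Longrightarrow> \<bar>k u v\<bar> \<le> B"
    using kernel_bounded[OF k] by blast
  have "integrable (M \<Otimes>\<^sub>M N) (case_prod k)"
    by (rule P.integrable_const_bound[of _ B]) (use km B in \<open>auto simp: sp\<close>)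
  then show ?thesis by (rule MN.Fubini_integral)
qed

lemma continuous_on_sphere_integral:
  fixes k :: "'a::euclidean_space \<Rightarrow> 'a \<Rightarrow> real"
  assumes M: "sphere_measure M" and k: "continuous_on (unit_sphere \<times> unit_sphere) (case_prod k)"
  shows "continuous_on unit_sphere (\<lambda>v. \<integral>u. k u v \<partial>M)"
proof (rule continuous_on_sequentiallyI)
  fix w :: "nat \<Rightarrow> 'a" and a assume w: "\<forall>n. w n \<in> unit_sphere" "a \<in> unit_sphere" "w \<longlonglongrightarrow> a"
  interpret finite_measure M using M by (simp add: sphere_measure_def)
  obtain B where B: "\<And>u v. norm u = 1 \<Longrightarrow> norm v = 1 \<Longrightarrow> \<bar>k u v\<bar> \<le> B"
    using kernel_bounded[OF k] by blast
  show "(\<lambda>n. \<integral>u. k u (w n) \<partial>M) \<longlonglongrightarrow> (\<integral>u. k u a \<partial>M)"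
  proof (rule integral_dominated_convergence[where w = "\<lambda>_. B"])
    show "(\<lambda>u. k u a) \<in> borel_measurable M" "(\<lambda>u. k u (w n)) \<in> borel_measurable M" for n
      using w by (auto intro!: measurable_sphere[OF M] kernel_section[OF k])
    have "(\<lambda>n. k u (w n)) \<longlonglongrightarrow> k u a" if "norm u = 1" for u
      using continuous_on_tendsto_compose[OF kernel_section(2)[OF k that] w(3)] w by auto
    then show "AE u in M. (\<lambda>n. k u (w n)) \<longlonglongrightarrow> k u a"
      by (intro AE_I2) (auto simp: space_sphere_measure[OF M])
    show "AE u in M. norm (k u (w n)) \<le> B" for n
      using w B by (intro AE_I2) (auto simp: space_sphere_measure[OF M])
  qed simp
qed

section \<open>The Funk-Hecke formula for continuous kernels\<close>

context spherical_prob
begin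

lemma abs_integral_sigma_le:
  fixes f :: "real^'n \<Rightarrow> real"
  assumes f: "continuous_on unit_sphere f" and B: "\<And>x. norm x = 1 \<Longrightarrow> \<bar>f x\<bar> \<le> B"
  shows "\<bar>\<integral>x. f x \<partial>\<sigma>\<bar> \<le> B"
proof -
  have "\<bar>\<integral>x. f x \<partial>\<sigma>\<bar> \<le> (\<integral>x. \<bar>f x\<bar> \<partial>\<sigma>)" by (rule integral_abs_bound)
  also have "\<dots> \<le> (\<integral>x. B \<partial>\<sigma>)"
    using B by (intro integral_mono integrable_abs integrable_sigma f)
      (auto simp: space_sphere_measure[OF sphere_measure_sigma])
  finally show ?thesis by (simp add: prob_space)
qed

text \<open>\<psi> is replaced by a polynomial within \<open>e\<close>, whose multiplier is the
  corresponding combination of multipliers of powers. The constant is chosen before \<open>Y\<close>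
  and \<open>u\<close>, which allows different harmonics and points to be compared.\<close>

lemma funk_hecke_approx:
  assumes \<psi>: "continuous_on {-1..1} \<psi>" and e: "0 < e"
  shows "\<exists>c. \<forall>Y u B. hom_poly l Y \<longrightarrow> (\<forall>x. laplace Y x = 0) \<longrightarrow> norm u = 1 \<longrightarrow> (\<forall>v. norm v = 1 \<longrightarrow> \<bar>Y v\<bar> \<le> B)
      \<longrightarrow> \<bar>(\<integral>v. \<psi> (u \<bullet> v) * Y v \<partial>\<sigma>) - c * Y u\<bar> \<le> e * B"
proof -
  obtain g where g: "real_polynomial_function g" "\<And>t. t \<in> {-1..1} \<Longrightarrow> \<bar>\<psi> t - g t\<bar> < e"
    using Stone_Weierstrass_real_polynomial_function[OF _ \<psi> e] by auto
  obtain a n where an: "g = (\<lambda>t. \<Sum>k\<le>n. a k * t ^ k)"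
    using g(1) by (auto simp: real_polynomial_function_iff_sum)
  obtain c where c: "\<And>k Y u. hom_poly l Y \<Longrightarrow> (\<forall>x. laplace Y x = 0) \<Longrightarrow> norm u = 1
      \<Longrightarrow> (\<integral>v. (u \<bullet> v) ^ k * Y v \<partial>\<sigma>) = c k * Y u"
    using funk_hecke_power[of l] by metis
  have "\<bar>(\<integral>v. \<psi> (u \<bullet> v) * Y v \<partial>\<sigma>) - (\<Sum>k\<le>n. a k * c k) * Y u\<bar> \<le> e * B"
    if Y: "hom_poly l Y" "\<forall>x. laplace Y x = 0" and u: "norm u = 1" and B: "\<And>v. norm v = 1 \<Longrightarrow> \<bar>Y v\<bar> \<le> B" for Y u B
  proof -
    have cY: "continuous_on unit_sphere Y" by (rule hom_poly_continuous[OF Y(1)])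
    have ik: "integrable \<sigma> (\<lambda>v. (u \<bullet> v) ^ k * Y v)" for k
      by (intro integrable_sigma continuous_intros cY)
    have "(\<integral>v. g (u \<bullet> v) * Y v \<partial>\<sigma>) = (\<integral>v. (\<Sum>k\<le>n. a k * ((u \<bullet> v) ^ k * Y v)) \<partial>\<sigma>)"
      unfolding an by (simp add: sum_distrib_right mult.assoc)
    also have "\<dots> = (\<Sum>k\<le>n. a k * (c k * Y u))"
      using ik by (simp add: c[OF Y u])
    finally have gY: "(\<integral>v. g (u \<bullet> v) * Y v \<partial>\<sigma>) = (\<Sum>k\<le>n. a k * c k) * Y u"
      by (simp add: sum_distrib_right mult.assoc)
    have cg: "continuous_on unit_sphere (\<lambda>v. g (u \<bullet> v))"
      unfolding an by (intro continuous_intros)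
    have c\<psi>: "continuous_on unit_sphere (\<lambda>v. \<psi> (u \<bullet> v))"
      by (rule continuous_on_zonal_right[OF \<psi> u])
    have "(\<integral>v. \<psi> (u \<bullet> v) * Y v \<partial>\<sigma>) - (\<integral>v. g (u \<bullet> v) * Y v \<partial>\<sigma>) = (\<integral>v. (\<psi> (u \<bullet> v) - g (u \<bullet> v)) * Y v \<partial>\<sigma>)"
      unfolding left_diff_distrib
      by (rule Bochner_Integration.integral_diff[symmetric]) (intro integrable_sigma continuous_intros cY c\<psi> cg)+
    also have "\<bar>\<dots>\<bar> \<le> e * B"
    proof (rule abs_integral_sigma_le)
      show "continuous_on unit_sphere (\<lambda>v. (\<psi> (u \<bullet> v) - g (u \<bullet> v)) * Y v)"
        by (intro continuous_intros cY c\<psi> cg)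
      fix v :: "real^'n" assume v: "norm v = 1"
      show "\<bar>(\<psi> (u \<bullet> v) - g (u \<bullet> v)) * Y v\<bar> \<le> e * B"
        unfolding abs_mult using g(2)[OF inner_unit_range[OF u v]] B[OF v] e by (intro mult_mono) auto
    qed
    finally show ?thesis by (simp add: gY)
  qed
  then show ?thesis by blast
qed

text \<open>The cross-multiplied form says that the ratio of integral to value is the same for all
  harmonics and points, and remains meaningful where a value is 0. Both integrals are compared with
  the same approximate multiplier, so its possible dependence on the error does no harm.\<close>

lemma funk_hecke:
  assumes \<psi>: "continuous_on {-1..1} \<psi>"
    and Y: "hom_poly l Y" "\<forall>x. laplace Y x = 0" and u: "norm u = 1"
    and Z: "hom_poly l Z" "\<forall>x. laplace Z x = 0" and w: "norm w = 1"
  shows "(\<integral>v. \<psi> (u \<bullet> v) * Y v \<partial>\<sigma>) * Z w = (\<integral>v. \<psi> (w \<bullet> v) * Z v \<partial>\<sigma>) * Y u"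
proof -
  obtain B where B: "0 < B" "\<And>v. norm v = 1 \<Longrightarrow> \<bar>Y v\<bar> \<le> B"
    using continuous_on_sphere_bounded[OF hom_poly_continuous[OF Y(1)]] by blast
  obtain C where C: "0 < C" "\<And>v. norm v = 1 \<Longrightarrow> \<bar>Z v\<bar> \<le> C"
    using continuous_on_sphere_bounded[OF hom_poly_continuous[OF Z(1)]] by blast
  let ?I = "\<integral>v. \<psi> (u \<bullet> v) * Y v \<partial>\<sigma>" and ?J = "\<integral>v. \<psi> (w \<bullet> v) * Z v \<partial>\<sigma>"
  have "\<bar>?I * Z w - ?J * Y u\<bar> \<le> 0 + e" if e: "0 < e" for e
  proof -
    \<comment> \<open>Two error terms arise, each at most \<open>d * B * C\<close>.\<close>
    define d where "d = e / (2 * B * C)"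
    have d: "0 < d" using e B C by (simp add: d_def)
    obtain c where c: "\<bar>?I - c * Y u\<bar> \<le> d * B" "\<bar>?J - c * Z w\<bar> \<le> d * C"
      using funk_hecke_approx[OF \<psi> d, of l] Y Z u w B(2) C(2) by blast
    have "?I * Z w - ?J * Y u = (?I - c * Y u) * Z w - (?J - c * Z w) * Y u" by (simp add: algebra_simps)
    also have "\<bar>\<dots>\<bar> \<le> \<bar>(?I - c * Y u) * Z w\<bar> + \<bar>(?J - c * Z w) * Y u\<bar>" by (rule abs_triangle_ineq4)
    also have "\<dots> \<le> (d * B) * C + (d * C) * B"
      unfolding abs_mult using c B(1) C(1) B(2)[OF u] C(2)[OF w] d by (intro add_mono mult_mono) auto
    also have "\<dots> = e" using B C by (simp add: d_def)
    finally show ?thesis by simp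
  qed
  then have "\<bar>?I * Z w - ?J * Y u\<bar> \<le> 0" by (rule field_le_epsilon)
  then show ?thesis by simp
qed

lemma spherical_harmonics_iff:
  "Y \<in> spherical_harmonics l \<longleftrightarrow> (\<exists>p. Y = restrict p unit_sphere \<and> hom_poly l p \<and> (\<forall>x. laplace p x = 0))"
  by (simp add: spherical_harmonics_def homogeneous_polynomial_iff_hom_poly laplacian_eq_laplace)

text \<open>\<open>THE\<close> needs a unique constant, and uniqueness holds once some harmonic of
  degree \<open>l\<close> is nonzero at some point of the sphere. Otherwise both sides are 0,
  whatever value \<open>multiplier\<close> has.\<close>

lemma multiplier_eq:
  fixes p :: "real^'n \<Rightarrow> real"
  assumes \<psi>: "continuous_on {-1..1} \<psi>" and Y: "hom_poly l p" "\<forall>x. laplace p x = 0" and u: "norm u = 1"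
  shows "(\<integral>v. \<psi> (u \<bullet> v) * p v \<partial>\<sigma>) = multiplier \<sigma> \<psi> l * p u"
proof (cases "\<exists>(q :: real^'n \<Rightarrow> real) w. hom_poly l q \<and> (\<forall>x. laplace q x = 0) \<and> norm w = 1 \<and> q w \<noteq> 0")
  case False
  then have "p v = 0" if "norm v = 1" for v using Y that by metis
  then have z: "\<psi> (u \<bullet> v) * p v = 0" "p v = 0" if "norm v = 1" for v using that by auto
  have "(\<integral>v. \<psi> (u \<bullet> v) * p v \<partial>\<sigma>) = (\<integral>v. 0 \<partial>\<sigma>)"
    using z(1) by (rule integral_sphere_cong[OF sphere_measure_sigma])
  then show ?thesis using z(2)[OF u] by simp
next
  case True
  then obtain q :: "real^'n \<Rightarrow> real" and w where q: "hom_poly l q" "\<forall>x. laplace q x = 0" and w: "norm w = 1" "q w \<noteq> 0" by blast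
  define c where "c = (\<integral>v. \<psi> (w \<bullet> v) * q v \<partial>\<sigma>) / q w"
  have restr: "(\<integral>v. \<psi> (u \<bullet> v) * restrict p unit_sphere v \<partial>\<sigma>) = (\<integral>v. \<psi> (u \<bullet> v) * p v \<partial>\<sigma>)" for u p
    by (rule integral_sphere_cong[OF sphere_measure_sigma]) simp
  have c: "(\<integral>v. \<psi> (u \<bullet> v) * p v \<partial>\<sigma>) = c * p u"
    if "hom_poly l p" "\<forall>x. laplace p x = 0" "norm u = 1" for p u
    using funk_hecke[OF \<psi> that q w(1)] w(2) by (simp add: c_def field_simps)
  have "multiplier \<sigma> \<psi> l = c"
    unfolding multiplier_def
  proof (rule the_equality)
    show "\<forall>Y\<in>spherical_harmonics l. \<forall>u\<in>unit_sphere. (\<integral>v. \<psi> (u \<bullet> v) * Y v \<partial>\<sigma>) = c * Y u"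
    proof (intro ballI)
      fix Y :: "real^'n \<Rightarrow> real" and u :: "real^'n" assume "Y \<in> spherical_harmonics l" and u: "u \<in> unit_sphere"
      then obtain p where p: "Y = restrict p unit_sphere" "hom_poly l p" "\<forall>x. laplace p x = 0"
        unfolding spherical_harmonics_iff by blast
      show "(\<integral>v. \<psi> (u \<bullet> v) * Y v \<partial>\<sigma>) = c * Y u"
        unfolding p(1) restr using c[OF p(2,3)] u by simp
    qed
    fix c' assume "\<forall>Y\<in>spherical_harmonics l. \<forall>u\<in>unit_sphere. (\<integral>v. \<psi> (u \<bullet> v) * Y v \<partial>\<sigma>) = c' * Y u"
    moreover have "restrict q unit_sphere \<in> spherical_harmonics l"
      using q by (auto simp: spherical_harmonics_iff)
    moreover have "w \<in> unit_sphere" using w by simp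
    ultimately have "(\<integral>v. \<psi> (w \<bullet> v) * restrict q unit_sphere v \<partial>\<sigma>) = c' * restrict q unit_sphere w" by blast
    then have "c * q w = c' * q w" using c[OF q w(1)] w unfolding restr by simp
    then show "c' = c" using w by simp
  qed
  with c[OF Y u] show ?thesis by simp
qed

lemma multiplier_0:
  assumes \<psi>: "continuous_on {-1..1} \<psi>" and u: "norm u = 1"
  shows "(\<integral>v. \<psi> (u \<bullet> v) \<partial>\<sigma>) = multiplier \<sigma> \<psi> 0"
  using multiplier_eq[OF \<psi> hom_poly_const _ u, of 1] by (simp add: laplace_def)

section \<open>Completeness of the spherical harmonics\<close>

text \<open>In \<open>integral_laplace\<close> the left side vanishes while the factor in front of
  the integral is positive.\<close>

lemma integral_harmonic_zero:
  fixes p :: "real^'n \<Rightarrow> real"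
  assumes "hom_poly l p" "\<forall>x. laplace p x = 0" "1 \<le> l"
  shows "(\<integral>x. p x \<partial>\<sigma>) = 0"
proof -
  have "0 < real l * (real l + real CARD('n) - 2)" using assms(3) dim by (intro mult_pos_pos) auto
  then show ?thesis using integral_laplace[OF assms(1)] assms(2) by (auto simp: zero_less_mult_iff)
qed

text \<open>Full support of \<sigma> is extracted from invariance. If \<open>f v > 0\<close>, then
  by compactness finitely many rotated copies of \<open>f\<close> have a strictly positive sum on
  the sphere; its integral is at least its minimum, yet each copy integrates to 0.\<close>

lemma nonneg_integral_zero_imp_zero:
  fixes f :: "real^'n \<Rightarrow> real"
  assumes f: "continuous_on unit_sphere f" and f0: "\<And>x. norm x = 1 \<Longrightarrow> 0 \<le> f x"
    and int: "(\<integral>x. f x \<partial>\<sigma>) = 0" and v: "norm v = 1"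
  shows "f v = 0"
proof (rule ccontr)
  assume "f v \<noteq> 0"
  with f0[OF v] have fv: "0 < f v" by simp
  obtain r where r: "0 < r" "\<And>x. norm x = 1 \<Longrightarrow> dist x v < r \<Longrightarrow> dist (f x) (f v) < f v"
    using f v fv unfolding continuous_on_iff by (metis mem_sphere_0)
  have near: "0 < f x" if "norm x = 1" "dist x v < r" for x
    using r(2)[OF that] by (simp add: dist_real_def abs_if split: if_splits)
  have "\<exists>Q. rotation_matrix Q \<and> Q *v w = v" if w: "norm w = 1" for w
  proof -
    obtain g where g: "orthogonal_transformation g" "det (matrix g) = 1" "g w = v"
      using rotation_exists_1[OF dim w v] by blast
    then have "matrix g *v w = v"
      using orthogonal_transformation_linear by (metis matrix_vector_mul(2))
    moreover have "rotation_matrix (matrix g)"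
      using g orthogonal_transformation_matrix by (auto simp: rotation_matrix_def)
    ultimately show ?thesis by blast
  qed
  then obtain Q where Q: "\<And>w. norm w = 1 \<Longrightarrow> rotation_matrix (Q w)" "\<And>w. norm w = 1 \<Longrightarrow> Q w *v w = v"
    by metis
  have nQ: "norm (Q w *v x) = norm x" if "norm w = 1" for w x
    using Q(1)[OF that] orthogonal_transformation_matrix[of "\<lambda>x. Q w *v x"]
    by (simp add: rotation_matrix_def orthogonal_transformation)
  obtain W where W: "W \<subseteq> unit_sphere" "finite W" "unit_sphere \<subseteq> (\<Union>w\<in>W. ball (w :: real^'n) r)"
  proof -
    have cov: "unit_sphere \<subseteq> (\<Union>w\<in>unit_sphere. ball (w :: real^'n) r)" using r(1) by force
    have op: "open (ball w r)" if "w \<in> unit_sphere" for w :: "real^'n" by simp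
    obtain W where "W \<subseteq> unit_sphere" "finite W" "unit_sphere \<subseteq> (\<Union>w\<in>W. ball (w :: real^'n) r)"
      by (rule compactE_image[OF compact_sphere op cov])
    then show thesis by (rule that)
  qed
  define F where "F x = (\<Sum>w\<in>W. f (Q w *v x))" for x
  have cQ: "continuous_on unit_sphere (\<lambda>x. f (Q w *v x))" if "w \<in> W" for w
    using W(1) that nQ
    by (intro continuous_on_compose2[OF f] linear_continuous_on matrix_vector_mul_bounded_linear) force+
  have cF: "continuous_on unit_sphere F"
    unfolding F_def by (intro continuous_on_sum cQ)
  have pos: "0 < F x" if x: "norm x = 1" for x
  proof -
    obtain w where w: "w \<in> W" "dist w x < r" using W(3) x by force
    have nw: "norm w = 1" using w W(1) by auto
    have "dist (Q w *v x) v = norm (Q w *v (x - w))"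
      using Q(2)[OF nw] by (simp add: dist_norm matrix_vector_mult_diff_distrib)
    also have "\<dots> < r" using nQ[OF nw] w(2) by (simp add: dist_norm norm_minus_commute)
    finally have "0 < f (Q w *v x)" using near nQ[OF nw] x by simp
    moreover have "0 \<le> f (Q w' *v x)" if "w' \<in> W" for w'
      using f0 nQ[of w' x] that W(1) x by auto
    ultimately show ?thesis
      unfolding F_def by (intro sum_pos2[OF W(2) w(1)])
  qed
  obtain z where z: "z \<in> unit_sphere" "\<And>x. x \<in> unit_sphere \<Longrightarrow> F z \<le> F x"
    using continuous_attains_inf[OF compact_sphere _ cF] v by (metis empty_iff mem_sphere_0)
  have "F z = (\<integral>x. F z \<partial>\<sigma>)" by (simp add: prob_space)
  also have "\<dots> \<le> (\<integral>x. F x \<partial>\<sigma>)"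
    using z by (intro integral_mono integrable_sigma[OF cF])
      (auto simp: space_sphere_measure[OF sphere_measure_sigma])
  also have "\<dots> = (\<Sum>w\<in>W. \<integral>x. f (Q w *v x) \<partial>\<sigma>)"
    unfolding F_def by (intro Bochner_Integration.integral_sum integrable_sigma cQ)
  also have "\<dots> = (\<Sum>w\<in>W. 0)"
  proof (rule sum.cong[OF refl])
    fix w assume "w \<in> W"
    then have "norm w = 1" using W(1) by auto
    then show "(\<integral>x. f (Q w *v x) \<partial>\<sigma>) = 0"
      using integral_rotation[OF Q(1) measurable_sphere[OF sphere_measure_sigma f]] int by simp
  qed
  finally show False using pos[of z] z(1) by simp
qed

text \<open>Harmonic decomposition extends the orthogonality to homogeneous polynomials, closure
  under products to all polynomials, and uniform approximation to \<open>f\<close> itself; the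
  integral of \<open>f\<^sup>2\<close> is then 0.\<close>

lemma orthogonal_to_harmonics_imp_zero:
  fixes f :: "real^'n \<Rightarrow> real"
  assumes f: "continuous_on unit_sphere f"
    and orth: "\<And>l h. hom_poly l h \<Longrightarrow> \<forall>x. laplace h x = 0 \<Longrightarrow> (\<integral>x. f x * h x \<partial>\<sigma>) = 0"
    and v: "norm v = 1"
  shows "f v = 0"
proof -
  have form: "(\<integral>x. f x * p x \<partial>\<sigma>) = 0" if "hom_poly n p" for n and p :: "real^'n \<Rightarrow> real"
    using that
  proof (induction n arbitrary: p rule: less_induct)
    case (less n)
    obtain h where h: "hom_poly n h" "\<And>x. laplace h x = 0" "n < 2 \<Longrightarrow> p = h"
        "2 \<le> n \<Longrightarrow> \<exists>q. hom_poly (n - 2) q \<and> (\<forall>x. p x = h x + (norm x)\<^sup>2 * q x)"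
      using harmonic_decomposition[OF less.prems] by blast
    show ?case
    proof (cases "n < 2")
      case True
      then show ?thesis using orth[OF h(1)] h by simp
    next
      case False
      then obtain q where q: "hom_poly (n - 2) q" "\<And>x. p x = h x + (norm x)\<^sup>2 * q x" using h(4) by auto
      have "(\<integral>x. f x * p x \<partial>\<sigma>) = (\<integral>x. f x * h x + f x * q x \<partial>\<sigma>)"
        by (rule integral_sphere_cong[OF sphere_measure_sigma]) (simp add: q(2) algebra_simps)
      also have "\<dots> = (\<integral>x. f x * h x \<partial>\<sigma>) + (\<integral>x. f x * q x \<partial>\<sigma>)"
        by (intro Bochner_Integration.integral_add integrable_sigma continuous_on_mult f
            hom_poly_continuous[OF h(1)] hom_poly_continuous[OF q(1)])
      also have "\<dots> = 0" using orth[OF h(1)] h(2) less.IH[OF _ q(1)] False by simp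
      finally show ?thesis .
    qed
  qed
  \<comment> \<open>\<open>real_polynomial_function\<close> is closed under products, and plain
    orthogonality would not survive that induction step. Allowing an arbitrary homogeneous factor
    \<open>p\<close> makes the property stable under multiplication by polynomials.\<close>
  define good where "good q \<longleftrightarrow> continuous_on unit_sphere q \<and>
      (\<forall>n p. hom_poly n p \<longrightarrow> (\<integral>x. f x * (q x * p x) \<partial>\<sigma>) = 0)" for q :: "real^'n \<Rightarrow> real"
  have mult_hom_poly: "good (\<lambda>x. g x * q x)" if "hom_poly m g" "good q" for g q m
    unfolding good_def
  proof (intro conjI allI impI)
    show "continuous_on unit_sphere (\<lambda>x. g x * q x)"
      using that(2) by (intro continuous_on_mult hom_poly_continuous[OF that(1)]) (simp add: good_def)
    fix n and p :: "real^'n \<Rightarrow> real" assume "hom_poly n p"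
    then have "(\<integral>x. f x * (q x * (g x * p x)) \<partial>\<sigma>) = 0"
      using that hom_poly_mult unfolding good_def by blast
    then show "(\<integral>x. f x * (g x * q x * p x) \<partial>\<sigma>) = 0" by (simp add: mult_ac)
  qed
  have mult: "good (\<lambda>x. g x * q x)" if "real_polynomial_function g" "good q" for g q
    using that
  proof (induction arbitrary: q)
    case (linear g)
    have "g = (\<lambda>x. \<Sum>i\<in>UNIV. g (axis i 1) * x $ i)"
    proof
      fix x :: "real^'n"
      have "g x = g (\<Sum>i\<in>UNIV. x $ i *\<^sub>R axis i 1)"
        using basis_expansion[of x] by (simp add: scalar_mult_eq_scaleR)
      also have "\<dots> = (\<Sum>i\<in>UNIV. g (axis i 1) * x $ i)"
        using bounded_linear.linear[OF linear(1)] by (simp add: linear_sum linear_cmul mult.commute)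
      finally show "g x = (\<Sum>i\<in>UNIV. g (axis i 1) * x $ i)" .
    qed
    moreover have "hom_poly 1 (\<lambda>x. \<Sum>i\<in>UNIV. g (axis i 1) * x $ i)"
      by (intro hom_poly_sum hom_poly_cmult hom_poly_coord)
    ultimately have "hom_poly 1 g" by simp
    then show ?case using linear(2) by (rule mult_hom_poly)
  next
    case (const c)
    then show ?case by (intro mult_hom_poly[OF hom_poly_const])
  next
    case (add g1 g2)
    have g: "good (\<lambda>x. g1 x * q x)" "good (\<lambda>x. g2 x * q x)" using add by auto
    show ?case
      unfolding good_def
    proof (intro conjI allI impI)
      show "continuous_on unit_sphere (\<lambda>x. (g1 x + g2 x) * q x)"
        using g unfolding distrib_right good_def by (intro continuous_on_add) auto
      fix n and p :: "real^'n \<Rightarrow> real" assume p: "hom_poly n p"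
      have "(\<integral>x. f x * ((g1 x + g2 x) * q x * p x) \<partial>\<sigma>)
          = (\<integral>x. f x * (g1 x * q x * p x) + f x * (g2 x * q x * p x) \<partial>\<sigma>)"
        by (simp add: algebra_simps)
      also have "\<dots> = (\<integral>x. f x * (g1 x * q x * p x) \<partial>\<sigma>) + (\<integral>x. f x * (g2 x * q x * p x) \<partial>\<sigma>)"
      proof (intro Bochner_Integration.integral_add integrable_sigma continuous_on_mult[OF f])
        show "continuous_on unit_sphere (\<lambda>x. g1 x * q x * p x)" "continuous_on unit_sphere (\<lambda>x. g2 x * q x * p x)"
          using g by (auto simp: good_def intro!: continuous_on_mult[OF _ hom_poly_continuous[OF p]])
      qed
      finally show "(\<integral>x. f x * ((g1 x + g2 x) * q x * p x) \<partial>\<sigma>) = 0"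
        using g p by (simp add: good_def)
    qed
  next
    case (mult g1 g2)
    then have "good (\<lambda>x. g1 x * (g2 x * q x))" by blast
    then show ?case by (simp add: mult.assoc)
  qed
  have poly: "(\<integral>x. f x * g x \<partial>\<sigma>) = 0" if "real_polynomial_function g" for g
  proof -
    have "good (\<lambda>x. 1)" using form by (simp add: good_def)
    from mult[OF that this] have "(\<integral>x. f x * (g x * 1 * 1) \<partial>\<sigma>) = 0"
      using hom_poly_const[of 1] unfolding good_def by blast
    then show ?thesis by simp
  qed
  obtain B where B: "0 < B" "\<And>x. norm x = 1 \<Longrightarrow> \<bar>f x\<bar> \<le> B"
    using continuous_on_sphere_bounded[OF f] by blast
  have "(\<integral>x. f x * f x \<partial>\<sigma>) \<le> 0 + e" if e: "0 < e" for e
  proof -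
    obtain g where g: "real_polynomial_function g" "\<And>x. x \<in> unit_sphere \<Longrightarrow> \<bar>f x - g x\<bar> < e / B"
      using Stone_Weierstrass_real_polynomial_function[OF compact_sphere f, of "e / B"] e B(1) by auto
    have cg: "continuous_on unit_sphere g"
      using g(1) continuous_on_polymonial_function by (auto simp: real_polynomial_function_eq)
    \<comment> \<open>Subtracting the vanishing integral of \<open>f x * g x\<close> leaves
      \<open>f\<close> times the approximation error, at most \<open>B * (e / B)\<close>.\<close>
    have "(\<integral>x. f x * f x \<partial>\<sigma>) = (\<integral>x. f x * f x \<partial>\<sigma>) - (\<integral>x. f x * g x \<partial>\<sigma>)" using poly[OF g(1)] by simp
    also have "\<dots> = (\<integral>x. f x * (f x - g x) \<partial>\<sigma>)"
      unfolding right_diff_distrib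
      by (rule Bochner_Integration.integral_diff[symmetric]) (intro integrable_sigma continuous_on_mult f cg)+
    also have "\<dots> \<le> \<bar>\<dots>\<bar>" by simp
    also have "\<dots> \<le> B * (e / B)"
    proof (rule abs_integral_sigma_le)
      fix x :: "real^'n" assume x: "norm x = 1"
      then show "\<bar>f x * (f x - g x)\<bar> \<le> B * (e / B)"
        unfolding abs_mult using B(1) B(2)[OF x] g(2)[of x] by (intro mult_mono) auto
    qed (intro continuous_intros f cg)
    finally show ?thesis using B(1) by simp
  qed
  then have "(\<integral>x. f x * f x \<partial>\<sigma>) \<le> 0" by (rule field_le_epsilon)
  moreover have "0 \<le> (\<integral>x. f x * f x \<partial>\<sigma>)" by (rule integral_nonneg_AE) simp
  ultimately have "(\<integral>x. f x * f x \<partial>\<sigma>) = 0" by simp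
  then have "f v * f v = 0"
    using v by (intro nonneg_integral_zero_imp_zero[of "\<lambda>x. f x * f x"] continuous_on_mult f) auto
  then show ?thesis by simp
qed

end

section \<open>Fubini for signed measures and the equivalences\<close>

lemma sphere_measure_variation:
  fixes \<mu> :: "'a::euclidean_space set \<Rightarrow> real"
  assumes "finite_signed_measure borel_sphere \<mu>"
  shows "sphere_measure (positive_variation borel_sphere \<mu>)"
    and "sphere_measure (negative_variation borel_sphere \<mu>)"
  using assms finite_signed_measure_uminus[OF assms]
  by (simp_all add: sphere_measure_def finite_measure_positive_variation negative_variation_def)

lemma sphere_measure_surface_area:
  fixes K :: "'a::euclidean_space set"
  assumes "convex_body K" "2 \<le> DIM('a)"
  shows "sphere_measure (surface_area_measure K)"
  using finite_surface_area_measure[OF assms] by (simp add: sphere_measure_def)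

lemma signed_integral_cong:
  fixes \<mu> :: "'a::euclidean_space set \<Rightarrow> real"
  assumes \<mu>: "finite_signed_measure borel_sphere \<mu>" and fg: "\<And>x. norm x = 1 \<Longrightarrow> f x = g x"
  shows "signed_integral borel_sphere \<mu> f = signed_integral borel_sphere \<mu> g"
  unfolding signed_integral_def
  using integral_sphere_cong[OF sphere_measure_variation(1)[OF \<mu>] fg]
    integral_sphere_cong[OF sphere_measure_variation(2)[OF \<mu>] fg] by simp

lemma signed_sphere_fubini:
  fixes k :: "'a::euclidean_space \<Rightarrow> 'a \<Rightarrow> real"
  assumes \<mu>: "finite_signed_measure borel_sphere \<mu>" and N: "sphere_measure N"
    and k: "continuous_on (unit_sphere \<times> unit_sphere) (case_prod k)"
  shows "(\<integral>v. signed_integral borel_sphere \<mu> (\<lambda>u. k u v) \<partial>N) = signed_integral borel_sphere \<mu> (\<lambda>u. \<integral>v. k u v \<partial>N)"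
proof -
  note P = sphere_measure_variation[OF \<mu>]
  have "(\<integral>v. signed_integral borel_sphere \<mu> (\<lambda>u. k u v) \<partial>N)
      = (\<integral>v. (\<integral>u. k u v \<partial>positive_variation borel_sphere \<mu>) \<partial>N)
        - (\<integral>v. (\<integral>u. k u v \<partial>negative_variation borel_sphere \<mu>) \<partial>N)"
    unfolding signed_integral_def
    by (intro Bochner_Integration.integral_diff integrable_sphere[OF N] continuous_on_sphere_integral P k)
  then show ?thesis
    unfolding signed_integral_def sphere_fubini[OF P(1) N k] sphere_fubini[OF P(2) N k] .
qed

lemma continuous_on_T_op:
  fixes \<mu> :: "'a::euclidean_space set \<Rightarrow> real"
  assumes \<mu>: "finite_signed_measure borel_sphere \<mu>" and \<psi>: "continuous_on {-1..1} \<psi>"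
  shows "continuous_on unit_sphere (T_op \<psi> \<mu>)"
  unfolding T_op_def signed_integral_def
  by (intro continuous_on_diff continuous_on_sphere_integral sphere_measure_variation[OF \<mu>] continuous_on_zonal[OF \<psi>])

lemma T_op_even:
  fixes \<mu> :: "'a::euclidean_space set \<Rightarrow> real"
  assumes \<mu>: "finite_signed_measure borel_sphere \<mu>"
    and even: "\<And>t. t \<in> {-1..1} \<Longrightarrow> \<psi> (- t) = \<psi> t" and v: "norm v = 1"
  shows "T_op \<psi> \<mu> (- v) = T_op \<psi> \<mu> v"
  unfolding T_op_def
  by (rule signed_integral_cong[OF \<mu>]) (use even[OF inner_unit_range[OF _ v]] in simp)

lemma signed_integral_const:
  fixes \<mu> :: "'a::euclidean_space set \<Rightarrow> real"
  assumes \<mu>: "finite_signed_measure borel_sphere \<mu>"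
  shows "signed_integral borel_sphere \<mu> (\<lambda>_. c) = c * \<mu> unit_sphere"
proof -
  have sp: "space borel_sphere = (unit_sphere :: 'a set)" by (simp add: borel_sphere_def space_restrict_space)
  show ?thesis
    using measure_variation_diff[OF \<mu>]
    by (simp add: signed_integral_def sp negative_variation_def algebra_simps flip: right_diff_distrib)
qed

lemma signed_integral_cmult:
  "signed_integral M \<mu> (\<lambda>x. c * f x) = c * signed_integral M \<mu> f"
  by (simp add: signed_integral_def right_diff_distrib)

theorem theorem3p4:
  fixes \<sigma> :: "(real^'n) measure"
    and \<psi> :: "real \<Rightarrow> real"
    and \<mu> :: "(real^'n) set \<Rightarrow> real"
  assumes dim: "CARD('n) \<ge> 2"
    and sigma: "is_spherical_prob \<sigma>"
    and psi_cont: "continuous_on {-1..1} \<psi>"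
    and psi_even: "\<And>t. t \<in> {-1..1} \<Longrightarrow> \<psi> (- t) = \<psi> t"
    and mu: "finite_signed_measure borel_sphere \<mu>"
    and mu_total: "\<mu> unit_sphere = 1"
  shows "((\<forall>K. convex_body K \<longrightarrow>
             signed_integral borel_sphere \<mu> (B_op \<psi> K) = (\<integral>u. B_op \<psi> K u \<partial>\<sigma>))
          \<longleftrightarrow> (\<forall>v\<in>unit_sphere. T_op \<psi> \<mu> v = multiplier \<sigma> \<psi> 0)) \<and>
         ((\<forall>v\<in>unit_sphere. T_op \<psi> \<mu> v = multiplier \<sigma> \<psi> 0)
          \<longleftrightarrow> (\<forall>l\<ge>1. \<forall>Y\<in>spherical_harmonics l.
                 multiplier \<sigma> \<psi> l * signed_integral borel_sphere \<mu> Y = 0)) \<and>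
         ((\<forall>l\<ge>1. \<forall>Y\<in>spherical_harmonics l.
             multiplier \<sigma> \<psi> l * signed_integral borel_sphere \<mu> Y = 0)
          \<longleftrightarrow> (\<forall>l\<in>active_spectrum \<sigma> \<psi>. \<forall>Y\<in>spherical_harmonics l.
                 signed_integral borel_sphere \<mu> Y = 0))"
    (is "(?i \<longleftrightarrow> ?ii) \<and> (?ii \<longleftrightarrow> ?iii) \<and> (?iii \<longleftrightarrow> ?iv)")
proof (intro conjI)
  interpret spherical_prob \<sigma> by unfold_locales (use sigma dim in auto)
  let ?lam = "multiplier \<sigma> \<psi>"
  let ?T = "T_op \<psi> \<mu>"
  let ?J = "signed_integral borel_sphere \<mu>"
  have dim': "2 \<le> DIM(real^'n)" using dim by simp
  have cT: "continuous_on unit_sphere ?T" by (rule continuous_on_T_op[OF mu psi_cont])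
  have ck: "continuous_on (unit_sphere \<times> unit_sphere) (\<lambda>(u :: real^'n, v). \<psi> (u \<bullet> v))"
    by (rule continuous_on_zonal[OF psi_cont])
  show "?iii \<longleftrightarrow> ?iv" by (auto simp: active_spectrum_def)

  \<comment> \<open>Fubini moves the kernel from \<mu> onto the harmonic, where the Funk-Hecke
    formula applies.\<close>
  have T_harmonic: "(\<integral>v. ?T v * p v \<partial>\<sigma>) = ?lam l * ?J p" if p: "hom_poly l p" "\<forall>x. laplace p x = 0" for l p
  proof -
    have cp: "continuous_on S p" for S by (rule hom_poly_continuous[OF p(1)])
    have ckp: "continuous_on (unit_sphere \<times> unit_sphere) (\<lambda>(u, v). p v * \<psi> (u \<bullet> v))"
      using ck unfolding split_beta
      by (intro continuous_on_mult continuous_on_compose2[OF cp[of UNIV]] continuous_intros) auto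
    have "(\<integral>v. ?T v * p v \<partial>\<sigma>) = (\<integral>v. ?J (\<lambda>u. p v * \<psi> (u \<bullet> v)) \<partial>\<sigma>)"
      by (simp add: T_op_def signed_integral_cmult mult.commute)
    also have "\<dots> = ?J (\<lambda>u. \<integral>v. p v * \<psi> (u \<bullet> v) \<partial>\<sigma>)"
      by (rule signed_sphere_fubini[OF mu sphere_measure_sigma ckp])
    also have "\<dots> = ?J (\<lambda>u. ?lam l * p u)"
      using multiplier_eq[OF psi_cont p] by (intro signed_integral_cong[OF mu]) (simp add: mult.commute)
    finally show ?thesis by (simp add: signed_integral_cmult)
  qed
  have iii_iff: "?iii \<longleftrightarrow> (\<forall>l\<ge>1. \<forall>p. hom_poly l p \<longrightarrow> (\<forall>x. laplace p x = 0) \<longrightarrow> ?lam l * ?J p = 0)"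
  proof -
    have "?J (restrict p unit_sphere) = ?J p" for p
      by (rule signed_integral_cong[OF mu]) simp
    then show ?thesis unfolding Ball_def spherical_harmonics_iff by (metis (no_types, lifting))
  qed
  show "?ii \<longleftrightarrow> ?iii"
  proof
    assume ii: ?ii
    have "?lam l * ?J p = 0" if "1 \<le> l" and p: "hom_poly l p" "\<forall>x. laplace p x = 0" for l p
    proof -
      have "?lam l * ?J p = (\<integral>v. ?lam 0 * p v \<partial>\<sigma>)"
        unfolding T_harmonic[OF p, symmetric] using ii
        by (intro integral_sphere_cong[OF sphere_measure_sigma]) simp
      then show ?thesis using integral_harmonic_zero[OF p that(1)] by simp
    qed
    then show ?iii unfolding iii_iff by blast
  next
    assume iii: ?iii
    have "?T v - ?lam 0 = 0" if v: "norm v = 1" for v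
    proof (rule orthogonal_to_harmonics_imp_zero[where f = "\<lambda>v. ?T v - ?lam 0"])
      fix l and h :: "real^'n \<Rightarrow> real" assume h: "hom_poly l h" "\<forall>x. laplace h x = 0"
      have "(\<integral>x. (?T x - ?lam 0) * h x \<partial>\<sigma>) = (\<integral>x. ?T x * h x \<partial>\<sigma>) - (\<integral>x. ?lam 0 * h x \<partial>\<sigma>)"
        unfolding left_diff_distrib
        by (intro Bochner_Integration.integral_diff integrable_sigma continuous_on_mult cT
            continuous_on_const hom_poly_continuous[OF h(1)])
      also have "\<dots> = ?lam l * ?J h - ?lam 0 * (\<integral>x. h x \<partial>\<sigma>)" by (simp add: T_harmonic[OF h])
      also have "\<dots> = 0"
      proof (cases "1 \<le> l")
        case True
        then show ?thesis using iii h integral_harmonic_zero[OF h] unfolding iii_iff by auto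
      next
        \<comment> \<open>In degree 0 the total mass 1 of \<mu> matches that of \<sigma>, and the
          two constant terms cancel.\<close>
        case False
        then have "l = 0" by simp
        moreover from this obtain c where "h = (\<lambda>_. c)" using hom_poly_0_const[of h] h by auto
        ultimately show ?thesis using mu_total by (simp add: signed_integral_const[OF mu] prob_space)
      qed
      finally show "(\<integral>x. (?T x - ?lam 0) * h x \<partial>\<sigma>) = 0" .
    qed (use v in \<open>auto intro!: continuous_intros cT\<close>)
    then show ?ii by simp
  qed

  \<comment> \<open>Fubini with respect to \<mu> and to \<sigma> turns the defect in (i) into half
    the integral of \<open>?T v - ?lam 0\<close> over the surface area measure; both directions of
    the first equivalence use this formula.\<close>
  have diff: "?J (B_op \<psi> K) - (\<integral>u. B_op \<psi> K u \<partial>\<sigma>) = 1/2 * (\<integral>v. ?T v - ?lam 0 \<partial>surface_area_measure K)"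
    if K: "convex_body K" for K
  proof -
    note S = sphere_measure_surface_area[OF K dim']
    have "?J (B_op \<psi> K) = 1/2 * (\<integral>v. ?T v \<partial>surface_area_measure K)"
      unfolding B_op_def signed_integral_cmult T_op_def signed_sphere_fubini[OF mu S ck] ..
    moreover have "(\<integral>u. B_op \<psi> K u \<partial>\<sigma>) = 1/2 * (\<integral>v. ?lam 0 \<partial>surface_area_measure K)"
    proof -
      have "(\<integral>u. B_op \<psi> K u \<partial>\<sigma>) = 1/2 * (\<integral>v. (\<integral>u. \<psi> (u \<bullet> v) \<partial>\<sigma>) \<partial>surface_area_measure K)"
        unfolding B_op_def sphere_fubini[OF sphere_measure_sigma S ck] by simp
      also have "(\<integral>v. (\<integral>u. \<psi> (u \<bullet> v) \<partial>\<sigma>) \<partial>surface_area_measure K) = (\<integral>v. ?lam 0 \<partial>surface_area_measure K)"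
        using multiplier_0[OF psi_cont] by (intro integral_sphere_cong[OF S]) (simp add: inner_commute)
      finally show ?thesis .
    qed
    moreover have "(\<integral>v. ?T v - ?lam 0 \<partial>surface_area_measure K)
        = (\<integral>v. ?T v \<partial>surface_area_measure K) - (\<integral>v. ?lam 0 \<partial>surface_area_measure K)"
      by (intro Bochner_Integration.integral_diff integrable_sphere[OF S] cT continuous_on_const)
    ultimately show ?thesis by simp
  qed
  show "?i \<longleftrightarrow> ?ii"
  proof
    assume i: ?i
    have "?T v - ?lam 0 = 0" if v: "norm v = 1" for v
    proof (rule even_function_zero_if_surface_integrals_zero[OF dim' v, where g = "\<lambda>v. ?T v - ?lam 0"])
      show "?T (- v) - ?lam 0 = ?T v - ?lam 0" using T_op_even[OF mu _ v, of \<psi>] psi_even by simp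
      show "(\<integral>v. ?T v - ?lam 0 \<partial>surface_area_measure K) = 0" if "convex_body K" for K
        using diff[OF that] i that by simp
    qed (intro continuous_intros cT)
    then show ?ii by simp
  next
    assume ii: ?ii
    have "?J (B_op \<psi> K) = (\<integral>u. B_op \<psi> K u \<partial>\<sigma>)" if K: "convex_body K" for K
    proof -
      have "(\<integral>v. ?T v - ?lam 0 \<partial>surface_area_measure K) = (\<integral>v. 0 \<partial>surface_area_measure K)"
        using ii by (intro integral_sphere_cong[OF sphere_measure_surface_area[OF K dim']]) simp
      then show ?thesis using diff[OF K] by simp
    qed
    then show ?i by blast
  qed
qed

end
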